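(* For $|q|<1$, $$\mathrm{C}\Phi_7(q)=\frac{1}{(q;q)_\infty^7}\left(1-\frac78\sum_{k=1}^\infty\Big(\frac k7\Big)\frac{k^2q^k}{1-q^k}+\frac{343}{8}\sum_{k=1}^\infty\Big(\frac k7\Big)\frac{q^k+q^{2k}}{(1-q^k)^3}\right)$$ $$=\frac{1}{(q^7;q^7)_\infty}+49q\frac{(q^7;q^7)_\infty^3}{(q;q)_\infty^4}+343q^2\frac{(q^7;q^7)_\infty^7}{(q;q)_\infty^8}=\frac{1}{(q^7;q^7)_\infty}+7\sum_{j=1}^\infty p(7j-2)q^j.$$
   Context: A $k$-colored generalized Frobenius symbol is a two-row array with $d\ge 0$ columns whose entries are colored nonnegative integers $\ell_c$ ($\ell\ge 0$, color $c\in\{1,\dots,k\}$), each row strictly decreasing with respect to the total order $0_1\prec 0_2\prec\cdots\prec 0_k\prec 1_1\prec\cdots\prec 1_k\prec 2_1\prec\cdots$. It is a $k$-colored generalized Frobenius partition of $n=d+\sum(\text{integer values of all entries})$. $c\phi_k(n)$ is the number of such partitions of $n$ (with $c\phi_k(0)=1$), and $\mathrm{C}\Phi_k(q)=\sum_{n\ge0}c\phi_k(n)q^n$. $(a;q)_\infty=\prod_{j\ge1}(1-aq^{j-1})$, $p(n)$ is the number of ordinary partitions of $n$, and $\left(\frac{k}{7}\right)$ is the Legendre symbol. *)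

theory Defs
  imports
    "HOL-Analysis.Analysis"
    "HOL-Library.Multiset"
    "HOL-Number_Theory.Number_Theory"
begin

text \<open>
  The colored integer \<open>l\<close> of color \<open>c\<close> is the pair \<open>(l, c)\<close>; the total order on colored
  integers compares the values first and the colors second.
\<close>

type_synonym colored_nat = "nat \<times> nat"

definition colored_less :: "colored_nat \<Rightarrow> colored_nat \<Rightarrow> bool" where
  "colored_less x y \<longleftrightarrow> fst x < fst y \<or> fst x = fst y \<and> snd x < snd y"

definition gen_frobenius_row :: "nat \<Rightarrow> colored_nat list \<Rightarrow> bool" where
  "gen_frobenius_row k r \<longleftrightarrow>
     (\<forall>x\<in>set r. snd x \<in> {1..k}) \<and> sorted_wrt (\<lambda>x y. colored_less y x) r"

definition gen_frobenius_symbols :: "nat \<Rightarrow> (colored_nat list \<times> colored_nat list) set" where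
  "gen_frobenius_symbols k =
     {(r, s). gen_frobenius_row k r \<and> gen_frobenius_row k s \<and> length r = length s}"

definition gen_frobenius_size :: "colored_nat list \<times> colored_nat list \<Rightarrow> nat" where
  "gen_frobenius_size = (\<lambda>(r, s). length r + (\<Sum>x\<leftarrow>r. fst x) + (\<Sum>x\<leftarrow>s. fst x))"

definition cphi :: "nat \<Rightarrow> nat \<Rightarrow> nat" where
  "cphi k n = card {F \<in> gen_frobenius_symbols k. gen_frobenius_size F = n}"

definition CPhi :: "nat \<Rightarrow> complex \<Rightarrow> complex" where
  "CPhi k q = (\<Sum>n. of_nat (cphi k n) * q ^ n)"

definition qpoch_inf :: "complex \<Rightarrow> complex \<Rightarrow> complex" where
  "qpoch_inf a q = (\<Prod>j. 1 - a * q ^ j)"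

definition partition_number :: "nat \<Rightarrow> nat" where
  "partition_number n = card {M :: nat multiset. 0 \<notin># M \<and> sum_mset M = n}"

lemma finite_gen_frobenius_partitions:
  "finite {F \<in> gen_frobenius_symbols k. gen_frobenius_size F = n}"
proof -
  let ?A = "{0..n} \<times> {1..k}"
  let ?L = "{xs. set xs \<subseteq> ?A \<and> length xs \<le> n}"
  have "finite ?L" by (rule finite_lists_length_le) simp
  moreover have "{F \<in> gen_frobenius_symbols k. gen_frobenius_size F = n} \<subseteq> ?L \<times> ?L"
  proof
    fix F assume F: "F \<in> {F \<in> gen_frobenius_symbols k. gen_frobenius_size F = n}"
    obtain r s where rs: "F = (r, s)" by (cases F)
    have le: "fst x \<le> (\<Sum>x\<leftarrow>xs. fst x)" if "x \<in> set xs" for x :: colored_nat and xs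
      using that by (intro member_le_sum_list) auto
    have sz: "length r + (\<Sum>x\<leftarrow>r. fst x) + (\<Sum>x\<leftarrow>s. fst x) = n" "length r = length s"
      and col: "\<forall>x\<in>set r. snd x \<in> {1..k}" "\<forall>x\<in>set s. snd x \<in> {1..k}"
      using F by (auto simp: rs gen_frobenius_symbols_def gen_frobenius_size_def
          gen_frobenius_row_def)
    have "set r \<subseteq> ?A" "set s \<subseteq> ?A"
      using le[of _ r] le[of _ s] sz col by (fastforce simp: mem_Times_iff)+
    then show "F \<in> ?L \<times> ?L" using sz by (auto simp: rs)
  qed
  ultimately show ?thesis by (meson finite_SigmaI finite_subset)
qed

lemma cphi_0: "cphi k 0 = 1"
proof -
  have "{F \<in> gen_frobenius_symbols k. gen_frobenius_size F = 0} = {([], [])}"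
    by (auto simp: gen_frobenius_symbols_def gen_frobenius_size_def gen_frobenius_row_def)
  then show ?thesis by (simp add: cphi_def)
qed

lemma finite_partitions: "finite {M :: nat multiset. 0 \<notin># M \<and> sum_mset M = n}"
proof (rule finite_subset)
  let ?L = "{xs. set xs \<subseteq> {0..n} \<and> length xs \<le> n}"
  show "finite (mset ` ?L)" by (intro finite_imageI finite_lists_length_le) simp
  show "{M :: nat multiset. 0 \<notin># M \<and> sum_mset M = n} \<subseteq> mset ` ?L"
  proof
    fix M :: "nat multiset" assume M: "M \<in> {M. 0 \<notin># M \<and> sum_mset M = n}"
    obtain xs where xs: "M = mset xs" by (metis ex_mset)
    have "0 \<notin> set xs \<Longrightarrow> length xs \<le> sum_list xs" for xs :: "nat list"
      by (induction xs) auto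
    then have "length xs \<le> n" using M by (auto simp: xs sum_mset_sum_list)
    moreover have "set xs \<subseteq> {0..n}"
      using M member_le_sum_list[of _ xs] by (auto simp: xs sum_mset_sum_list)
    ultimately show "M \<in> mset ` ?L" by (auto simp: xs)
  qed
qed

lemma convergent_qpoch_inf:
  assumes "norm q < 1"
  shows "convergent_prod (\<lambda>j. 1 - a * q ^ j :: complex)"
proof -
  have "summable (\<lambda>j. norm (- a * q ^ j))"
    using assms by (simp add: norm_mult norm_power summable_mult summable_geometric)
  then have "abs_convergent_prod (\<lambda>j. 1 + - a * q ^ j)"
    by (simp add: summable_imp_abs_convergent_prod)
  then show ?thesis
    using abs_convergent_prod_imp_convergent_prod by fastforce
qed

end

theory Submission
  imports Defs "HOL-Complex_Analysis.Complex_Analysis"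
begin

text \<open>
  Write \<open>E = (q;q)\<close>, \<open>E\<^sub>7 = (q\<^sup>7;q\<^sup>7)\<close> and \<open>\<theta>(z) = (q;q) (z;q) (q/z;q)\<close>.  By the Jacobi triple product
  \<open>\<theta>(xy) \<theta>(x/y)\<close> is a \<open>2 \<times> 2\<close> determinant in \<open>x\<close> and \<open>y\<close>, which gives the three-term relation; its
  derivatives express the Lambert series \<open>\<Sum> x(1+x)/(1-x)\<^sup>3\<close> over \<open>x = z q\<^sup>n\<close> as
  \<open>E\<^sup>9 z \<theta>(z\<^sup>2) / \<theta>(z)\<^sup>4\<close>.

  For a point of order 7 the values \<open>x, y, z\<close> of \<open>\<theta>\<close> at its multiples 1, 2, 4 lie on Klein's quartic
  \<open>x\<^sup>3y + y\<^sup>3z + z\<^sup>3x = 0\<close>.  The Weierstrass cubic is determined by its values at these three points;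
  comparing its discriminant with the product formula coming from the points of order 2 evaluates
  \<open>T = -(y\<^sup>2z/x\<^sup>3 + z\<^sup>2x/y\<^sup>3 + x\<^sup>2y/z\<^sup>3)\<close>: it is \<open>8 + 49 q E\<^sub>7\<^sup>4/E\<^sup>4\<close> for the nome \<open>q\<close> and the seventh
  roots of unity, and \<open>8 + E\<^sup>4/(q E\<^sub>7\<^sup>4)\<close> for the nome \<open>q\<^sup>7\<close> and the powers of \<open>q\<close>.  This evaluates the
  two Lambert series of the theorem.  Extracting the powers of \<open>q\<^sup>7\<close> from the second evaluation, where
  the Lambert series is an eigenfunction, yields the generating function of \<open>p(7j - 2)\<close>.

  Finally the generating function of the symbols is the constant term of \<open>(\<theta>(z)/E)\<^sup>7\<close>.  The mean of
  \<open>\<theta>(\<zeta>z)\<^sup>7\<close> over the seventh roots of unity \<open>\<zeta>\<close> is this constant term times \<open>E\<^sup>7 \<theta>(z\<^sup>7; q\<^sup>7)\<close>; differentiating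
  at \<open>z = 1\<close> expresses it through \<open>x, y, z\<close>, hence as a quadratic polynomial in \<open>T\<close>.
\<close>

section \<open>Infinite q-products\<close>

text \<open>No modular forms enter; each evaluation compares two expressions for one elliptic
  object. The number 8 in \<open>T\<close> comes from Tate's normal form of a curve with a point of
  order 7: with d = -z^2 x / y^3 the three summands of \<open>T\<close> are d, 1/(1-d) and (d-1)/d,
  the discriminant of the normal form is d^7 (d-1)^7 (d^3 - 8 d^2 + 5 d + 1), and its last factor
  over d (d-1) is \<open>T\<close> - 8. With k = q E_7^4 / E^4 the two values of \<open>T\<close>
  are 8 + 49 k and 8 + 1/k, exchanged by k -> 1/(49 k). The quadratic polynomial of the last step is
  (T^2 - 9 T + 15)/7, which at T = 8 + 49 k equals 1 + 49 k + 343 k^2; these are the three terms of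
  the theorem. The obstacle in the constant term is that differentiating at z = 1 brings in
  derivatives of theta at the points of order 7, not only its values. The three-term relation gives
  three linear equations, of determinant 28, for the three logarithmic derivatives, which makes them
  rational in x, y, z. For the partitions, the eigenvalue equation contains two averages; the one of
  E^3 is known from the triple product, so that the other can be solved for.\<close>

abbreviation (input) euler :: "complex \<Rightarrow> complex" where
  "euler q \<equiv> qpoch_inf q q"

lemma qpoch_inf_LIMSEQ:
  assumes "norm q < 1"
  shows "(\<lambda>N. \<Prod>j<N. 1 - a * q ^ j) \<longlonglongrightarrow> qpoch_inf a q"
  unfolding qpoch_inf_def
  using convergent_prod_LIMSEQ[OF convergent_qpoch_inf[OF assms, of a]]
  by (simp add: LIMSEQ_lessThan_iff_atMost)

lemma qpoch_inf_eqI: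
  assumes "norm q < 1" "(\<lambda>N. \<Prod>j<N. 1 - a * q ^ j) \<longlonglongrightarrow> l"
  shows "qpoch_inf a q = l"
  using LIMSEQ_unique[OF qpoch_inf_LIMSEQ[OF assms(1)] assms(2)] .

lemma qpoch_inf_nonzero:
  assumes "norm q < 1" "\<And>j. a * q ^ j \<noteq> 1"
  shows "qpoch_inf a q \<noteq> 0"
  unfolding qpoch_inf_def
  by (rule prodinf_nonzero[OF convergent_qpoch_inf[OF assms(1)]]) (use assms(2) in force)

lemma qpoch_inf_rec:
  assumes "norm q < 1"
  shows "qpoch_inf a q = (1 - a) * qpoch_inf (a * q) q"
proof (rule qpoch_inf_eqI[OF assms])
  have "(\<lambda>N. \<Prod>j<Suc N. 1 - a * q ^ j) = (\<lambda>N. (1 - a) * (\<Prod>j<N. 1 - a * q * q ^ j))"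
    by (subst prod.lessThan_Suc_shift) (simp add: mult_ac)
  then have "(\<lambda>N. \<Prod>j<Suc N. 1 - a * q ^ j) \<longlonglongrightarrow> (1 - a) * qpoch_inf (a * q) q"
    using tendsto_mult_left[OF qpoch_inf_LIMSEQ[OF assms, of "a * q"], of "1 - a"] by simp
  then show "(\<lambda>N. \<Prod>j<N. 1 - a * q ^ j) \<longlonglongrightarrow> (1 - a) * qpoch_inf (a * q) q"
    by (rule LIMSEQ_imp_Suc)
qed

lemma qpoch_inf_1 [simp]:
  assumes "norm q < 1"
  shows "qpoch_inf 1 q = 0"
  using qpoch_inf_rec[OF assms, of 1] by simp

lemma power_eq_1_norm_less:
  fixes q :: complex
  assumes "norm q < 1" "n > 0"
  shows "q ^ n \<noteq> 1"
proof
  assume "q ^ n = 1"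
  then have "norm q ^ n = 1" by (metis norm_one norm_power)
  moreover have "norm q ^ n < 1" using assms by (simp add: power_less_one_iff)
  ultimately show False by simp
qed

lemma qpoch_inf_self_nonzero:
  assumes "norm q < 1"
  shows "euler q \<noteq> 0"
  by (rule qpoch_inf_nonzero[OF assms])
    (use power_eq_1_norm_less[OF assms, of "Suc _"] in simp)

lemma qpoch_inf_uniform_limit:
  assumes q: "norm q < 1"
  shows "uniform_limit (cball 0 R) (\<lambda>N z. \<Prod>j<N. 1 - z * q ^ j) (\<lambda>z. qpoch_inf z q) sequentially"
proof -
  have "uniformly_convergent_on (cball 0 R) (\<lambda>N z. \<Sum>j<N. norm (1 - z * q ^ j - 1))"
  proof (rule Weierstrass_m_test'[where M = "\<lambda>j. \<bar>R\<bar> * norm q ^ j"])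
    show "summable (\<lambda>j. \<bar>R\<bar> * norm q ^ j)"
      using q by (intro summable_mult summable_geometric) simp
    fix j :: nat and z :: complex
    assume "z \<in> cball 0 R"
    then have "norm z \<le> \<bar>R\<bar>" by auto
    then show "norm (norm (1 - z * q ^ j - 1)) \<le> \<bar>R\<bar> * norm q ^ j"
      by (simp add: norm_mult norm_power mult_right_mono)
  qed
  then have "uniformly_convergent_on (cball 0 R) (\<lambda>N z. \<Prod>j<N. 1 - z * q ^ j)"
    by (intro uniformly_convergent_on_prod') (auto intro!: continuous_intros)
  then have "uniform_limit (cball 0 R) (\<lambda>N z. \<Prod>j<N. 1 - z * q ^ j)
               (\<lambda>z. lim (\<lambda>N. \<Prod>j<N. 1 - z * q ^ j)) sequentially"
    by (simp add: uniformly_convergent_uniform_limit_iff)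
  then show ?thesis
    using limI[OF qpoch_inf_LIMSEQ[OF q]] by simp
qed

lemma qpoch_inf_holomorphic:
  assumes q: "norm q < 1"
  shows "(\<lambda>z. qpoch_inf z q) holomorphic_on UNIV"
proof (rule holomorphic_uniform_sequence[where f = "\<lambda>N z. \<Prod>j<N. 1 - z * q ^ j"])
  fix x :: complex
  have "uniform_limit (cball x 1) (\<lambda>N z. \<Prod>j<N. 1 - z * q ^ j) (\<lambda>z. qpoch_inf z q) sequentially"
    by (rule uniform_limit_on_subset[OF qpoch_inf_uniform_limit[OF q, of "norm x + 1"]])
      (simp add: cball_subset_cball_iff dist_norm)
  then show "\<exists>d>0. cball x d \<subseteq> UNIV \<and> uniform_limit (cball x d) (\<lambda>N z. \<Prod>j<N. 1 - z * q ^ j)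
      (\<lambda>z. qpoch_inf z q) sequentially"
    by (intro exI[of _ 1]) simp
qed (auto intro!: holomorphic_intros)

lemma qpoch_inf_holomorphic' [holomorphic_intros]:
  assumes "norm q < 1" "f holomorphic_on A"
  shows "(\<lambda>z. qpoch_inf (f z) q) holomorphic_on A"
  using holomorphic_on_compose_gen[OF assms(2) qpoch_inf_holomorphic[OF assms(1)]]
  by (simp add: o_def)

section \<open>Unconditional sums over the integers and limits under the sum\<close>

lemma summable_on_int_halves:
  fixes f :: "int \<Rightarrow> complex"
  assumes "summable (\<lambda>n. norm (f (int n)))" "summable (\<lambda>n. norm (f (- int n - 1)))"
  shows "f summable_on UNIV"
proof -
  have "f \<circ> int summable_on UNIV" "f \<circ> (\<lambda>n. - int n - 1) summable_on UNIV"
    using assms by (auto intro!: norm_summable_imp_summable_on simp: o_def)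
  moreover have "inj int" "inj (\<lambda>n. - int n - 1)"
    by (auto simp: inj_def)
  ultimately have "f summable_on range int" "f summable_on range (\<lambda>n. - int n - 1)"
    by (simp_all add: summable_on_reindex)
  then have "f summable_on (range int \<union> range (\<lambda>n. - int n - 1))"
    by (rule summable_on_union)
  also have "range int \<union> range (\<lambda>n. - int n - 1) = UNIV"
  proof -
    have "x \<in> range int \<union> range (\<lambda>n. - int n - 1)" for x
      by (cases "x \<ge> 0") (auto simp: image_iff intro: exI[of _ "nat x"] exI[of _ "nat (- x - 1)"])
    then show ?thesis by blast
  qed
  finally show ?thesis .
qed

lemma summable_on_norm_bound:
  fixes g :: "'b \<Rightarrow> complex"
  assumes "M summable_on A" "\<And>k. k \<in> A \<Longrightarrow> norm (g k) \<le> M k"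
  shows "g summable_on A"
  by (rule abs_summable_summable, rule summable_on_comparison_test[OF assms(1)])
    (use assms(2) in auto)

text \<open>Tannery's theorem: \<open>M\<close> dominates every \<open>a N\<close>, so one finite
  set carries all the sums up to e/4 on each tail, and on that set termwise convergence suffices. It
  carries the finite triple product to its limit.\<close>

lemma tannery_int:
  fixes a :: "nat \<Rightarrow> int \<Rightarrow> complex" and b :: "int \<Rightarrow> complex"
  assumes lim: "\<And>k. (\<lambda>N. a N k) \<longlonglongrightarrow> b k"
    and bound: "\<And>N k. norm (a N k) \<le> M k" and M: "M summable_on UNIV"
    and sum: "\<And>N. (a N has_sum s N) UNIV" and s: "s \<longlonglongrightarrow> l"
  shows "(b has_sum l) UNIV"
proof -
  have bb: "norm (b k) \<le> M k" for k
    by (rule LIMSEQ_le_const2[OF tendsto_norm[OF lim]]) (use bound in blast)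
  have bsum: "b summable_on UNIV"
    by (rule summable_on_norm_bound[OF M bb])
  have "l = infsum b UNIV"
  proof (rule LIMSEQ_unique[OF s], rule LIMSEQ_I)
    fix e :: real assume e: "e > 0"
    have Mpos: "M k \<ge> 0" for k using bb[of k] norm_ge_zero order_trans by blast
    obtain F where F: "finite F" "dist (sum M F) (infsum M UNIV) \<le> e / 4"
      using infsum_finite_approximation[OF M, of "e / 4"] e by auto
    have tail: "norm (infsum g (UNIV - F)) \<le> e / 4"
      if g: "\<And>k. norm (g k) \<le> M k" for g :: "int \<Rightarrow> complex"
    proof -
      have "infsum M UNIV = sum M F + infsum M (UNIV - F)"
        using infsum_Un_disjoint[of M F "UNIV - F"] F(1) summable_on_subset_banach[OF M] by simp
      moreover have "norm (infsum g (UNIV - F)) \<le> infsum M (UNIV - F)"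
        by (rule norm_infsum_le[OF has_sum_infsum has_sum_infsum])
          (use g summable_on_subset_banach[OF M] summable_on_norm_bound[OF M] in
           \<open>auto intro: summable_on_subset_banach\<close>)
      ultimately show ?thesis using F(2) by (auto simp: dist_norm)
    qed
    have split: "infsum g UNIV = sum g F + infsum g (UNIV - F)"
      if g: "g summable_on UNIV" for g :: "int \<Rightarrow> complex"
      using infsum_Un_disjoint[of g F "UNIV - F"] F(1) summable_on_subset_banach[OF g] by simp
    have "(\<lambda>N. sum (a N) F) \<longlonglongrightarrow> sum b F"
      by (intro tendsto_sum lim)
    then obtain N0 where N0: "\<And>N. N \<ge> N0 \<Longrightarrow> norm (sum (a N) F - sum b F) < e / 4"
      using LIMSEQ_D[of _ _ "e / 4"] e by fastforce
    show "\<exists>N0. \<forall>N\<ge>N0. norm (s N - infsum b UNIV) < e"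
    proof (intro exI allI impI)
      fix N assume N: "N \<ge> N0"
      have "s N = infsum (a N) UNIV" using sum[of N] by (simp add: infsumI)
      then have eq: "s N - infsum b UNIV = (sum (a N) F - sum b F) + infsum (a N) (UNIV - F) - infsum b (UNIV - F)"
        using split[OF has_sum_imp_summable[OF sum[of N]]] split[OF bsum] by simp
      have "norm (s N - infsum b UNIV) \<le>
        norm (sum (a N) F - sum b F) + norm (infsum (a N) (UNIV - F)) + norm (infsum b (UNIV - F))"
        unfolding eq by (meson norm_triangle_ineq norm_triangle_ineq4 order_trans add_right_mono)
      then show "norm (s N - infsum b UNIV) < e"
        using N0[OF N] tail[of "a N", OF bound] tail[of b, OF bb] e by linarith
    qed
  qed
  then show ?thesis using bsum by simp
qed

section \<open>The Jacobi triple product\<close>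

definition theta :: "complex \<Rightarrow> complex \<Rightarrow> complex" where
  "theta q z = euler q * qpoch_inf z q * qpoch_inf (q / z) q"

lemma theta_factor:
  assumes "norm q < 1" "z \<noteq> 0"
  shows "theta q z = (1 - z) * (euler q * qpoch_inf (z * q) q * qpoch_inf (q / z) q)"
  unfolding theta_def by (subst qpoch_inf_rec[OF assms(1), of z]) (simp add: mult_ac)

lemma theta_1 [simp]: "norm q < 1 \<Longrightarrow> theta q 1 = 0"
  by (simp add: theta_def)

lemma theta_inverse:
  assumes "norm q < 1" "z \<noteq> 0"
  shows "theta q (1 / z) = - theta q z / z"
  unfolding theta_factor[OF assms] using assms
  by (simp add: theta_factor[of q "1 / z"] field_simps)

lemma theta_shift:
  assumes "norm q < 1" "z \<noteq> 0" "q \<noteq> 0"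
  shows "theta q (q * z) = - theta q z / z"
proof -
  have "theta q (q * z) = theta q (1 / z)"
    using assms by (simp add: theta_def mult_ac)
  then show ?thesis using theta_inverse[OF assms(1,2)] by simp
qed

lemma theta_nonzero:
  assumes "norm q < 1" "\<And>j. z * q ^ j \<noteq> 1" "\<And>j. q ^ Suc j \<noteq> z" "z \<noteq> 0"
  shows "theta q z \<noteq> 0"
proof -
  have "qpoch_inf (q / z) q \<noteq> 0"
    by (rule qpoch_inf_nonzero[OF assms(1)]) (use assms(3,4) in \<open>auto simp: field_simps\<close>)
  then show ?thesis
    using qpoch_inf_self_nonzero[OF assms(1)] qpoch_inf_nonzero[OF assms(1,2)]
    by (simp add: theta_def)
qed

lemma theta_holomorphic [holomorphic_intros]:
  assumes "norm q < 1" "f holomorphic_on A" "\<And>z. z \<in> A \<Longrightarrow> f z \<noteq> 0"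
  shows "(\<lambda>z. theta q (f z)) holomorphic_on A"
  unfolding theta_def by (intro holomorphic_intros assms)

text \<open>The zero at 1 is simple: in \<open>(1 - z) * g z\<close> only the derivative of the
  linear factor survives, and \<open>g 1\<close> is the cube of the Euler product.\<close>

lemma theta_has_derivative_at_1:
  assumes q: "norm q < 1"
  shows "(theta q has_field_derivative - (euler q ^ 3)) (at 1)"
proof -
  define g where "g = (\<lambda>z. euler q * qpoch_inf (z * q) q * qpoch_inf (q / z) q)"
  have "g holomorphic_on - {0}"
    unfolding g_def using q by (intro holomorphic_intros) auto
  then have "g field_differentiable at 1"
    by (rule holomorphic_on_imp_differentiable_at) auto
  then obtain g' where g': "(g has_field_derivative g') (at 1)"
    by (auto simp: field_differentiable_def)
  have g1: "g 1 = euler q ^ 3"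
    by (simp add: g_def power3_eq_cube)
  have "((\<lambda>z. (1 - z) * g z) has_field_derivative - (euler q ^ 3)) (at 1)"
    using g' by (auto intro!: derivative_eq_intros simp: g1)
  moreover have "\<forall>\<^sub>F z in nhds 1. (1 - z) * g z = theta q z"
    using eventually_nhds_in_open[of "- {0::complex}" 1, OF open_Compl]
    by (auto elim!: eventually_mono simp: g_def theta_factor[OF q])
  ultimately show ?thesis
    using DERIV_cong_ev[of 1 1 "\<lambda>z. (1 - z) * g z" "theta q"] by simp
qed

definition theta_coeff :: "complex \<Rightarrow> int \<Rightarrow> complex" where
  "theta_coeff q n = (- 1) powi n * q powi (n * (n - 1) div 2)"

lemma theta_coeff_Suc:
  assumes "q \<noteq> 0"
  shows "theta_coeff q (n + 1) = - (q powi n) * theta_coeff q n"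
proof -
  have "(n + 1) * n = n * (n - 1) + n * 2" by (simp add: algebra_simps)
  then have "(n + 1) * n div 2 = n * (n - 1) div 2 + n" by simp
  then show ?thesis
    using assms by (simp add: theta_coeff_def power_int_add mult_ac)
qed

lemma theta_coeff_pred:
  assumes "q \<noteq> 0"
  shows "theta_coeff q (n - 1) = - (q powi (1 - n)) * theta_coeff q n"
  using theta_coeff_Suc[OF assms, of "n - 1"] assms
  by (simp add: power_int_diff field_simps)

lemma summable_norm_ratio_0:
  fixes f :: "nat \<Rightarrow> complex"
  assumes "\<And>n. f (Suc n) = r n * f n" "r \<longlonglongrightarrow> 0"
  shows "summable (\<lambda>n. norm (f n))"
proof -
  have "(\<lambda>n. norm (r n)) \<longlonglongrightarrow> 0"
    using assms(2) by (rule tendsto_norm_zero)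
  then have "\<forall>\<^sub>F n in sequentially. norm (r n) < 1 / 2"
    by (rule order_tendstoD) simp
  then obtain N where N: "\<And>n. n \<ge> N \<Longrightarrow> norm (r n) \<le> 1 / 2"
    by (auto simp: eventually_sequentially intro: less_imp_le)
  show ?thesis
  proof (rule summable_ratio_test[of "1 / 2" N])
    fix n assume "n \<ge> N"
    then show "norm (norm (f (Suc n))) \<le> 1 / 2 * norm (norm (f n))"
      using mult_right_mono[OF N, of n "norm (f n)"] by (simp add: assms(1) norm_mult)
  qed simp
qed

text \<open>In either direction the ratio of consecutive terms is a constant times
  \<open>q ^ n\<close>, which tends to 0 whatever the value of z.\<close>

lemma theta_series_summable:
  assumes "norm q < 1" "q \<noteq> 0" "z \<noteq> 0"
  shows "(\<lambda>n. theta_coeff q n * z powi n) summable_on UNIV"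
proof (rule summable_on_int_halves)
  have 0: "(\<lambda>n. c * q ^ n) \<longlonglongrightarrow> 0" for c :: complex
    using tendsto_mult_right_zero[OF LIMSEQ_power_zero[OF assms(1)]] by simp
  show "summable (\<lambda>n. norm (theta_coeff q (int n) * z powi int n))"
  proof (rule summable_norm_ratio_0[OF _ 0])
    fix n
    show "theta_coeff q (int (Suc n)) * z powi int (Suc n) = - z * q ^ n * (theta_coeff q (int n) * z powi int n)"
      using theta_coeff_Suc[OF assms(2), of "int n"] assms(3)
      by (simp add: power_int_add add.commute)
  qed
  show "summable (\<lambda>n. norm (theta_coeff q (- int n - 1) * z powi (- int n - 1)))"
  proof (rule summable_norm_ratio_0[OF _ 0])
    fix n
    have "q powi (2 + int n) = q\<^sup>2 * q ^ n"
      using power_int_add[of q 2 "int n"] assms(2) by simp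
    then show "theta_coeff q (- int (Suc n) - 1) * z powi (- int (Suc n) - 1) =
        - (q\<^sup>2 / z) * q ^ n * (theta_coeff q (- int n - 1) * z powi (- int n - 1))"
      using theta_coeff_pred[OF assms(2), of "- int n - 1"] assms(3) power_int_diff[of z "- int n - 1" 1]
      by (simp add: algebra_simps)
  qed
qed

lemma has_sum_int_shift:
  fixes f :: "int \<Rightarrow> 'a :: {topological_comm_monoid_add, t2_space}"
  shows "((\<lambda>n. f (n + k)) has_sum s) UNIV \<longleftrightarrow> (f has_sum s) UNIV"
  by (rule has_sum_reindex_bij_witness[of _ "\<lambda>n. n - k" "\<lambda>n. n + k"]) auto

text \<open>The value 0 at negative arguments makes the recursion hold at every integer, so that the
  finite triple product can be written as a sum over all integers.\<close>

definition inv_qfact :: "complex \<Rightarrow> int \<Rightarrow> complex" where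
  "inv_qfact q n = (if n < 0 then 0 else 1 / (\<Prod>j<nat n. 1 - q ^ Suc j))"

lemma inv_qfact_rec:
  assumes "norm q < 1"
  shows "inv_qfact q (n - 1) = (1 - q powi n) * inv_qfact q n"
proof (cases "n \<le> 0")
  case True
  then show ?thesis by (cases "n = 0") (auto simp: inv_qfact_def)
next
  case False
  then obtain m where m: "n = int (Suc m)" by (metis not_le zero_less_imp_eq_int not0_implies_Suc of_nat_0 less_irrefl)
  have "1 - q ^ Suc m \<noteq> 0" using power_eq_1_norm_less[OF assms, of "Suc m"] by simp
  then show ?thesis by (simp add: m inv_qfact_def nat_add_distrib del: power_Suc of_nat_Suc) (simp add: power_int_def nat_add_distrib)
qed

text \<open>A symmetric form of the q-binomial theorem; the bracket is the Gaussian binomial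
  coefficient of 2N over N+n. The two new factors multiply to 1 + q^(2N+1) - z q^N - q^(N+1)/z, so
  the induction step is a recursion between the coefficients at n-1, n and n+1.\<close>

lemma jacobi_triple_product_finite:
  assumes q: "norm q < 1" "q \<noteq> 0" "z \<noteq> 0"
  shows "((\<lambda>n. theta_coeff q n * ((\<Prod>j<2*N. 1 - q ^ Suc j) * inv_qfact q (int N + n) * inv_qfact q (int N - n)) * z powi n)
     has_sum (\<Prod>j<N. (1 - z * q ^ j) * (1 - q / z * q ^ j))) UNIV"
proof (induction N)
  case 0
  have "((\<lambda>n. theta_coeff q n * (inv_qfact q n * inv_qfact q (- n)) * z powi n) has_sum 1) {0}"
    by (rule has_sum_finiteI) (auto simp: inv_qfact_def theta_coeff_def)
  then have "((\<lambda>n. theta_coeff q n * (inv_qfact q n * inv_qfact q (- n)) * z powi n) has_sum 1) UNIV"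
    by (rule has_sum_cong_neutral[THEN iffD1, rotated -1]) (auto simp: inv_qfact_def)
  then show ?case by simp
next
  case (Suc N)
  define K where "K = (\<Prod>j<2*N. 1 - q ^ Suc j)"
  define F where "F = (\<lambda>n. theta_coeff q n * (K * inv_qfact q (int N + n) * inv_qfact q (int N - n)) * z powi n)"
  define s where "s = (\<Prod>j<N. (1 - z * q ^ j) * (1 - q / z * q ^ j))"
  have F: "(F has_sum s) UNIV" using Suc.IH by (simp add: F_def K_def s_def)
  have "((\<lambda>n. (1 + q ^ (2*N+1)) * F n + ((- z * q ^ N) * F (n + (- 1)) + (- (q ^ Suc N / z)) * F (n + 1)))
     has_sum ((1 + q ^ (2*N+1)) * s + ((- z * q ^ N) * s + (- (q ^ Suc N / z)) * s))) UNIV"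
    by (intro has_sum_add has_sum_cmult_right F has_sum_int_shift[THEN iffD2])
  also have "(1 + q ^ (2*N+1)) * s + ((- z * q ^ N) * s + (- (q ^ Suc N / z)) * s) =
     (\<Prod>j<Suc N. (1 - z * q ^ j) * (1 - q / z * q ^ j))"
  proof -
    have Q: "q ^ (2*N+1) = q * q ^ N * q ^ N" by (simp add: power_add mult_2)
    have "(1 + q * Q * Q) * s + ((- z * Q) * s + (- (q * Q / z)) * s) = s * ((1 - z * Q) * (1 - q / z * Q))" for Q
      using q(3) by (simp add: field_simps)
    from this[of "q ^ N"] show ?thesis
      unfolding Q prod.lessThan_Suc power_Suc s_def .
  qed
  also have "(\<lambda>n. (1 + q ^ (2*N+1)) * F n + ((- z * q ^ N) * F (n + (- 1)) + (- (q ^ Suc N / z)) * F (n + 1))) =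
     (\<lambda>n. theta_coeff q n * ((\<Prod>j<2*Suc N. 1 - q ^ Suc j) * inv_qfact q (int (Suc N) + n) * inv_qfact q (int (Suc N) - n)) * z powi n)"
  proof
    fix n
    define I where "I = inv_qfact q (int N + 1 + n)"
    define J where "J = inv_qfact q (int N + 1 - n)"
    \<comment> \<open>All powers of q in the recursion become monomials in \<open>A\<close>,
      \<open>B\<close> and 1/q, because A B = q^(2N+2). What remains is a rational identity in
      \<open>A\<close>, \<open>B\<close>, q.\<close>
    define A where "A = q powi (int N + 1 + n)"
    define B where "B = q powi (int N + 1 - n)"
    define t where "t = theta_coeff q n"
    have I1: "inv_qfact q (int N + n) = (1 - A) * I"
      using inv_qfact_rec[OF q(1), of "int N + 1 + n"] by (simp add: A_def I_def)
    have I2: "inv_qfact q (int N + n - 1) = (1 - A / q) * ((1 - A) * I)"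
      using inv_qfact_rec[OF q(1), of "int N + n"] q(2) power_int_diff[of q "int N + 1 + n" 1]
      by (simp add: A_def I1[unfolded A_def])
    have J1: "inv_qfact q (int N - n) = (1 - B) * J"
      using inv_qfact_rec[OF q(1), of "int N + 1 - n"] by (simp add: B_def J_def)
    have J2: "inv_qfact q (int N - n - 1) = (1 - B / q) * ((1 - B) * J)"
      using inv_qfact_rec[OF q(1), of "int N - n"] q(2) power_int_diff[of q "int N + 1 - n" 1]
      by (simp add: B_def J1[unfolded B_def])
    have tm: "theta_coeff q (n - 1) * q ^ N = - B * t"
      using theta_coeff_pred[OF q(2), of n] q(2)
      by (simp add: B_def t_def power_int_add power_int_diff)
    have tp: "theta_coeff q (n + 1) * q ^ Suc N = - A * t"
      using theta_coeff_Suc[OF q(2), of n] q(2)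
      by (simp add: A_def t_def power_int_add)
    have S: "q ^ (2*N+2) = A * B"
      using q(2) by (simp add: A_def B_def power_int_add[symmetric] add.commute flip: power_int_of_nat)
    have S': "q ^ (2*N+1) = A * B / q"
      using S q(2) by (simp add: field_simps)
    have zm: "z powi (n - 1) = z powi n / z" and zp: "z powi (n + 1) = z powi n * z"
      using q(3) by (simp_all add: power_int_diff power_int_add)
    have K2: "(\<Prod>j<2*Suc N. 1 - q ^ Suc j) = K * (1 - A * B / q) * (1 - A * B)"
      using S S' by (simp add: K_def)
    have im: "n + (- 1) = n - 1" "int N + (n - 1) = int N + n - 1" "int N - (n - 1) = int N + 1 - n"
      and ip: "int N + (n + 1) = int N + 1 + n" "int N - (n + 1) = int N - n - 1"
      and iS: "int (Suc N) + n = int N + 1 + n" "int (Suc N) - n = int N + 1 - n"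
      by simp_all
    have "F (n + (- 1)) = theta_coeff q (n - 1) * (K * ((1 - A / q) * ((1 - A) * I)) * J) * (z powi n / z)"
      unfolding F_def im I2 J_def zm ..
    then have "(- z * q ^ N) * F (n + (- 1)) = - (theta_coeff q (n - 1) * q ^ N) *
         (K * ((1 - A / q) * ((1 - A) * I)) * J) * z powi n"
      using q(3) by simp
    then have f1: "(- z * q ^ N) * F (n + (- 1)) = (B * t) * (K * ((1 - A / q) * ((1 - A) * I)) * J) * z powi n"
      unfolding tm by simp
    have f2: "(- (q ^ Suc N / z)) * F (n + 1) = (A * t) * (K * I * ((1 - B / q) * ((1 - B) * J))) * z powi n"
    proof -
      have "F (n + 1) = theta_coeff q (n + 1) * (K * I * ((1 - B / q) * ((1 - B) * J))) * (z powi n * z)"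
        unfolding F_def ip J2 I_def zp ..
      then have "(- (q ^ Suc N / z)) * F (n + 1) = - (theta_coeff q (n + 1) * q ^ Suc N) *
         (K * I * ((1 - B / q) * ((1 - B) * J))) * z powi n"
        using q(3) by simp
      then show ?thesis unfolding tp by simp
    qed
    have f3: "F n = t * (K * ((1 - A) * I) * ((1 - B) * J)) * z powi n"
      by (simp add: F_def I1 J1 t_def)
    have "(1 + q ^ (2*N+1)) * F n + ((- z * q ^ N) * F (n + (- 1)) + (- (q ^ Suc N / z)) * F (n + 1)) =
      t * K * I * J * z powi n * ((1 + A * B / q) * (1 - A) * (1 - B) + B * (1 - A / q) * (1 - A) + A * (1 - B / q) * (1 - B))"
      unfolding f1 f2 f3 S' by (simp add: algebra_simps add_divide_distrib diff_divide_distrib)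
    also have "(1 + A * B / q) * (1 - A) * (1 - B) + B * (1 - A / q) * (1 - A) + A * (1 - B / q) * (1 - B) =
       (1 - A * B / q) * (1 - A * B)"
      using q(2) by (simp add: field_simps)
    finally show "(1 + q ^ (2*N+1)) * F n + ((- z * q ^ N) * F (n + (- 1)) + (- (q ^ Suc N / z)) * F (n + 1)) =
      theta_coeff q n * ((\<Prod>j<2*Suc N. 1 - q ^ Suc j) * inv_qfact q (int (Suc N) + n) * inv_qfact q (int (Suc N) - n)) * z powi n"
      unfolding K2 iS by (simp add: t_def I_def J_def)
  qed
  finally show ?case .
qed

text \<open>For fixed n the Gaussian binomial tends to 1/E. The products (q;q)_N and their inverses
  are bounded sequences, which gives the domination needed for \<open>tannery_int\<close>.\<close>

theorem jacobi_triple_product: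
  assumes q: "norm q < 1" "q \<noteq> 0" "z \<noteq> 0"
  shows "((\<lambda>n. theta_coeff q n * z powi n) has_sum theta q z) UNIV"
proof -
  define E where "E = euler q"
  define ph where "ph = (\<lambda>N. \<Prod>j<N. 1 - q ^ Suc j)"
  have E0: "E \<noteq> 0" using qpoch_inf_self_nonzero[OF q(1)] by (simp add: E_def)
  have phE: "ph \<longlonglongrightarrow> E"
    using qpoch_inf_LIMSEQ[OF q(1), of q] by (simp add: ph_def E_def)
  have ph0: "ph N \<noteq> 0" for N
    using power_eq_1_norm_less[OF q(1), of "Suc _"] by (simp add: ph_def)
  obtain K where K: "\<And>N. norm (ph N) \<le> K"
    using convergent_imp_Bseq[OF convergentI[OF phE]] by (auto simp: Bseq_def)
  obtain K' where K': "\<And>N. norm (inverse (ph N)) \<le> K'"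
    using convergent_imp_Bseq[OF convergentI[OF tendsto_inverse[OF phE E0]]] by (auto simp: Bseq_def)
  have Kpos: "K \<ge> 0" "K' \<ge> 0" using K[of 0] K'[of 0] norm_ge_zero order_trans by blast+
  have iq: "norm (inv_qfact q m) \<le> K'" for m
    using K'[of "nat m"] Kpos by (auto simp: inv_qfact_def ph_def divide_inverse)
  have iqlim: "(\<lambda>N. inv_qfact q (int N + m)) \<longlonglongrightarrow> inverse E" for m
  proof -
    have "filterlim (\<lambda>N. nat (int N + m)) sequentially sequentially"
      unfolding filterlim_at_top
    proof
      fix Z
      show "\<forall>\<^sub>F N in sequentially. Z \<le> nat (int N + m)"
        using eventually_ge_at_top[of "nat (int Z - m)"] by eventually_elim linarith
    qed
    then have "(\<lambda>N. inverse (ph (nat (int N + m)))) \<longlonglongrightarrow> inverse E"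
      by (rule filterlim_compose[OF tendsto_inverse[OF phE E0]])
    moreover have "\<forall>\<^sub>F N in sequentially. inverse (ph (nat (int N + m))) = inv_qfact q (int N + m)"
      using eventually_ge_at_top[of "nat (- m)"]
      by eventually_elim (auto simp: inv_qfact_def ph_def divide_inverse)
    ultimately show ?thesis by (rule Lim_transform_eventually)
  qed
  have "((\<lambda>n. theta_coeff q n * inverse E * z powi n) has_sum (qpoch_inf z q * qpoch_inf (q / z) q)) UNIV"
  proof (rule tannery_int[where M = "\<lambda>n. (K * K' * K') * norm (theta_coeff q n * z powi n)",
        OF _ _ _ jacobi_triple_product_finite[OF q]])
    fix n
    have "strict_mono (\<lambda>N::nat. 2 * N)" by (simp add: strict_mono_def)
    from LIMSEQ_subseq_LIMSEQ[OF phE this]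
    have "(\<lambda>N. ph (2 * N)) \<longlonglongrightarrow> E" by (simp add: o_def)
    then have "(\<lambda>N. theta_coeff q n * (ph (2 * N) * inv_qfact q (int N + n) * inv_qfact q (int N + (- n))) * z powi n)
       \<longlonglongrightarrow> theta_coeff q n * (E * inverse E * inverse E) * z powi n"
      by (intro tendsto_intros iqlim)
    then show "(\<lambda>N. theta_coeff q n * ((\<Prod>j<2*N. 1 - q ^ Suc j) * inv_qfact q (int N + n) * inv_qfact q (int N - n)) * z powi n)
       \<longlonglongrightarrow> theta_coeff q n * inverse E * z powi n"
      using E0 by (simp add: ph_def)
  next
    fix N n
    have "norm (ph (2 * N)) * norm (inv_qfact q (int N + n)) * norm (inv_qfact q (int N - n)) \<le> K * K' * K'"
      by (intro mult_mono K iq mult_nonneg_nonneg Kpos) auto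
    then have "norm (ph (2 * N)) * norm (inv_qfact q (int N + n)) * norm (inv_qfact q (int N - n)) *
       norm (theta_coeff q n * z powi n) \<le> K * K' * K' * norm (theta_coeff q n * z powi n)"
      by (rule mult_right_mono) simp
    then show "norm (theta_coeff q n * ((\<Prod>j<2*N. 1 - q ^ Suc j) * inv_qfact q (int N + n) * inv_qfact q (int N - n)) * z powi n)
       \<le> (K * K' * K') * norm (theta_coeff q n * z powi n)"
      by (simp add: norm_mult ph_def mult_ac)
  next
    show "(\<lambda>n. (K * K' * K') * norm (theta_coeff q n * z powi n)) summable_on UNIV"
      using theta_series_summable[OF q] unfolding summable_on_iff_abs_summable_on_complex
      by (rule summable_on_cmult_right)
  next
    show "(\<lambda>N. \<Prod>j<N. (1 - z * q ^ j) * (1 - q / z * q ^ j)) \<longlonglongrightarrow> qpoch_inf z q * qpoch_inf (q / z) q"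
      unfolding prod.distrib by (intro tendsto_mult qpoch_inf_LIMSEQ q)
  qed
  from has_sum_cmult_right[OF this, of E] show ?thesis
    using E0 by (simp add: theta_def E_def field_simps)
qed

section \<open>The three-term relation\<close>

lemma has_sum_mult_Times:
  fixes f :: "'a \<Rightarrow> complex" and g :: "'b \<Rightarrow> complex"
  assumes f: "(f has_sum a) A" and g: "(g has_sum b) B"
  shows "((\<lambda>(x, y). f x * g y) has_sum (a * b)) (A \<times> B)"
proof (rule has_sum_SigmaI)
  fix x assume "x \<in> A"
  show "((\<lambda>y. case (x, y) of (x, y) \<Rightarrow> f x * g y) has_sum (f x * b)) B"
    using has_sum_cmult_right[OF g, of "f x"] by simp
next
  show "((\<lambda>x. f x * b) has_sum a * b) A"
    by (rule has_sum_cmult_left[OF f])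
next
  have nf: "(\<lambda>x. norm (f x)) summable_on A" and ng: "(\<lambda>x. norm (g x)) summable_on B"
    using has_sum_imp_summable[OF f] has_sum_imp_summable[OF g]
    by (simp_all add: summable_on_iff_abs_summable_on_complex)
  have "(\<lambda>(x, y). norm (f x) * norm (g y)) summable_on A \<times> B"
  proof (rule summable_on_SigmaI[where g = "\<lambda>x. norm (f x) * infsum (\<lambda>y. norm (g y)) B"])
    show "(\<lambda>x. norm (f x) * infsum (\<lambda>y. norm (g y)) B) summable_on A"
      by (rule summable_on_cmult_left[OF nf])
  qed (auto intro!: has_sum_cmult_right has_sum_infsum ng)
  then show "(\<lambda>(x, y). f x * g y) summable_on A \<times> B"
    by (rule summable_on_norm_bound) (auto simp: norm_mult)
qed

text \<open>Even and odd powers of x. Both are theta series for the nome \<open>q ^ 2\<close>, and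
  for fixed y they span the functions theta(xy) theta(x/y) of x.\<close>

definition theta_even :: "complex \<Rightarrow> complex \<Rightarrow> complex" where
  "theta_even q x = (\<Sum>\<^sub>\<infinity>a. q powi (a * a - a) * x powi (2 * a))"

definition theta_odd :: "complex \<Rightarrow> complex \<Rightarrow> complex" where
  "theta_odd q x = (\<Sum>\<^sub>\<infinity>a. q powi (a * a) * x powi (2 * a + 1))"

lemma power_int_even_odd:
  "(- 1 :: complex) powi (2 * a) = 1" "(- 1 :: complex) powi (2 * a + 1) = - 1"
  using power_int_mult[of "-1::complex" 2 a] power_int_add[of "-1::complex" "2*a" 1] by simp_all

text \<open>In the double series the index pairs of equal parity are (a+b, a-b), the others (a+b+1,
  a-b). In these coordinates the quadratic exponents decouple, so each half is a product of a series
  in x and a series in y. The factor y turns the second series into \<open>theta_even\<close> and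
  \<open>theta_odd\<close> at y.\<close>

lemma theta_mult_split:
  assumes q: "norm q < 1" "q \<noteq> 0" and xy: "x \<noteq> 0" "y \<noteq> 0"
  shows "y * (theta q (x * y) * theta q (x / y)) =
         theta_even q x * theta_odd q y - theta_odd q x * theta_even q y"
proof -
  define F where "F = (\<lambda>(m, n). (theta_coeff q m * (x * y) powi m) * (theta_coeff q n * (x / y) powi n))"
  define s where "s = theta q (x * y) * theta q (x / y)"
  have F: "(F has_sum s) (UNIV \<times> UNIV)"
    unfolding F_def s_def using q xy by (intro has_sum_mult_Times jacobi_triple_product) auto
  define A where "A = {(m, n). even (m + n :: int)}"
  have Fe: "F (a + b, a - b) = (q powi (a * a - a) * x powi (2 * a)) * (q powi (b * b) * y powi (2 * b))" for a b
  proof -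
    have "((a + b) * (a + b - 1)) div 2 + ((a - b) * (a - b - 1)) div 2 =
          ((a + b) * (a + b - 1) + (a - b) * (a - b - 1)) div 2"
      by (rule div_add[symmetric]) auto
    also have "(a + b) * (a + b - 1) + (a - b) * (a - b - 1) = 2 * (a * a - a + b * b)"
      by (simp add: algebra_simps)
    finally have "q powi ((a + b) * (a + b - 1) div 2) * q powi ((a - b) * (a - b - 1) div 2) =
        q powi (a * a - a) * q powi (b * b)"
      using q(2) by (simp flip: power_int_add)
    moreover have "x powi (a + b) * x powi (a - b) = x powi (2 * a)"
      using xy by (subst power_int_add[symmetric]) (auto intro: arg_cong)
    moreover have "y powi (a + b) / y powi (a - b) = y powi (2 * b)"
      using xy by (subst power_int_diff[symmetric]) (auto intro: arg_cong)
    moreover have "(- 1 :: complex) powi (a + b) * (- 1) powi (a - b) = 1"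
      using power_int_even_odd(1)[of a] by (subst power_int_add[symmetric]) simp_all
    moreover have "F (a + b, a - b) =
      ((- 1) powi (a + b) * (- 1) powi (a - b)) *
      (q powi ((a + b) * (a + b - 1) div 2) * q powi ((a - b) * (a - b - 1) div 2)) *
      (x powi (a + b) * x powi (a - b)) * (y powi (a + b) / y powi (a - b))"
      by (simp add: F_def theta_coeff_def power_int_mult_distrib power_int_divide_distrib)
    ultimately show ?thesis by simp
  qed
  have Fo: "F (a + b + 1, a - b) = - ((q powi (a * a) * x powi (2 * a + 1)) * (q powi ((b + 1) * (b + 1) - (b + 1)) * y powi (2 * b + 1)))" for a b
  proof -
    have "((a + b + 1) * (a + b + 1 - 1)) div 2 + ((a - b) * (a - b - 1)) div 2 =
          ((a + b + 1) * (a + b + 1 - 1) + (a - b) * (a - b - 1)) div 2"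
      by (rule div_add[symmetric]) auto
    also have "(a + b + 1) * (a + b + 1 - 1) + (a - b) * (a - b - 1) = 2 * (a * a + ((b + 1) * (b + 1) - (b + 1)))"
      by (simp add: algebra_simps)
    finally have "q powi ((a + b + 1) * (a + b + 1 - 1) div 2) * q powi ((a - b) * (a - b - 1) div 2) =
        q powi (a * a) * q powi ((b + 1) * (b + 1) - (b + 1))"
      using q(2) by (simp add: power_int_add[symmetric])
    moreover have "x powi (a + b + 1) * x powi (a - b) = x powi (2 * a + 1)"
      using xy by (subst power_int_add[symmetric]) (auto intro: arg_cong)
    moreover have "y powi (a + b + 1) / y powi (a - b) = y powi (2 * b + 1)"
      using xy by (subst power_int_diff[symmetric]) (auto intro: arg_cong)
    moreover have "(- 1 :: complex) powi (a + b + 1) * (- 1) powi (a - b) = - 1"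
      using power_int_even_odd(2)[of a] by (subst power_int_add[symmetric]) (simp_all add: add_ac)
    moreover have "F (a + b + 1, a - b) =
      ((- 1) powi (a + b + 1) * (- 1) powi (a - b)) *
      (q powi ((a + b + 1) * (a + b + 1 - 1) div 2) * q powi ((a - b) * (a - b - 1) div 2)) *
      (x powi (a + b + 1) * x powi (a - b)) * (y powi (a + b + 1) / y powi (a - b))"
      unfolding F_def theta_coeff_def
      by (simp only: prod.case power_int_mult_distrib power_int_divide_distrib) simp
    ultimately show ?thesis by simp
  qed
  have bije: "bij_betw (\<lambda>(a, b). (a + b, a - b)) (UNIV \<times> UNIV) A"
    by (rule bij_betwI[where g = "\<lambda>(m, n). ((m + n) div 2, (m - n) div 2)"])
      (simp_all add: A_def split: prod.splits, presburger+)
  have bijo: "bij_betw (\<lambda>(a, b). (a + b + 1, a - b)) (UNIV \<times> UNIV) (- A)"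
    by (rule bij_betwI[where g = "\<lambda>(m, n). ((m + n - 1) div 2, (m - n - 1) div 2)"])
      (simp_all add: A_def split: prod.splits, presburger+)
  have even_sum: "(\<lambda>a. q powi (a * a - a) * x powi (2 * a)) summable_on UNIV" if "x \<noteq> 0" for x
  proof -
    have "theta_coeff (q ^ 2) a * (- (x ^ 2)) powi a = q powi (a * a - a) * x powi (2 * a)" for a
    proof -
      have "2 * (a * (a - 1) div 2) = a * a - a" by (simp add: algebra_simps)
      then have "(q ^ 2) powi (a * (a - 1) div 2) = q powi (a * a - a)"
        using power_int_mult[of q 2 "a * (a - 1) div 2"] by simp
      moreover have "(- (x ^ 2)) powi a = (- 1) powi a * x powi (2 * a)"
        using power_int_mult[of x 2 a] power_int_mult_distrib[of "- 1" "x\<^sup>2" a] by simp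
      ultimately show ?thesis
        using power_int_mult_distrib[of "- 1 :: complex" "- 1" a] by (simp add: theta_coeff_def)
    qed
    then show ?thesis
      using theta_series_summable[of "q ^ 2" "- (x ^ 2)"] q that by (simp add: norm_power power_less_one_iff)
  qed
  have odd_sum: "(\<lambda>a. q powi (a * a) * x powi (2 * a + 1)) summable_on UNIV" if x0: "x \<noteq> 0" for x
  proof -
    \<comment> \<open>A square root of q absorbs the factor q^a of q^(a^2) = q^(a^2-a) q^a into the
      argument, which reduces the odd series to an even one at x r.\<close>
    obtain r where r: "q = r ^ 2" by (metis power2_csqrt)
    have r0: "r \<noteq> 0" using q r by auto
    have "q powi (a * a) * x powi (2 * a + 1) = q powi (a * a - a) * (x * r) powi (2 * a) * x" for a
    proof -
      have "r powi (2 * a) = q powi a" unfolding r by (simp add: power_int_mult)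
      moreover have "q powi (a * a) = q powi (a * a - a) * q powi a"
        using q(2) by (simp flip: power_int_add)
      ultimately show ?thesis using x0 by (simp add: power_int_mult_distrib power_int_add)
    qed
    then show ?thesis
      using summable_on_cmult_left[OF even_sum[of "x * r"], of x] x0 r0 by simp
  qed
  have e: "((\<lambda>a. q powi (a * a - a) * x powi (2 * a)) has_sum theta_even q x) UNIV"
    if "x \<noteq> 0" for x unfolding theta_even_def using even_sum[OF that] by simp
  have o: "((\<lambda>a. q powi (a * a) * x powi (2 * a + 1)) has_sum theta_odd q x) UNIV"
    if "x \<noteq> 0" for x unfolding theta_odd_def using odd_sum[OF that] by simp
  have "((\<lambda>b. q powi (b * b) * y powi (2 * b + 1) / y) has_sum (theta_odd q y / y)) UNIV"
    using has_sum_divide_const[OF o[OF xy(2)]] by simp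
  then have o': "((\<lambda>b. q powi (b * b) * y powi (2 * b)) has_sum (theta_odd q y / y)) UNIV"
    using xy(2) by (simp add: power_int_add)
  have "((\<lambda>b. q powi ((b + 1) * (b + 1) - (b + 1)) * y powi (2 * (b + 1))) has_sum theta_even q y) UNIV"
    using e[OF xy(2)] has_sum_int_shift[of "\<lambda>a. q powi (a * a - a) * y powi (2 * a)" 1] by blast
  then have "((\<lambda>b. q powi ((b + 1) * (b + 1) - (b + 1)) * y powi (2 * (b + 1)) / y) has_sum (theta_even q y / y)) UNIV"
    by (rule has_sum_divide_const)
  moreover have "y powi (2 * (b + 1)) / y = y powi (2 * b + 1)" for b
    using xy(2) power_int_diff[of y "2 * (b + 1)" 1] by (simp add: algebra_simps)
  ultimately have e': "((\<lambda>b. q powi ((b + 1) * (b + 1) - (b + 1)) * y powi (2 * b + 1)) has_sum (theta_even q y / y)) UNIV"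
    by (simp only: times_divide_eq_right[symmetric])
  have "(F has_sum (theta_even q x * (theta_odd q y / y))) A"
    using has_sum_mult_Times[OF e[OF xy(1)] o']
    by (subst has_sum_reindex_bij_betw[OF bije, symmetric]) (simp only: case_prod_unfold Fe UNIV_Times_UNIV)
  moreover have "(F has_sum (- (theta_odd q x * (theta_even q y / y)))) (- A)"
    using has_sum_uminusI[OF has_sum_mult_Times[OF o[OF xy(1)] e']]
    by (subst has_sum_reindex_bij_betw[OF bijo, symmetric]) (simp only: case_prod_unfold Fo UNIV_Times_UNIV)
  ultimately have "(F has_sum (theta_even q x * (theta_odd q y / y) + - (theta_odd q x * (theta_even q y / y)))) (A \<union> - A)"
    by (rule has_sum_Un_disjoint) auto
  then have "s = theta_even q x * (theta_odd q y / y) - theta_odd q x * (theta_even q y / y)"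
    using has_sum_unique[OF F] by simp
  then show ?thesis
    using xy by (simp add: s_def field_simps)
qed

text \<open>The Weierstrass sigma function up to a constant and a factor exp(c u^2): the half
  exponential makes theta odd in the additive variable.\<close>

definition weier :: "complex \<Rightarrow> complex \<Rightarrow> complex" where
  "weier q u = exp (- u / 2) * theta q (exp u)"

text \<open>Each product W(u+v) W(u-v) is a minor P(u) Q(v) - Q(u) P(v) of a matrix with two rows
  and four columns. The claim is the Plucker relation between the six minors.\<close>

lemma weier_three_term:
  assumes q: "norm q < 1" "q \<noteq> 0"
  shows "weier q (a + b) * weier q (a - b) * (weier q (c + d) * weier q (c - d)) -
         weier q (a + c) * weier q (a - c) * (weier q (b + d) * weier q (b - d)) +
         weier q (a + d) * weier q (a - d) * (weier q (b + c) * weier q (b - c)) = 0"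
proof -
  define P where "P = (\<lambda>u. theta_even q (exp u) * exp (- u))"
  define Q where "Q = (\<lambda>u. theta_odd q (exp u) * exp (- u))"
  have V: "weier q (u + v) * weier q (u - v) = P u * Q v - Q u * P v" for u v
  proof -
    have "weier q (u + v) * weier q (u - v) = exp (- (u + v) / 2) * exp (- (u - v) / 2) * (theta q (exp u * exp v) * theta q (exp u / exp v))"
      by (simp add: weier_def exp_add exp_diff)
    also have "exp (- (u + v) / 2) * exp (- (u - v) / 2) = exp (- u)"
      by (subst exp_add[symmetric], rule arg_cong[of _ _ exp]) (simp add: field_simps)
    also have "exp (- u) * (theta q (exp u * exp v) * theta q (exp u / exp v)) =
        exp (- u) * exp (- v) * (exp v * (theta q (exp u * exp v) * theta q (exp u / exp v)))"
      by (simp add: exp_minus)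
    also have "exp v * (theta q (exp u * exp v) * theta q (exp u / exp v)) =
        theta_even q (exp u) * theta_odd q (exp v) - theta_odd q (exp u) * theta_even q (exp v)"
      by (rule theta_mult_split[OF q]) auto
    finally show ?thesis by (simp add: P_def Q_def algebra_simps)
  qed
  show ?thesis unfolding V by (simp add: algebra_simps)
qed

lemma weier_minus:
  assumes "norm q < 1"
  shows "weier q (- u) = - weier q u"
proof -
  have "weier q (- u) = exp (u / 2) * theta q (1 / exp u)"
    by (simp add: weier_def exp_minus inverse_eq_divide)
  also have "\<dots> = - (exp (u / 2) / exp u) * theta q (exp u)"
    using theta_inverse[OF assms, of "exp u"] by simp
  also have "exp (u / 2) / exp u = exp (- u / 2)"
    by (subst exp_diff[symmetric], rule arg_cong[of _ _ exp]) simp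
  finally show ?thesis by (simp add: weier_def)
qed

lemma weier_holomorphic:
  "norm q < 1 \<Longrightarrow> weier q holomorphic_on UNIV"
  unfolding weier_def[abs_def] by (intro holomorphic_intros) auto

lemma weier_has_derivative_at_0:
  assumes "norm q < 1"
  shows "(weier q has_field_derivative - (euler q ^ 3)) (at 0)"
proof -
  have "(theta q has_field_derivative - (euler q ^ 3)) (at (exp 0))"
    using theta_has_derivative_at_1[OF assms] by simp
  then have "((\<lambda>u. theta q (exp u)) has_field_derivative - (euler q ^ 3) * exp 0) (at 0)"
    by (rule DERIV_chain2) (rule DERIV_exp)
  then have "((\<lambda>u. exp (- u / 2) * theta q (exp u)) has_field_derivative - (euler q ^ 3)) (at 0)"
    by (rule DERIV_mult[where f = "\<lambda>u. exp (- u / 2)" and Da = "- 1 / 2", THEN DERIV_cong, rotated])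
      (auto intro!: derivative_eq_intros simp: assms)
  then show ?thesis
    unfolding weier_def[abs_def] .
qed

text \<open>Isolates what follows from the three-term equation by differentiation alone. The
  derivatives are parameters, so that they can be handled as ordinary functions by
  \<open>derivative_intros\<close>.\<close>

locale weierstrass_function =
  fixes W W1 W2 W3 :: "complex \<Rightarrow> complex"
  assumes three_term:
    "W (a + b) * W (a - b) * (W (c + d) * W (c - d)) - W (a + c) * W (a - c) * (W (b + d) * W (b - d)) +
     W (a + d) * W (a - d) * (W (b + c) * W (b - c)) = 0"
    and odd: "W (- u) = - W u"
    and deriv_W: "(W has_field_derivative W1 u) (at u)"
    and deriv_W1: "(W1 has_field_derivative W2 u) (at u)"
    and deriv_W2: "(W2 has_field_derivative W3 u) (at u)"
begin

lemma W_0 [simp]: "W 0 = 0"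
  using odd[of 0] by simp

lemma derivs [derivative_intros]:
  assumes "(f has_field_derivative f') (at x within s)"
  shows "((\<lambda>x. W (f x)) has_field_derivative W1 (f x) * f') (at x within s)"
    and "((\<lambda>x. W1 (f x)) has_field_derivative W2 (f x) * f') (at x within s)"
    and "((\<lambda>x. W2 (f x)) has_field_derivative W3 (f x) * f') (at x within s)"
  using DERIV_chain2[OF deriv_W assms] DERIV_chain2[OF deriv_W1 assms] DERIV_chain2[OF deriv_W2 assms]
  by simp_all

lemma W1_even: "W1 (- u) = W1 u"
proof -
  have "((\<lambda>x. - W (- x)) has_field_derivative W1 (- u)) (at u)"
    by (auto intro!: derivative_eq_intros)
  then show ?thesis using DERIV_unique[OF deriv_W] by (simp add: odd)
qed

lemma W2_odd: "W2 (- u) = - W2 u"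
proof -
  have "((\<lambda>x. W1 (- x)) has_field_derivative - W2 (- u)) (at u)"
    by (auto intro!: derivative_eq_intros)
  then show ?thesis using DERIV_unique[OF deriv_W1] by (simp add: W1_even)
qed

text \<open>Differentiate the three-term equation in a at a = b. Its first product contains W(a-b),
  so only the derivative of that factor contributes there.\<close>

lemma zeta_relation:
  "W1 0 * W (2 * b) * (W (c + d) * W (c - d)) =
   (W1 (b + c) * W (b - c) + W (b + c) * W1 (b - c)) * (W (b + d) * W (b - d)) -
   (W1 (b + d) * W (b - d) + W (b + d) * W1 (b - d)) * (W (b + c) * W (b - c))"
proof -
  have "((\<lambda>a. W (a + b) * W (a - b) * (W (c + d) * W (c - d)) - W (a + c) * W (a - c) * (W (b + d) * W (b - d)) +
     W (a + d) * W (a - d) * (W (b + c) * W (b - c))) has_field_derivative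
     (W1 (b + b) * W (b - b) + W1 (b - b) * W (b + b)) * (W (c + d) * W (c - d)) -
     (W1 (b + c) * W (b - c) + W1 (b - c) * W (b + c)) * (W (b + d) * W (b - d)) +
     (W1 (b + d) * W (b - d) + W1 (b - d) * W (b + d)) * (W (b + c) * W (b - c))) (at b)"
    by (auto intro!: derivative_eq_intros)
  then have "(W1 (b + b) * W (b - b) + W1 (b - b) * W (b + b)) * (W (c + d) * W (c - d)) -
     (W1 (b + c) * W (b - c) + W1 (b - c) * W (b + c)) * (W (b + d) * W (b - d)) +
     (W1 (b + d) * W (b - d) + W1 (b - d) * W (b + d)) * (W (b + c) * W (b - c)) = 0"
    unfolding three_term using DERIV_unique[OF _ DERIV_const] by blast
  then show ?thesis by (simp add: algebra_simps)
qed

text \<open>The derivative of \<open>zeta_relation\<close> in b at 0. Divided by W(c)^2 W(d)^2, the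
  right side is the difference of (log W)'' at c and d, that is, a difference of values of the
  Weierstrass p-function.\<close>

lemma p_relation:
  "W1 0 ^ 2 * (W (c + d) * W (c - d)) =
   (W2 c * W c - W1 c ^ 2) * W d ^ 2 - (W2 d * W d - W1 d ^ 2) * W c ^ 2"
proof -
  define H where "H = (\<lambda>b. W1 0 * W (2 * b) * (W (c + d) * W (c - d)) -
   ((W1 (b + c) * W (b - c) + W (b + c) * W1 (b - c)) * (W (b + d) * W (b - d)) -
   (W1 (b + d) * W (b - d) + W (b + d) * W1 (b - d)) * (W (b + c) * W (b - c))))"
  have H0: "H = (\<lambda>b. 0)" unfolding H_def using zeta_relation by (intro ext) simp
  have "(H has_field_derivative
     W1 0 * (W1 (2 * 0) * 2) * (W (c + d) * W (c - d)) -
     (((W2 (0 + c) * W (0 - c) + W1 (0 - c) * W1 (0 + c)) + (W1 (0 + c) * W1 (0 - c) + W2 (0 - c) * W (0 + c))) * (W (0 + d) * W (0 - d))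
       + (W1 (0 + d) * W (0 - d) + W1 (0 - d) * W (0 + d)) * (W1 (0 + c) * W (0 - c) + W (0 + c) * W1 (0 - c))
       - (((W2 (0 + d) * W (0 - d) + W1 (0 - d) * W1 (0 + d)) + (W1 (0 + d) * W1 (0 - d) + W2 (0 - d) * W (0 + d))) * (W (0 + c) * W (0 - c))
       + (W1 (0 + c) * W (0 - c) + W1 (0 - c) * W (0 + c)) * (W1 (0 + d) * W (0 - d) + W (0 + d) * W1 (0 - d))))) (at 0)"
    unfolding H_def by (rule derivative_eq_intros refl | simp)+
  then have "W1 0 * (W1 (2 * 0) * 2) * (W (c + d) * W (c - d)) -
     (((W2 (0 + c) * W (0 - c) + W1 (0 - c) * W1 (0 + c)) + (W1 (0 + c) * W1 (0 - c) + W2 (0 - c) * W (0 + c))) * (W (0 + d) * W (0 - d))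
       + (W1 (0 + d) * W (0 - d) + W1 (0 - d) * W (0 + d)) * (W1 (0 + c) * W (0 - c) + W (0 + c) * W1 (0 - c))
       - (((W2 (0 + d) * W (0 - d) + W1 (0 - d) * W1 (0 + d)) + (W1 (0 + d) * W1 (0 - d) + W2 (0 - d) * W (0 + d))) * (W (0 + c) * W (0 - c))
       + (W1 (0 + c) * W (0 - c) + W1 (0 - c) * W (0 + c)) * (W1 (0 + d) * W (0 - d) + W (0 + d) * W1 (0 - d)))) = 0"
    unfolding H0 using DERIV_unique[OF _ DERIV_const] by blast
  then have "2 * (W1 0 ^ 2 * (W (c + d) * W (c - d))) =
   2 * ((W2 c * W c - W1 c ^ 2) * W d ^ 2 - (W2 d * W d - W1 d ^ 2) * W c ^ 2)"
    by (simp add: odd W1_even W2_odd algebra_simps power2_eq_square)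
  then show ?thesis by (subst (asm) mult_left_cancel) auto
qed

text \<open>The derivative of \<open>p_relation\<close> in c at c = u. The bracket is W(u)^3 times
  (log W)'''(u); in classical terms sigma(2u)/sigma(u)^4 = -p'(u).\<close>

lemma p_deriv_relation:
  "W1 0 ^ 3 * W (2 * u) = W u * (W3 u * W u ^ 2 - 3 * W2 u * W1 u * W u + 2 * W1 u ^ 3)"
proof -
  define H where "H = (\<lambda>c. W1 0 ^ 2 * (W (c + u) * W (c - u)) -
   ((W2 c * W c - W1 c ^ 2) * W u ^ 2 - (W2 u * W u - W1 u ^ 2) * W c ^ 2))"
  have H0: "H = (\<lambda>b. 0)" unfolding H_def using p_relation by (intro ext) simp
  have "(H has_field_derivative
     W1 0 ^ 2 * (W1 (u + u) * W (u - u) + W1 (u - u) * W (u + u)) -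
     ((W3 u * W u + W1 u * W2 u - 2 * W1 u * W2 u) * W u ^ 2 - (W2 u * W u - W1 u ^ 2) * (2 * W u * W1 u))) (at u)"
    unfolding H_def by (rule derivative_eq_intros refl | simp)+
  then have "W1 0 ^ 2 * (W1 (u + u) * W (u - u) + W1 (u - u) * W (u + u)) -
     ((W3 u * W u + W1 u * W2 u - 2 * W1 u * W2 u) * W u ^ 2 - (W2 u * W u - W1 u ^ 2) * (2 * W u * W1 u)) = 0"
    unfolding H0 using DERIV_unique[OF _ DERIV_const] by blast
  then show ?thesis by (simp add: algebra_simps power2_eq_square power3_eq_cube)
qed

end

lemma weier_weierstrass_function:
  assumes "norm q < 1" "q \<noteq> 0"
  shows "weierstrass_function (weier q) (deriv (weier q)) ((deriv ^^ 2) (weier q)) ((deriv ^^ 3) (weier q))"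
proof
  have H: "(deriv ^^ n) (weier q) holomorphic_on UNIV" for n
    by (rule holomorphic_higher_deriv[OF weier_holomorphic[OF assms(1)]]) simp
  have D: "((deriv ^^ n) (weier q) has_field_derivative (deriv ^^ Suc n) (weier q) u) (at u)" for n u
    using holomorphic_derivI[OF H[of n] open_UNIV, of u] by simp
  show "(weier q has_field_derivative deriv (weier q) u) (at u)"
    "(deriv (weier q) has_field_derivative (deriv ^^ 2) (weier q) u) (at u)"
    "((deriv ^^ 2) (weier q) has_field_derivative (deriv ^^ 3) (weier q) u) (at u)" for u
    using D[of 0 u] D[of 1 u] D[of 2 u] by (simp_all add: numeral_2_eq_2 numeral_3_eq_3)
qed (use weier_three_term[OF assms] weier_minus[OF assms(1)] in auto)

lemma deriv_weier_0:
  assumes "norm q < 1"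
  shows "deriv (weier q) 0 = - (euler q ^ 3)"
  by (rule DERIV_imp_deriv[OF weier_has_derivative_at_0[OF assms]])

section \<open>Lambert series\<close>

text \<open>The closed form of the sum of n^2 x^n, and at x = e^u the negative of the third
  derivative of log(1 - e^u).\<close>

definition lambert3 :: "complex \<Rightarrow> complex" where
  "lambert3 x = x * (1 + x) / (1 - x) ^ 3"

text \<open>The numerator of the third logarithmic derivative \<open>(log g)''' = log3_num g / g\<^sup>3\<close>.\<close>

definition log3_num :: "(complex \<Rightarrow> complex) \<Rightarrow> complex \<Rightarrow> complex" where
  "log3_num g u = (deriv ^^ 3) g u * g u ^ 2 - 3 * (deriv ^^ 2) g u * deriv g u * g u + 2 * deriv g u ^ 3"

text \<open>Additivity of the third logarithmic derivative with denominators cleared. As a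
  polynomial in derivatives, \<open>log3_num\<close> needs no branch of the logarithm and passes to
  locally uniform limits.\<close>

lemma log3_num_mult:
  assumes "g holomorphic_on UNIV" "h holomorphic_on UNIV"
  shows "log3_num (\<lambda>u. g u * h u) u = log3_num g u * h u ^ 3 + log3_num h u * g u ^ 3"
proof -
  have D: "(deriv ^^ n) (\<lambda>u. g u * h u) u =
      (\<Sum>i = 0..n. of_nat (n choose i) * (deriv ^^ i) g u * (deriv ^^ (n - i)) h u)" for n
    by (rule higher_deriv_mult[OF assms]) auto
  have S2: "sum F {0..2} = F 0 + F 1 + F 2" for F :: "nat \<Rightarrow> complex"
    by (simp add: numeral_2_eq_2)
  have S3: "sum F {0..3} = F 0 + F 1 + F 2 + F 3" for F :: "nat \<Rightarrow> complex"
    by (simp add: numeral_3_eq_3 numeral_2_eq_2)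
  have D1: "deriv (\<lambda>u. g u * h u) u = g u * deriv h u + deriv g u * h u"
    using D[of 1] by simp
  have D2: "(deriv ^^ 2) (\<lambda>u. g u * h u) u = g u * (deriv ^^ 2) h u + 2 * deriv g u * deriv h u + (deriv ^^ 2) g u * h u"
    unfolding D S2 by simp
  have D3: "(deriv ^^ 3) (\<lambda>u. g u * h u) u = g u * (deriv ^^ 3) h u + 3 * deriv g u * (deriv ^^ 2) h u +
      3 * (deriv ^^ 2) g u * deriv h u + (deriv ^^ 3) g u * h u"
    unfolding D S3 by (simp add: numeral_3_eq_3 numeral_2_eq_2)
  show ?thesis
    unfolding log3_num_def D1 D2 D3 by (simp add: algebra_simps power2_eq_square power3_eq_cube)
qed

lemma higher_deriv_eqI:
  assumes "\<And>u. (g has_field_derivative g1 u) (at u)" "\<And>u. (g1 has_field_derivative g2 u) (at u)"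
    "\<And>u. (g2 has_field_derivative g3 u) (at u)"
  shows "deriv g = g1" "(deriv ^^ 2) g = g2" "(deriv ^^ 3) g = g3"
proof -
  show 1: "deriv g = g1" using assms(1) DERIV_imp_deriv by blast
  have 2: "deriv g1 = g2" using assms(2) DERIV_imp_deriv by blast
  have 3: "deriv g2 = g3" using assms(3) DERIV_imp_deriv by blast
  show "(deriv ^^ 2) g = g2" "(deriv ^^ 3) g = g3"
    by (simp_all add: numeral_2_eq_2 numeral_3_eq_3 1 2 3)
qed

lemma log3_num_one_minus_exp:
  "log3_num (\<lambda>u. 1 - c * exp u) u = - (c * exp u * (1 + c * exp u))"
proof -
  have "deriv (\<lambda>u. 1 - c * exp u) = (\<lambda>u. - c * exp u)"
    "(deriv ^^ 2) (\<lambda>u. 1 - c * exp u) = (\<lambda>u. - c * exp u)"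
    "(deriv ^^ 3) (\<lambda>u. 1 - c * exp u) = (\<lambda>u. - c * exp u)"
    by (rule higher_deriv_eqI[where ?g1.0 = "\<lambda>u. - c * exp u" and ?g2.0 = "\<lambda>u. - c * exp u"];
        auto intro!: derivative_eq_intros)+
  then show ?thesis by (simp add: log3_num_def algebra_simps power2_eq_square power3_eq_cube)
qed

lemma log3_num_one_minus_exp_minus:
  "log3_num (\<lambda>u. 1 - c * exp (- u)) u = c * exp (- u) * (1 + c * exp (- u))"
proof -
  have "deriv (\<lambda>u. 1 - c * exp (- u)) = (\<lambda>u. c * exp (- u))"
    "(deriv ^^ 2) (\<lambda>u. 1 - c * exp (- u)) = (\<lambda>u. - c * exp (- u))"
    "(deriv ^^ 3) (\<lambda>u. 1 - c * exp (- u)) = (\<lambda>u. c * exp (- u))"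
    by (rule higher_deriv_eqI[where ?g1.0 = "\<lambda>u. c * exp (- u)" and ?g2.0 = "\<lambda>u. - c * exp (- u)"];
        auto intro!: derivative_eq_intros)+
  then show ?thesis by (simp add: log3_num_def algebra_simps power2_eq_square power3_eq_cube)
qed

lemma log3_num_exp_half: "log3_num (\<lambda>u. c * exp (- u / 2)) u = 0"
proof -
  have "deriv (\<lambda>u. c * exp (- u / 2)) = (\<lambda>u. - c / 2 * exp (- u / 2))"
    "(deriv ^^ 2) (\<lambda>u. c * exp (- u / 2)) = (\<lambda>u. c / 4 * exp (- u / 2))"
    "(deriv ^^ 3) (\<lambda>u. c * exp (- u / 2)) = (\<lambda>u. - c / 8 * exp (- u / 2))"
    by (rule higher_deriv_eqI[where ?g1.0 = "\<lambda>u. - c / 2 * exp (- u / 2)" and ?g2.0 = "\<lambda>u. c / 4 * exp (- u / 2)"];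
        auto intro!: derivative_eq_intros)+
  then show ?thesis by (simp add: log3_num_def algebra_simps power2_eq_square power3_eq_cube)
qed

text \<open>The constant is kept in full and only the two z-dependent products are truncated:
  constants and exp(-u/2) do not affect the third logarithmic derivative.\<close>

definition weier_part :: "complex \<Rightarrow> nat \<Rightarrow> complex \<Rightarrow> complex" where
  "weier_part q N u = euler q * exp (- u / 2) * (\<Prod>j<N. (1 - q ^ j * exp u) * (1 - q ^ Suc j * exp (- u)))"

lemma weier_part_holomorphic: "weier_part q N holomorphic_on UNIV"
  unfolding weier_part_def[abs_def] by (intro holomorphic_intros) auto

lemma log3_num_weier_part:
  assumes "\<And>j. q ^ j * exp u \<noteq> 1" "\<And>j. q ^ Suc j * exp (- u) \<noteq> 1"
  shows "log3_num (weier_part q N) u =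
         weier_part q N u ^ 3 * (\<Sum>j<N. lambert3 (q ^ Suc j * exp (- u)) - lambert3 (q ^ j * exp u))"
proof (induction N)
  case 0
  show ?case
    using log3_num_exp_half[of "euler q"] by (simp add: weier_part_def[abs_def])
next
  case (Suc N)
  define x where "x = q ^ N * exp u"
  define y where "y = q ^ Suc N * exp (- u)"
  have ne: "1 - x \<noteq> 0" "1 - y \<noteq> 0"
    using assms(1)[of N] assms(2)[of N] by (auto simp: x_def y_def)
  have eq: "weier_part q (Suc N) = (\<lambda>u. weier_part q N u * ((1 - q ^ N * exp u) * (1 - q ^ Suc N * exp (- u))))"
    by (simp add: weier_part_def[abs_def] mult_ac)
  define w where "w = weier_part q N u"
  define T where "T = (\<Sum>j<N. lambert3 (q ^ Suc j * exp (- u)) - lambert3 (q ^ j * exp u))"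
  have "log3_num (weier_part q (Suc N)) u =
     log3_num (weier_part q N) u * ((1 - x) * (1 - y)) ^ 3 +
     log3_num (\<lambda>u. (1 - q ^ N * exp u) * (1 - q ^ Suc N * exp (- u))) u * weier_part q N u ^ 3"
    unfolding eq x_def y_def by (intro log3_num_mult weier_part_holomorphic holomorphic_intros)
  also have "log3_num (\<lambda>u. (1 - q ^ N * exp u) * (1 - q ^ Suc N * exp (- u))) u =
     log3_num (\<lambda>u. 1 - q ^ N * exp u) u * (1 - y) ^ 3 + log3_num (\<lambda>u. 1 - q ^ Suc N * exp (- u)) u * (1 - x) ^ 3"
    unfolding x_def y_def by (intro log3_num_mult holomorphic_intros)
  also have "log3_num (\<lambda>u. 1 - q ^ N * exp u) u = - (x * (1 + x))"
    unfolding x_def by (rule log3_num_one_minus_exp)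
  also have "log3_num (\<lambda>u. 1 - q ^ Suc N * exp (- u)) u = y * (1 + y)"
    unfolding y_def by (rule log3_num_one_minus_exp_minus)
  also have "- (x * (1 + x)) = - lambert3 x * (1 - x) ^ 3"
    using ne by (simp add: lambert3_def)
  also have "y * (1 + y) = lambert3 y * (1 - y) ^ 3"
    using ne by (simp add: lambert3_def)
  finally have "log3_num (weier_part q (Suc N)) u = w ^ 3 * T * ((1 - x) * (1 - y)) ^ 3 +
     (- lambert3 x * (1 - x) ^ 3 * (1 - y) ^ 3 + lambert3 y * (1 - y) ^ 3 * (1 - x) ^ 3) * w ^ 3"
    unfolding Suc.IH w_def T_def .
  also have "\<dots> = (w * ((1 - x) * (1 - y))) ^ 3 * (T + (lambert3 y - lambert3 x))"
    unfolding power_mult_distrib by (simp only: distrib_left distrib_right left_diff_distrib right_diff_distrib mult_ac) simp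
  also have "w * ((1 - x) * (1 - y)) = weier_part q (Suc N) u"
    by (simp add: eq x_def y_def w_def)
  finally show ?case
    by (simp add: T_def x_def y_def)
qed

lemma weier_part_uniform_limit:
  assumes q: "norm q < 1"
  shows "uniform_limit (cball u 1) (weier_part q) (weier q) sequentially"
proof -
  define P where "P = (\<lambda>N z. \<Prod>j<N. 1 - z * q ^ j)"
  have P: "uniform_limit (cball u 1) (\<lambda>N v. P N (f v)) (\<lambda>v. qpoch_inf (f v) q) sequentially"
    if "continuous_on UNIV f" for f :: "complex \<Rightarrow> complex"
  proof -
    have "compact (f ` cball u 1)"
      by (intro compact_continuous_image continuous_on_subset[OF that]) auto
    then obtain R where R: "\<And>v. v \<in> cball u 1 \<Longrightarrow> f v \<in> cball 0 R"
      using compact_imp_bounded bounded_iff by (metis (no_types, lifting) imageI mem_cball_0)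
    show ?thesis
      using uniform_limit_compose'[OF qpoch_inf_uniform_limit[OF q, of R], of f "cball u 1"] R
      by (auto simp: P_def)
  qed
  have cont: "continuous_on UNIV (\<lambda>z. qpoch_inf z q)"
    by (rule holomorphic_on_imp_continuous_on[OF qpoch_inf_holomorphic[OF q]])
  have bd: "bounded ((\<lambda>v. g v) ` cball u 1)" if "continuous_on UNIV g" for g :: "complex \<Rightarrow> complex"
    by (intro compact_imp_bounded compact_continuous_image continuous_on_subset[OF that]) auto
  have c1: "continuous_on UNIV (\<lambda>v. qpoch_inf (exp v) q)" "continuous_on UNIV (\<lambda>v. qpoch_inf (q * exp (- v)) q)"
    by (intro continuous_on_compose2[OF cont] continuous_intros; simp)+
  have "uniform_limit (cball u 1) (\<lambda>N v. (euler q * exp (- v / 2)) * (P N (exp v) * P N (q * exp (- v))))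
     (\<lambda>v. (euler q * exp (- v / 2)) * (qpoch_inf (exp v) q * qpoch_inf (q * exp (- v)) q)) sequentially"
    by (intro uniform_lim_mult P uniform_limit_const bd continuous_intros c1) auto
  also have "(\<lambda>N v. (euler q * exp (- v / 2)) * (P N (exp v) * P N (q * exp (- v)))) = weier_part q"
    by (intro ext) (simp add: weier_part_def P_def prod.distrib mult_ac)
  also have "(\<lambda>v. (euler q * exp (- v / 2)) * (qpoch_inf (exp v) q * qpoch_inf (q * exp (- v)) q)) = weier q"
    by (intro ext) (simp add: weier_def theta_def exp_minus inverse_eq_divide)
  finally show ?thesis .
qed

text \<open>Two evaluations of (log W)''' at z = exp u. The product gives it factor by factor, since
  the derivatives of the partial products converge; \<open>p_deriv_relation\<close> gives the
  quotient, with W'(0)^3 = -E^9.\<close>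

lemma lambert3_sums:
  assumes q: "norm q < 1" "q \<noteq> 0" and z: "z \<noteq> 0" "\<And>j. z * q ^ j \<noteq> 1" "\<And>j. q ^ Suc j \<noteq> z"
  shows "(\<lambda>j. lambert3 (q ^ Suc j / z) - lambert3 (z * q ^ j)) sums
         (- (euler q ^ 9) * z * theta q (z ^ 2) / theta q z ^ 4)"
proof -
  obtain u where u: "z = exp u" using exp_Ln[OF z(1)] by metis
  interpret weierstrass_function "weier q" "deriv (weier q)" "(deriv ^^ 2) (weier q)" "(deriv ^^ 3) (weier q)"
    by (rule weier_weierstrass_function[OF q])
  have th: "theta q z \<noteq> 0" by (rule theta_nonzero[OF q(1) z(2,3,1)])
  have W0: "weier q u \<noteq> 0" using th by (simp add: weier_def u)
  define S where "S = (\<lambda>N. \<Sum>j<N. lambert3 (q ^ Suc j * exp (- u)) - lambert3 (q ^ j * exp u))"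
  have ul: "uniform_limit (ball u 1) (weier_part q) (weier q) sequentially"
    by (rule uniform_limit_on_subset[OF weier_part_uniform_limit[OF q(1)] ball_subset_cball])
  have D: "(\<lambda>N. (deriv ^^ n) (weier_part q N) u) \<longlonglongrightarrow> (deriv ^^ n) (weier q) u" for n
    by (rule higher_deriv_complex_uniform_limit[OF ul])
      (auto intro!: always_eventually holomorphic_on_subset[OF weier_part_holomorphic])
  have lim: "(\<lambda>N. log3_num (weier_part q N) u) \<longlonglongrightarrow> log3_num (weier q) u"
    unfolding log3_num_def using D[of 0] D[of 1] D[of 2] D[of 3] by (auto intro!: tendsto_intros)
  have Wlim: "(\<lambda>N. weier_part q N u) \<longlonglongrightarrow> weier q u" using D[of 0] by simp
  have ne: "q ^ j * exp u \<noteq> 1" "q ^ Suc j * exp (- u) \<noteq> 1" for j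
    using z(2)[of j] z(3)[of j] by (auto simp: u exp_minus field_simps)
  have "(\<lambda>N. log3_num (weier_part q N) u / weier_part q N u ^ 3) \<longlonglongrightarrow> log3_num (weier q) u / weier q u ^ 3"
    by (intro tendsto_intros lim Wlim) (use W0 in auto)
  moreover have "weier_part q N u \<noteq> 0" for N
    using ne qpoch_inf_self_nonzero[OF q(1)] by (auto simp: weier_part_def)
  ultimately have S: "S \<longlonglongrightarrow> log3_num (weier q) u / weier q u ^ 3"
    using log3_num_weier_part[OF ne] by (simp add: S_def)
  have "deriv (weier q) 0 ^ 3 * weier q (2 * u) = weier q u * log3_num (weier q) u"
    unfolding log3_num_def by (rule p_deriv_relation)
  then have "log3_num (weier q) u / weier q u ^ 3 = deriv (weier q) 0 ^ 3 * (weier q (2 * u) / weier q u ^ 4)"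
    using W0 by (simp add: power_numeral_reduce)
  also have "deriv (weier q) 0 ^ 3 = - (euler q ^ 9)"
    unfolding deriv_weier_0[OF q(1)] by (simp add: power_mult[symmetric])
  also have "weier q (2 * u) / weier q u ^ 4 = z * theta q (z ^ 2) / theta q z ^ 4"
  proof -
    have "exp (- u / 2) ^ 4 = exp (- u) * exp (- u)"
      using exp_of_nat_mult[of 4 "- u / 2"] exp_add[of "- u" "- u"] by simp
    then have "weier q u ^ 4 = exp (- u) * exp (- u) * theta q z ^ 4"
      by (simp add: weier_def power_mult_distrib u)
    moreover have "weier q (2 * u) = exp (- u) * theta q (z ^ 2)"
      by (simp add: weier_def u exp_double)
    ultimately show ?thesis
      using th by (simp only:) (simp add: u exp_minus divide_simps)
  qed
  finally have "S \<longlonglongrightarrow> - (euler q ^ 9) * z * theta q (z ^ 2) / theta q z ^ 4"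
    using S by (simp add: mult.assoc)
  then show ?thesis
    by (simp add: sums_def S_def u exp_minus inverse_eq_divide mult.commute)
qed

text \<open>Telescoping isolates \<open>lambert3 z\<close>, so that both families run over the same
  powers q^(j+1). This form is used at roots of unity, where z itself lies on the unit
  circle.\<close>

lemma lambert3_sums':
  assumes q: "norm q < 1" "q \<noteq> 0" and z: "z \<noteq> 0" "\<And>j. z * q ^ j \<noteq> 1" "\<And>j. q ^ Suc j \<noteq> z"
  shows "(\<lambda>j. lambert3 (q ^ Suc j / z) - lambert3 (z * q ^ Suc j)) sums
         (lambert3 z - (euler q ^ 9) * z * theta q (z ^ 2) / theta q z ^ 4)"
proof -
  have "isCont lambert3 0"
    unfolding lambert3_def by (intro continuous_intros) auto
  moreover have "(\<lambda>N. z * q ^ N) \<longlonglongrightarrow> 0"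
    using tendsto_mult_right_zero[OF LIMSEQ_power_zero[OF q(1)]] by simp
  ultimately have "(\<lambda>N. lambert3 (z * q ^ N)) \<longlonglongrightarrow> lambert3 0"
    by (rule isCont_tendsto_compose)
  then have "(\<lambda>j. lambert3 (z * q ^ j) - lambert3 (z * q ^ Suc j)) sums (lambert3 (z * q ^ 0) - lambert3 0)"
    by (rule telescope_sums')
  from sums_add[OF lambert3_sums[OF assms] this] show ?thesis
    by (simp add: lambert3_def)
qed

section \<open>Klein's quartic and the discriminant\<close>

text \<open>On the quartic the cyclic permutation of x, y, z acts on d as a Mobius map of order
  three; up to sign the three monomial quotients are the orbit d, (d-1)/d, 1/(1-d).\<close>

lemma klein_parametrization:
  fixes x y z :: complex
  assumes nz: "x \<noteq> 0" "y \<noteq> 0" "z \<noteq> 0" and klein: "x ^ 3 * y + y ^ 3 * z + z ^ 3 * x = 0"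
    and d: "d = - (z ^ 2 * x / y ^ 3)"
  shows "d - 1 = x ^ 3 / (z * y ^ 2)" "y ^ 2 * z / x ^ 3 = - (1 / (1 - d))"
    "x ^ 2 * y / z ^ 3 = - ((d - 1) / d)" "d \<noteq> 0" "d \<noteq> 1"
proof -
  have "d * y ^ 3 = - (z ^ 2 * x)" using nz by (simp add: d)
  moreover have "(d - 1) * (z * y ^ 2) * y = z * (d * y ^ 3) - y ^ 3 * z"
    by (simp add: power_numeral_reduce algebra_simps)
  ultimately have "(d - 1) * (z * y ^ 2) * y = - (z ^ 3 * x) - y ^ 3 * z"
    by (simp add: power_numeral_reduce)
  also have "\<dots> = x ^ 3 * y"
  proof -
    have "- (z ^ 3 * x) - y ^ 3 * z - x ^ 3 * y = - (x ^ 3 * y + y ^ 3 * z + z ^ 3 * x)" by simp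
    then show ?thesis unfolding klein by simp
  qed
  finally have "(d - 1) * (z * y ^ 2) = x ^ 3"
    using nz by simp
  then show K: "d - 1 = x ^ 3 / (z * y ^ 2)"
    using nz by (simp add: eq_divide_eq)
  show "d \<noteq> 0" using nz by (simp add: d)
  show "d \<noteq> 1" using K nz by auto
  have "1 - d = - (x ^ 3 / (z * y ^ 2))" using K by (metis minus_diff_eq)
  then show "y ^ 2 * z / x ^ 3 = - (1 / (1 - d))" using nz by (simp add: mult_ac)
  show "x ^ 2 * y / z ^ 3 = - ((d - 1) / d)"
    unfolding K using nz by (simp add: d divide_simps power_numeral_reduce)
qed

text \<open>\<open>g0\<close>, \<open>g1\<close>, \<open>g2\<close> are the coefficients of the
  cubic expanded at \<xi>, and both sides are its discriminant. The quantities \<open>p\<close> and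
  \<open>r\<close> are invariant under translation and satisfy 27 disc = 4 p^3 - r^2.\<close>

lemma cubic_disc_shift:
  fixes \<xi> a b :: complex
  assumes "g0 = \<xi> ^ 3 - a * \<xi> ^ 2 + b * \<xi>" "g1 = 3 * \<xi> ^ 2 - 2 * a * \<xi> + b" "g2 = 3 * \<xi> - a"
  shows "b ^ 2 * (a ^ 2 - 4 * b) = g2 ^ 2 * g1 ^ 2 - 4 * g1 ^ 3 - 4 * g2 ^ 3 * g0 + 18 * g2 * g1 * g0 - 27 * g0 ^ 2"
proof -
  define p where "p = g2 ^ 2 - 3 * g1"
  define r where "r = 2 * g2 ^ 3 - 9 * g2 * g1 + 27 * g0"
  have p: "p = a ^ 2 - 3 * b"
    unfolding p_def assms by (simp add: algebra_simps power_numeral_reduce)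
  have r: "r = 9 * a * b - 2 * a ^ 3"
    unfolding r_def assms by (simp add: algebra_simps power_numeral_reduce)
  have "27 * (b ^ 2 * (a ^ 2 - 4 * b)) = 4 * p ^ 3 - r ^ 2"
    unfolding p r by (simp add: algebra_simps power_numeral_reduce)
  also have "\<dots> = 27 * (g2 ^ 2 * g1 ^ 2 - 4 * g1 ^ 3 - 4 * g2 ^ 3 * g0 + 18 * g2 * g1 * g0 - 27 * g0 ^ 2)"
    unfolding p_def r_def by (simp add: algebra_simps power_numeral_reduce)
  finally show ?thesis by (subst (asm) mult_left_cancel) auto
qed

text \<open>The cubic comes from Tate's normal form y^2 + C x y - B y = x^3 - B x^2 of a curve with
  a point of order 7, by completing the square in y and scaling the abscissa by l^2.\<close>

lemma tate_disc:
  fixes l d :: complex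
  assumes "g0 = l ^ 6 * B ^ 2 / 4" "g1 = - (l ^ 4 * C * B / 2)" "g2 = l ^ 2 * (C ^ 2 / 4 - B)"
    and B: "B = d ^ 3 - d ^ 2" and C: "C = 1 - (d ^ 2 - d)"
  shows "16 * (g2 ^ 2 * g1 ^ 2 - 4 * g1 ^ 3 - 4 * g2 ^ 3 * g0 + 18 * g2 * g1 * g0 - 27 * g0 ^ 2) =
     l ^ 12 * (d * (d - 1)) ^ 7 * (d ^ 3 - 8 * d ^ 2 + 5 * d + 1)"
proof -
  have "16 * (g2 ^ 2 * g1 ^ 2 - 4 * g1 ^ 3 - 4 * g2 ^ 3 * g0 + 18 * g2 * g1 * g0 - 27 * g0 ^ 2) =
    l ^ 12 * (B ^ 3 * (C ^ 4 - 8 * B * C ^ 2 + 16 * B ^ 2 - C ^ 3 + 36 * C * B - 27 * B))"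
    unfolding assms(1-3) by (simp add: field_simps power_numeral_reduce)
  also have "B ^ 3 = d ^ 6 * (d - 1) ^ 3"
    unfolding B by (simp add: algebra_simps power_numeral_reduce)
  also have "C ^ 4 - 8 * B * C ^ 2 + 16 * B ^ 2 - C ^ 3 + 36 * C * B - 27 * B =
      d * (d - 1) ^ 4 * (d ^ 3 - 8 * d ^ 2 + 5 * d + 1)"
    unfolding B C by (simp add: algebra_simps power_numeral_reduce)
  finally show ?thesis by (simp add: power_mult_distrib power_numeral_reduce mult_ac)
qed

text \<open>\<open>X1\<close>, \<open>X2\<close>, \<open>X4\<close> play the abscissas of P, 2P, 4P
  for a point P of order 7. Their differences add up to 0, which is Klein's equation. The three
  prescribed values then determine the monic cubic, which is identified with Tate's.\<close>

theorem klein_discriminant: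
  fixes x y z :: complex
  assumes nz: "x \<noteq> 0" "y \<noteq> 0" "z \<noteq> 0"
    and diff: "X2 - X1 = z / (x * y ^ 2)" "X4 - X2 = x / (y * z ^ 2)" "X1 - X4 = y / (z * x ^ 2)"
    and curve: "X1 ^ 3 - a * X1 ^ 2 + b * X1 = (y / x ^ 4) ^ 2 / 4"
      "X2 ^ 3 - a * X2 ^ 2 + b * X2 = (z / y ^ 4) ^ 2 / 4"
      "X4 ^ 3 - a * X4 ^ 2 + b * X4 = (x / z ^ 4) ^ 2 / 4"
  shows "x ^ 3 * y + y ^ 3 * z + z ^ 3 * x = 0"
    and "16 * (b ^ 2 * (a ^ 2 - 4 * b)) * (x * y * z) ^ 4 =
         - (y ^ 2 * z / x ^ 3 + z ^ 2 * x / y ^ 3 + x ^ 2 * y / z ^ 3) - 8"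
proof -
  have "z / (x * y ^ 2) + x / (y * z ^ 2) + y / (z * x ^ 2) = 0"
    unfolding diff[symmetric] by simp
  then have "(z / (x * y ^ 2) + x / (y * z ^ 2) + y / (z * x ^ 2)) * (x ^ 2 * y ^ 2 * z ^ 2) = 0"
    by simp
  also have "(z / (x * y ^ 2) + x / (y * z ^ 2) + y / (z * x ^ 2)) * (x ^ 2 * y ^ 2 * z ^ 2) =
      x ^ 3 * y + y ^ 3 * z + z ^ 3 * x"
    using nz by (simp add: field_simps power_numeral_reduce)
  finally show klein: "x ^ 3 * y + y ^ 3 * z + z ^ 3 * x = 0" .
  define d where "d = - (z ^ 2 * x / y ^ 3)"
  \<comment> \<open>The scale for which the abscissas, measured from \<open>X1\<close>, become l^2
    times 0, d^3 - d^2 and d^2 - d, those of Tate's curve.\<close>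
  define l where "l = y ^ 3 / (x ^ 3 * z)"
  note kp = klein_parametrization[OF nz klein d_def]
  define B where "B = d ^ 3 - d ^ 2"
  define C where "C = 1 - (d ^ 2 - d)"
  have l0: "l \<noteq> 0" using nz by (simp add: l_def)
  have B': "B = d ^ 2 * (d - 1)" by (simp add: B_def algebra_simps power_numeral_reduce)
  have dd: "d * (d - 1) = - (z * x ^ 4 / y ^ 5)"
    unfolding kp(1) using nz by (simp add: d_def divide_simps power_numeral_reduce)
  have d2: "X2 - X1 = l ^ 2 * B"
    unfolding diff(1) B' kp(1) using nz by (simp add: d_def l_def divide_simps power_numeral_reduce)
  have d4: "X4 - X1 = l ^ 2 * (1 - C)"
  proof -
    have "X4 - X1 = - (y / (z * x ^ 2))" unfolding diff(3)[symmetric] by simp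
    also have "\<dots> = l ^ 2 * (d * (d - 1))"
      unfolding dd using nz by (simp add: l_def divide_simps power_numeral_reduce)
    also have "d * (d - 1) = 1 - C" by (simp add: C_def algebra_simps power2_eq_square)
    finally show ?thesis .
  qed
  have Y1: "(y / x ^ 4) ^ 2 = l ^ 6 * B ^ 2"
  proof -
    have "y / x ^ 4 = l * (X2 - X1)" unfolding diff(1) using nz by (simp add: l_def divide_simps power_numeral_reduce)
    then show ?thesis by (simp add: d2 power_mult_distrib power_numeral_reduce)
  qed
  have Y2: "(z / y ^ 4) ^ 2 = l ^ 6 * (B * (1 - C)) ^ 2"
  proof -
    have "z / y ^ 4 = - (l * (X2 - X1) * (d * (d - 1)))"
      unfolding diff(1) dd using nz by (simp add: l_def divide_simps power_numeral_reduce)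
    also have "d * (d - 1) = 1 - C" by (simp add: C_def algebra_simps power2_eq_square)
    finally show ?thesis by (simp add: d2 power_mult_distrib power_numeral_reduce)
  qed
  have Y4: "(x / z ^ 4) ^ 2 = l ^ 6 * (d * (d - 1) ^ 3) ^ 2"
  proof -
    have "x / z ^ 4 = - (l ^ 3 * (d * (d - 1) ^ 3))"
      unfolding kp(1) using nz by (simp add: l_def d_def divide_simps power_numeral_reduce)
    then show ?thesis by (simp add: power_mult_distrib power_mult[symmetric])
  qed
  define g0 where "g0 = X1 ^ 3 - a * X1 ^ 2 + b * X1"
  define g1 where "g1 = 3 * X1 ^ 2 - 2 * a * X1 + b"
  define g2 where "g2 = 3 * X1 - a"
  have shift: "X ^ 3 - a * X ^ 2 + b * X = (X - X1) ^ 3 + g2 * (X - X1) ^ 2 + g1 * (X - X1) + g0" for X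
    by (simp add: g0_def g1_def g2_def algebra_simps power_numeral_reduce)
  have g0: "g0 = l ^ 6 * B ^ 2 / 4"
    unfolding g0_def curve(1) Y1 ..
  have e2: "(l ^ 2 * B) ^ 3 + g2 * (l ^ 2 * B) ^ 2 + g1 * (l ^ 2 * B) + g0 = l ^ 6 * (B * (1 - C)) ^ 2 / 4"
    using curve(2) unfolding shift[of X2] d2 Y2 .
  have e4: "(l ^ 2 * (1 - C)) ^ 3 + g2 * (l ^ 2 * (1 - C)) ^ 2 + g1 * (l ^ 2 * (1 - C)) + g0 = l ^ 6 * (d * (d - 1) ^ 3) ^ 2 / 4"
    using curve(3) unfolding shift[of X4] d4 Y4 .
  \<comment> \<open>Tate's coefficients satisfy the same two equations as \<open>g1\<close>,
    \<open>g2\<close>. These are linear, and their solution is unique because the abscissas 0,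
    \<open>B\<close>, \<open>1 - C\<close> are distinct.\<close>
  define G1 where "G1 = - (l ^ 4 * C * B / 2)"
  define G2 where "G2 = l ^ 2 * (C ^ 2 / 4 - B)"
  have B0: "B \<noteq> 0" and C0: "1 - C \<noteq> 0" and BC: "B - (1 - C) \<noteq> 0"
  proof -
    show "B \<noteq> 0" using kp(4,5) by (simp add: B')
    have C': "1 - C = d * (d - 1)" by (simp add: C_def algebra_simps power2_eq_square)
    then show "1 - C \<noteq> 0" using kp(4,5) by simp
    have "B - (1 - C) = d * (d - 1) * (d - 1)" unfolding C' B' by (simp add: algebra_simps power2_eq_square)
    then show "B - (1 - C) \<noteq> 0" using kp(4,5) by simp
  qed
  have f2: "(l ^ 2 * B) ^ 3 + G2 * (l ^ 2 * B) ^ 2 + G1 * (l ^ 2 * B) + g0 = l ^ 6 * (B * (1 - C)) ^ 2 / 4"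
    unfolding G1_def G2_def g0 by (simp add: field_simps power_numeral_reduce)
  have f4: "(l ^ 2 * (1 - C)) ^ 3 + G2 * (l ^ 2 * (1 - C)) ^ 2 + G1 * (l ^ 2 * (1 - C)) + g0 = l ^ 6 * (d * (d - 1) ^ 3) ^ 2 / 4"
  proof -
    have "(l ^ 2 * (1 - C)) ^ 3 + G2 * (l ^ 2 * (1 - C)) ^ 2 + G1 * (l ^ 2 * (1 - C)) + g0 =
       l ^ 6 * ((1 - C) ^ 3 + (C ^ 2 / 4 - B) * (1 - C) ^ 2 - C * B / 2 * (1 - C) + B ^ 2 / 4)"
      unfolding G1_def G2_def g0 by (simp add: field_simps power_numeral_reduce)
    also have "(1 - C) ^ 3 + (C ^ 2 / 4 - B) * (1 - C) ^ 2 - C * B / 2 * (1 - C) + B ^ 2 / 4 = (d * (d - 1) ^ 3) ^ 2 / 4"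
      unfolding B_def C_def by (simp add: field_simps power_numeral_reduce)
    finally show ?thesis by simp
  qed
  have h2: "(g2 - G2) * (l ^ 2 * B) + (g1 - G1) = 0"
  proof -
    have "((g2 - G2) * (l ^ 2 * B) + (g1 - G1)) * (l ^ 2 * B) =
       ((l ^ 2 * B) ^ 3 + g2 * (l ^ 2 * B) ^ 2 + g1 * (l ^ 2 * B) + g0) - ((l ^ 2 * B) ^ 3 + G2 * (l ^ 2 * B) ^ 2 + G1 * (l ^ 2 * B) + g0)"
      by (simp add: algebra_simps power2_eq_square)
    also have "\<dots> = 0" unfolding e2 f2 by simp
    finally show ?thesis using l0 B0 by simp
  qed
  have h4: "(g2 - G2) * (l ^ 2 * (1 - C)) + (g1 - G1) = 0"
  proof -
    have "((g2 - G2) * (l ^ 2 * (1 - C)) + (g1 - G1)) * (l ^ 2 * (1 - C)) =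
       ((l ^ 2 * (1 - C)) ^ 3 + g2 * (l ^ 2 * (1 - C)) ^ 2 + g1 * (l ^ 2 * (1 - C)) + g0) - ((l ^ 2 * (1 - C)) ^ 3 + G2 * (l ^ 2 * (1 - C)) ^ 2 + G1 * (l ^ 2 * (1 - C)) + g0)"
      by (simp add: algebra_simps power2_eq_square)
    also have "\<dots> = 0" unfolding e4 f4 by simp
    finally show ?thesis using l0 C0 by simp
  qed
  have "(g2 - G2) * (l ^ 2 * (B - (1 - C))) =
      ((g2 - G2) * (l ^ 2 * B) + (g1 - G1)) - ((g2 - G2) * (l ^ 2 * (1 - C)) + (g1 - G1))"
    by (simp add: algebra_simps)
  then have "(g2 - G2) * (l ^ 2 * (B - (1 - C))) = 0"
    unfolding h2 h4 by simp
  then have g2: "g2 = G2" using l0 BC by simp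
  then have g1: "g1 = G1" using h2 by simp
  have m1: "16 * (b ^ 2 * (a ^ 2 - 4 * b)) = l ^ 12 * (d * (d - 1)) ^ 7 * (d ^ 3 - 8 * d ^ 2 + 5 * d + 1)"
    unfolding cubic_disc_shift[OF g0_def g1_def g2_def]
    by (rule tate_disc[OF g0 g1[unfolded G1_def] g2[unfolded G2_def] B_def C_def])
  \<comment> \<open>The factor (xyz)^4 is what removes the scale: it cancels l^12 (d(d-1))^8, so the
    normalized discriminant depends on d alone.\<close>
  have m2: "l ^ 12 * (d * (d - 1)) ^ 8 * (x * y * z) ^ 4 = 1"
  proof -
    have "l ^ 3 * (d * (d - 1)) ^ 2 * (x * y * z) = 1"
      unfolding dd l_def using nz by (simp add: divide_simps power_numeral_reduce)
    then have "(l ^ 3 * (d * (d - 1)) ^ 2 * (x * y * z)) ^ 4 = 1" by simp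
    then show ?thesis by (simp add: power_mult_distrib power_mult[symmetric])
  qed
  have m3: "(d * (d - 1)) ^ 7 * (d * (d - 1)) = (d * (d - 1)) ^ 8"
    by (simp only: power_Suc2[symmetric]) simp
  have "l ^ 12 * u7 * p * P * u = l ^ 12 * (u7 * u) * P * p" for u7 p P u
    by simp
  from this[of "(d * (d - 1)) ^ 7" "d ^ 3 - 8 * d ^ 2 + 5 * d + 1" "(x * y * z) ^ 4" "d * (d - 1)"]
  have "16 * (b ^ 2 * (a ^ 2 - 4 * b)) * (x * y * z) ^ 4 * (d * (d - 1)) = d ^ 3 - 8 * d ^ 2 + 5 * d + 1"
    unfolding m1 m2 m3 by simp
  then have "16 * (b ^ 2 * (a ^ 2 - 4 * b)) * (x * y * z) ^ 4 = (d ^ 3 - 8 * d ^ 2 + 5 * d + 1) / (d * (d - 1))"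
    using kp(4,5) by (simp add: field_simps)
  \<comment> \<open>Partial fractions; the three non-constant terms are the orbit of d from
    \<open>klein_parametrization\<close>.\<close>
  also have "\<dots> = 1 / (1 - d) + d + (d - 1) / d - 8"
    using kp(4,5) by (simp add: divide_simps) (simp add: algebra_simps power_numeral_reduce)
  also have "\<dots> = - (y ^ 2 * z / x ^ 3 + z ^ 2 * x / y ^ 3 + x ^ 2 * y / z ^ 3) - 8"
    unfolding kp(2,3) by (simp add: d_def)
  finally show "16 * (b ^ 2 * (a ^ 2 - 4 * b)) * (x * y * z) ^ 4 =
         - (y ^ 2 * z / x ^ 3 + z ^ 2 * x / y ^ 3 + x ^ 2 * y / z ^ 3) - 8" .
qed

text \<open>\<open>A1\<close>, \<open>A2\<close>, \<open>A4\<close> arise later as right sides of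
  the linear system for the logarithmic derivatives, and 9, 1, -3 from inverting it. Each of the
  nine products is -(xyz)^2 times a monomial in t1, t2, t3. Cyclically consecutive ones satisfy u v
  = u - 1, which reduces everything to the sums of the t_i and of their squares.\<close>

theorem klein_theta_sum:
  fixes x y z :: complex
  assumes nz: "x \<noteq> 0" "y \<noteq> 0" "z \<noteq> 0" and klein: "x ^ 3 * y + y ^ 3 * z + z ^ 3 * x = 0"
    and A: "A1 = y ^ 3 / (x ^ 3 * z)" "A2 = z ^ 3 / (y ^ 3 * x)" "A4 = x ^ 3 / (z ^ 3 * y)"
    and T: "T = - (y ^ 2 * z / x ^ 3 + z ^ 2 * x / y ^ 3 + x ^ 2 * y / z ^ 3)"
  shows "x ^ 7 * (9 * A1 + A2 - 3 * A4) + y ^ 7 * (9 * A2 + A4 - 3 * A1) + z ^ 7 * (9 * A4 + A1 - 3 * A2) =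
         2 * (x * y * z) ^ 2 * (T ^ 2 - 9 * T + 15)"
proof -
  define d where "d = - (z ^ 2 * x / y ^ 3)"
  note kp = klein_parametrization[OF nz klein d_def]
  define t1 where "t1 = - (y ^ 2 * z / x ^ 3)"
  define t2 where "t2 = - (z ^ 2 * x / y ^ 3)"
  define t3 where "t3 = - (x ^ 2 * y / z ^ 3)"
  have t: "t1 = 1 / (1 - d)" "t2 = d" "t3 = (d - 1) / d"
    using kp(2,3) by (simp_all add: t1_def t2_def t3_def d_def)
  let ?P = "x * y * z"
  have a: "x ^ 7 * A1 = - (?P ^ 2 * t3)" "y ^ 7 * A2 = - (?P ^ 2 * t1)" "z ^ 7 * A4 = - (?P ^ 2 * t2)"
    unfolding A t1_def t2_def t3_def using nz by (simp_all add: divide_simps power_numeral_reduce)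
  have b: "x ^ 7 * A4 = - (?P ^ 2 * (t2 ^ 2 * t3 ^ 3))" "y ^ 7 * A1 = - (?P ^ 2 * (t3 ^ 2 * t1 ^ 3))"
    "z ^ 7 * A2 = - (?P ^ 2 * (t1 ^ 2 * t2 ^ 3))"
    unfolding A t1_def t2_def t3_def using nz by (simp_all add: divide_simps power_numeral_reduce)
  have c: "x ^ 7 * A2 = - (?P ^ 2 * (t2 ^ 2 * t3))" "y ^ 7 * A4 = - (?P ^ 2 * (t3 ^ 2 * t1))"
    "z ^ 7 * A1 = - (?P ^ 2 * (t1 ^ 2 * t2))"
    unfolding A t1_def t2_def t3_def using nz by (simp_all add: divide_simps power_numeral_reduce)
  have "x ^ 7 * (9 * A1 + A2 - 3 * A4) + y ^ 7 * (9 * A2 + A4 - 3 * A1) + z ^ 7 * (9 * A4 + A1 - 3 * A2) =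
     9 * (x ^ 7 * A1) + x ^ 7 * A2 - 3 * (x ^ 7 * A4) + (9 * (y ^ 7 * A2) + y ^ 7 * A4 - 3 * (y ^ 7 * A1)) +
     (9 * (z ^ 7 * A4) + z ^ 7 * A1 - 3 * (z ^ 7 * A2))"
    by (simp add: algebra_simps)
  then have "x ^ 7 * (9 * A1 + A2 - 3 * A4) + y ^ 7 * (9 * A2 + A4 - 3 * A1) + z ^ 7 * (9 * A4 + A1 - 3 * A2) =
    ?P ^ 2 * (3 * (t2 ^ 2 * t3 ^ 3 + t3 ^ 2 * t1 ^ 3 + t1 ^ 2 * t2 ^ 3) - (t2 ^ 2 * t3 + t3 ^ 2 * t1 + t1 ^ 2 * t2)
      - 9 * (t1 + t2 + t3))"
    unfolding a b c by (simp add: algebra_simps)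
  also have "3 * (t2 ^ 2 * t3 ^ 3 + t3 ^ 2 * t1 ^ 3 + t1 ^ 2 * t2 ^ 3) - (t2 ^ 2 * t3 + t3 ^ 2 * t1 + t1 ^ 2 * t2)
      - 9 * (t1 + t2 + t3) = 2 * (T ^ 2 - 9 * T + 15)"
  proof -
    have T': "T = t1 + t2 + t3" by (simp add: T t1_def t2_def t3_def)
    have d: "1 - d \<noteq> 0" "d \<noteq> 0" using kp by auto
    have r: "t2 * t3 = t2 - 1" "t3 * t1 = t3 - 1" "t1 * t2 = t1 - 1"
      unfolding t using d by (simp_all add: divide_simps)
    have cube: "u ^ 2 * v ^ 3 = u ^ 2 - 3 * u + 2 + v" "u ^ 2 * v = u ^ 2 - u" if uv: "u * v = u - 1" for u v :: complex
    proof -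
      have "u ^ 2 * v = u * (u * v)" by (simp add: power2_eq_square)
      then show *: "u ^ 2 * v = u ^ 2 - u" unfolding uv by (simp add: algebra_simps power2_eq_square)
      have "u ^ 2 * v ^ 3 = (u * v) ^ 2 * v" by (simp add: power_numeral_reduce mult_ac)
      also have "\<dots> = (u - 1) ^ 2 * v" unfolding uv ..
      also have "\<dots> = u ^ 2 * v - 2 * (u * v) + v" by (simp add: algebra_simps power2_eq_square)
      finally show "u ^ 2 * v ^ 3 = u ^ 2 - 3 * u + 2 + v" unfolding * uv by (simp add: algebra_simps)
    qed
    have T2: "T ^ 2 = t1 ^ 2 + t2 ^ 2 + t3 ^ 2 + 2 * (t2 * t3 + t3 * t1 + t1 * t2)"
      unfolding T' by (simp add: algebra_simps power2_eq_square)
    show ?thesis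
      unfolding cube[OF r(1)] cube[OF r(2)] cube[OF r(3)] T2 r unfolding T' by (simp add: algebra_simps)
  qed
  finally show ?thesis by (simp add: mult_ac)
qed

section \<open>Points of order two\<close>

lemma norm_power_less_1:
  fixes q :: complex
  assumes "norm q < 1" "m > 0"
  shows "norm (q ^ m) < 1"
  using assms by (simp add: norm_power power_less_one_iff)

lemma qpoch_inf_power_split:
  assumes q: "norm q < 1" and m: "m > 0"
  shows "qpoch_inf z q = (\<Prod>i<m. qpoch_inf (z * q ^ i) (q ^ m))"
proof (rule LIMSEQ_unique)
  have "strict_mono (\<lambda>N. m * N)" using m by (simp add: strict_mono_def)
  from LIMSEQ_subseq_LIMSEQ[OF qpoch_inf_LIMSEQ[OF q, of z] this]
  show "(\<lambda>N. \<Prod>j<m * N. 1 - z * q ^ j) \<longlonglongrightarrow> qpoch_inf z q" by (simp add: o_def)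
  have "(\<Prod>j<m * N. 1 - z * q ^ j) = (\<Prod>i<m. \<Prod>j<N. 1 - z * q ^ i * (q ^ m) ^ j)" for N
  proof (induction N)
    case (Suc N)
    have U: "{..<m * Suc N} = {..<m * N} \<union> {m * N..<m * N + m}"
      by (auto simp only: mult_Suc_right lessThan_iff atLeastLessThan_iff Un_iff)
    have "(\<Prod>j<m * Suc N. 1 - z * q ^ j) =
        (\<Prod>j<m * N. 1 - z * q ^ j) * (\<Prod>j = m * N..<m * N + m. 1 - z * q ^ j)"
      unfolding U by (rule prod.union_disjoint) (simp_all only: finite_lessThan finite_atLeastLessThan ivl_disj_int)
    also have "(\<Prod>j = m * N..<m * N + m. 1 - z * q ^ j) = (\<Prod>i<m. 1 - z * q ^ i * (q ^ m) ^ N)"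
    proof (rule prod.reindex_bij_witness[of _ "\<lambda>i. m * N + i" "\<lambda>j. j - m * N"])
      fix j assume "j \<in> {m * N..<m * N + m}"
      then have "q ^ j = q ^ (j - m * N) * q ^ (m * N)"
        by (subst power_add[symmetric]) simp
      then show "1 - z * q ^ (j - m * N) * (q ^ m) ^ N = 1 - z * q ^ j"
        by (simp add: power_mult)
    qed auto
    finally show ?case by (simp add: Suc prod.distrib)
  qed simp
  moreover have "(\<lambda>N. \<Prod>i<m. \<Prod>j<N. 1 - z * q ^ i * (q ^ m) ^ j) \<longlonglongrightarrow>
      (\<Prod>i<m. qpoch_inf (z * q ^ i) (q ^ m))"
    by (intro tendsto_prod qpoch_inf_LIMSEQ norm_power_less_1 assms)
  ultimately show "(\<lambda>N. \<Prod>j<m * N. 1 - z * q ^ j) \<longlonglongrightarrow> (\<Prod>i<m. qpoch_inf (z * q ^ i) (q ^ m))"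
    by simp
qed

lemma qpoch_inf_square:
  assumes s: "norm s < 1"
  shows "qpoch_inf (z ^ 2) (s ^ 2) =
         qpoch_inf z (s ^ 2) * qpoch_inf (z * s) (s ^ 2) * (qpoch_inf (- z) (s ^ 2) * qpoch_inf (- z * s) (s ^ 2))"
proof -
  have "qpoch_inf (z ^ 2) (s ^ 2) = qpoch_inf z s * qpoch_inf (- z) s"
  proof (rule qpoch_inf_eqI[OF norm_power_less_1[OF s]])
    have "(\<Prod>j<N. 1 - z * s ^ j) * (\<Prod>j<N. 1 - (- z) * s ^ j) = (\<Prod>j<N. 1 - z ^ 2 * (s ^ 2) ^ j)" for N
      unfolding prod.distrib[symmetric]
      by (intro prod.cong) (auto simp: algebra_simps power2_eq_square power_mult_distrib)
    then show "(\<lambda>N. \<Prod>j<N. 1 - z ^ 2 * (s ^ 2) ^ j) \<longlonglongrightarrow> qpoch_inf z s * qpoch_inf (- z) s"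
      using tendsto_mult[OF qpoch_inf_LIMSEQ[OF s, of z] qpoch_inf_LIMSEQ[OF s, of "- z"]] by simp
  qed simp
  moreover have "qpoch_inf w s = qpoch_inf w (s ^ 2) * qpoch_inf (w * s) (s ^ 2)" for w
  proof -
    have "{..<2::nat} = {0, 1}" by auto
    then show ?thesis using qpoch_inf_power_split[OF s, of 2 w] by simp
  qed
  ultimately show ?thesis by simp
qed

context
  fixes s p :: complex
  assumes s: "norm s < 1" "s \<noteq> 0" and p: "p = s ^ 2"
begin

lemma p_facts: "norm p < 1" "p \<noteq> 0"
  using s norm_power_less_1[OF s(1), of 2] by (simp_all add: p)

text \<open>The factors of (z^2; s^2) split by sign and by the parity of the power of s. The
  arguments on the right are the translates of z by the points 1, -1, s, -s killed by
  doubling.\<close>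

lemma theta_duplication:
  assumes z: "z \<noteq> 0"
  shows "theta p (z ^ 2) * euler p ^ 3 = theta p z * theta p (- z) * (theta p (s * z) * theta p (- s * z))"
proof -
  have 1: "qpoch_inf (z ^ 2) p = qpoch_inf z p * qpoch_inf (s * z) p * (qpoch_inf (- z) p * qpoch_inf (- s * z) p)"
    using qpoch_inf_square[OF s(1), of z] by (simp add: p mult.commute)
  have 2: "qpoch_inf (p / z ^ 2) p = qpoch_inf (s / z) p * qpoch_inf (p / z) p * (qpoch_inf (- (s / z)) p * qpoch_inf (- (p / z)) p)"
    using qpoch_inf_square[OF s(1), of "s / z"] by (simp add: p power2_eq_square)
  have 3: "p / (s * z) = s / z" "p / (- s * z) = - (s / z)" "p / - z = - (p / z)"
    using s by (simp_all add: p power2_eq_square)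
  show ?thesis
    unfolding theta_def 1 2 3 by (simp add: power3_eq_cube mult_ac)
qed

text \<open>Splitting the Euler product of p itself gives (s;p) (-s;p) (-p;p) = 1, which enters
  squared; the 2 is the first factor of (-1;p).\<close>

lemma theta_half_periods: "theta p (- 1) * theta p s * theta p (- s) = 2 * euler p ^ 3"
proof -
  have 1: "qpoch_inf (- 1) p = 2 * qpoch_inf (- p) p"
    using qpoch_inf_rec[OF p_facts(1), of "- 1"] by simp
  have 2: "euler p = qpoch_inf s p * euler p * (qpoch_inf (- s) p * qpoch_inf (- p) p)"
    using qpoch_inf_square[OF s(1), of s] by (simp add: p power2_eq_square)
  then have 3: "qpoch_inf s p * qpoch_inf (- s) p * qpoch_inf (- p) p = 1"
    using qpoch_inf_self_nonzero[OF p_facts(1)] by (simp add: mult_ac)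
  have 4: "p / s = s" "p / - s = - s" "p / - 1 = - p" using s by (simp_all add: p power2_eq_square)
  have "theta p (- 1) * theta p s * theta p (- s) =
      2 * euler p ^ 3 * (qpoch_inf s p * qpoch_inf (- s) p * qpoch_inf (- p) p) ^ 2"
    unfolding theta_def 1 4 by (simp add: power3_eq_cube power2_eq_square mult_ac)
  then show ?thesis unfolding 3 by simp
qed

text \<open>The Plucker relation for the four arguments u, v, 1, -1 in the determinants of
  \<open>theta_mult_split\<close>.\<close>

lemma theta_minus_one_relation:
  assumes "u \<noteq> 0" "v \<noteq> 0"
  shows "v * (theta p (u * v) * theta p (u / v)) * theta p (- 1) ^ 2 =
         theta p u ^ 2 * theta p (- v) ^ 2 - theta p (- u) ^ 2 * theta p v ^ 2"
proof -
  define P where "P = theta_even p"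
  define Q where "Q = theta_odd p"
  have V: "y * (theta p (x * y) * theta p (x / y)) = P x * Q y - Q x * P y" if "x \<noteq> 0" "y \<noteq> 0" for x y
    unfolding P_def Q_def by (rule theta_mult_split[OF p_facts that])
  have 1: "theta p (- 1) ^ 2 = P (- 1) * Q 1 - Q (- 1) * P 1"
    using V[of "- 1" 1] by (simp add: power2_eq_square)
  have 2: "theta p x ^ 2 = P x * Q 1 - Q x * P 1" if "x \<noteq> 0" for x
    using V[of x 1] that by (simp add: power2_eq_square)
  have 3: "theta p (- x) ^ 2 = - (P x * Q (- 1) - Q x * P (- 1))" if "x \<noteq> 0" for x
    using arg_cong[OF V[of x "- 1"], of uminus] that by (simp add: power2_eq_square)
  show ?thesis
    unfolding V[OF assms] 1 2[OF assms(1)] 2[OF assms(2)] 3[OF assms(1)] 3[OF assms(2)]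
    by (simp add: algebra_simps)
qed

text \<open>The cases v = s and v = -s of the preceding relation; since s u = p (u/s), the
  quasi-period turns theta(u/s) into a multiple of theta(su). They show that the abscissa minus a
  root of the cubic is a square up to elementary factors.\<close>

lemma theta_s_relations:
  assumes u: "u \<noteq> 0"
  shows "u * theta p (s * u) ^ 2 * theta p (- 1) ^ 2 =
           theta p (- u) ^ 2 * theta p s ^ 2 - theta p u ^ 2 * theta p (- s) ^ 2"
    and "u * theta p (- s * u) ^ 2 * theta p (- 1) ^ 2 =
           theta p (- u) ^ 2 * theta p (- s) ^ 2 - theta p u ^ 2 * theta p s ^ 2"
proof -
  have *: "theta p (s * u) = - (s / u) * theta p (u / s)" if "u \<noteq> 0" for u
    using theta_shift[of p "u / s"] p_facts s that by (simp add: p power2_eq_square field_simps)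
  have "theta p (u / s) = - (u / s) * theta p (s * u)"
    unfolding *[OF u] using s u by simp
  then have "s * (theta p (u * s) * theta p (u / s)) = - (u * theta p (s * u) ^ 2)"
    using s by (simp add: power2_eq_square mult_ac)
  then have "- (u * theta p (s * u) ^ 2) * theta p (- 1) ^ 2 =
           theta p u ^ 2 * theta p (- s) ^ 2 - theta p (- u) ^ 2 * theta p s ^ 2"
    using theta_minus_one_relation[OF u s(2)] by simp
  from arg_cong[of _ _ uminus, OF this] show "u * theta p (s * u) ^ 2 * theta p (- 1) ^ 2 =
           theta p (- u) ^ 2 * theta p s ^ 2 - theta p u ^ 2 * theta p (- s) ^ 2"
    by simp
  have "theta p (- u / s) = (u / s) * theta p (- s * u)"
    using *[of "- u"] s u by simp
  then have "- s * (theta p (u * (- s)) * theta p (u / (- s))) = - (u * theta p (- s * u) ^ 2)"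
    using s by (simp add: power2_eq_square mult_ac)
  then have "- (u * theta p (- s * u) ^ 2) * theta p (- 1) ^ 2 =
           theta p u ^ 2 * theta p s ^ 2 - theta p (- u) ^ 2 * theta p (- s) ^ 2"
    using theta_minus_one_relation[OF u, of "- s"] s by simp
  from arg_cong[of _ _ uminus, OF this] show "u * theta p (- s * u) ^ 2 * theta p (- 1) ^ 2 =
           theta p (- u) ^ 2 * theta p (- s) ^ 2 - theta p u ^ 2 * theta p s ^ 2"
    by simp
qed

text \<open>Jacobi's identity theta_3^4 = theta_4^4 + theta_2^4, obtained as the case u = s of the
  second relation.\<close>

lemma theta_half_period_fourth_powers:
  "s * theta p (- 1) ^ 4 = theta p (- s) ^ 4 - theta p s ^ 4"
proof -
  have "theta p (- s * s) = theta p (- 1)"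
    using theta_shift[of p "- 1"] p_facts by (simp add: p power2_eq_square)
  then show ?thesis
    using theta_s_relations(2)[OF s(2)] by (simp add: power_numeral_reduce mult_ac)
qed

text \<open>The Weierstrass cubic in the coordinate \<open>X\<close> for which one of the roots is at the origin.\<close>

lemma theta_weierstrass_cubic:
  defines "X \<equiv> \<lambda>u. theta p (- u) ^ 2 / (theta p u ^ 2 * theta p (- 1) ^ 2)"
  shows "\<exists>a b. 16 * (b ^ 2 * (a ^ 2 - 4 * b)) * euler p ^ 12 = p \<and>
     (\<forall>u. u \<noteq> 0 \<longrightarrow> theta p u \<noteq> 0 \<longrightarrow>
       X u ^ 3 - a * X u ^ 2 + b * X u = (u * theta p (u ^ 2) / theta p u ^ 4) ^ 2 / 4) \<and>
     (\<forall>u v. u \<noteq> 0 \<longrightarrow> v \<noteq> 0 \<longrightarrow> theta p u \<noteq> 0 \<longrightarrow> theta p v \<noteq> 0 \<longrightarrow>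
       X u - X v = - (v * (theta p (u * v) * theta p (u / v))) / (theta p u ^ 2 * theta p v ^ 2))"
proof -
  define E where "E = euler p"
  define t where "t = theta p (- 1) ^ 2"
  define A where "A = theta p s ^ 2"
  define B where "B = theta p (- s) ^ 2"
  have E0: "E \<noteq> 0" using qpoch_inf_self_nonzero[OF p_facts(1)] by (simp add: E_def)
  have tAB: "t * A * B = 4 * E ^ 6"
  proof -
    have "t * A * B = (theta p (- 1) * theta p s * theta p (- s)) ^ 2"
      by (simp add: t_def A_def B_def power_mult_distrib)
    also have "\<dots> = 4 * E ^ 6"
      unfolding theta_half_periods by (simp add: E_def power_mult_distrib power_mult[symmetric])
    finally show ?thesis .
  qed
  then have nz: "t \<noteq> 0" "A \<noteq> 0" "B \<noteq> 0" using E0 by auto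
  have fourth: "B ^ 2 - A ^ 2 = s * t ^ 2"
    using theta_half_period_fourth_powers by (simp add: A_def B_def t_def power_mult[symmetric])
  \<comment> \<open>The roots of the cubic are the values of \<open>X\<close> at the points -1, s,
    -s of order two, namely 0, B/(A t) and A/(B t); \<open>a\<close> and \<open>b\<close> are the
    sum and the product of the last two.\<close>
  define a where "a = B / (A * t) + A / (B * t)"
  define b where "b = 1 / t ^ 2"
  have "a ^ 2 - 4 * b = ((B ^ 2 - A ^ 2) / (A * B * t)) ^ 2"
    unfolding a_def b_def using nz by (simp add: divide_simps power2_eq_square) (simp add: algebra_simps)
  then have "b ^ 2 * (a ^ 2 - 4 * b) = b ^ 2 * ((s * t ^ 2) / (A * B * t)) ^ 2"
    by (simp only: fourth)
  also have "\<dots> = p / (t * A * B) ^ 2"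
    unfolding b_def p using nz by (simp add: divide_simps power_numeral_reduce)
  finally have "b ^ 2 * (a ^ 2 - 4 * b) = p / (t * A * B) ^ 2" .
  \<comment> \<open>Rescaling \<open>X\<close> by E^6, the square of the derivative of
    \<open>weier p\<close> at 0, multiplies this by E^36 and yields p E^24 / 16, the classical
    modular discriminant up to the 16.\<close>
  then have disc: "16 * (b ^ 2 * (a ^ 2 - 4 * b)) * E ^ 12 = p"
    unfolding tAB using E0 by (simp add: power_mult_distrib power_mult[symmetric])
  have cubic: "X u ^ 3 - a * X u ^ 2 + b * X u = (u * theta p (u ^ 2) / theta p u ^ 4) ^ 2 / 4"
    if u: "u \<noteq> 0" "theta p u \<noteq> 0" for u
  proof -
    have X: "X u = theta p (- u) ^ 2 / (theta p u ^ 2 * t)" by (simp add: X_def t_def)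
    have "X u ^ 3 - a * X u ^ 2 + b * X u = X u * (X u - B / (A * t)) * (X u - A / (B * t))"
      unfolding a_def b_def using nz by (simp add: divide_simps power_numeral_reduce) (simp add: algebra_simps)
    also have "X u - B / (A * t) = u * theta p (s * u) ^ 2 / (theta p u ^ 2 * A)"
    proof -
      have "X u - B / (A * t) = (theta p (- u) ^ 2 * A - theta p u ^ 2 * B) / (theta p u ^ 2 * t * A)"
        unfolding X using nz u by (simp add: divide_simps)
      also have "\<dots> = u * theta p (s * u) ^ 2 / (theta p u ^ 2 * A)"
        unfolding A_def B_def theta_s_relations(1)[OF u(1), symmetric] using nz u
        by (simp add: A_def[symmetric] t_def[symmetric])
      finally show ?thesis .
    qed
    also have "X u - A / (B * t) = u * theta p (- s * u) ^ 2 / (theta p u ^ 2 * B)"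
    proof -
      have "X u - A / (B * t) = (theta p (- u) ^ 2 * B - theta p u ^ 2 * A) / (theta p u ^ 2 * t * B)"
        unfolding X using nz u by (simp add: divide_simps)
      also have "\<dots> = u * theta p (- s * u) ^ 2 / (theta p u ^ 2 * B)"
        unfolding A_def B_def theta_s_relations(2)[OF u(1), symmetric] using nz u
        by (simp add: B_def[symmetric] t_def[symmetric])
      finally show ?thesis .
    qed
    also have "X u * (u * theta p (s * u) ^ 2 / (theta p u ^ 2 * A)) * (u * theta p (- s * u) ^ 2 / (theta p u ^ 2 * B)) =
       u ^ 2 * (theta p u * theta p (- u) * (theta p (s * u) * theta p (- s * u))) ^ 2 / (theta p u ^ 8 * (t * A * B))"
      unfolding X using nz u by (simp add: divide_simps power_numeral_reduce)
    also have "\<dots> = (u * theta p (u ^ 2) / theta p u ^ 4) ^ 2 / 4"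
      unfolding theta_duplication[OF u(1), symmetric] tAB E_def[symmetric] using E0
      by (simp add: power_mult_distrib power_divide power_mult[symmetric])
    finally show ?thesis .
  qed
  have diff: "X u - X v = - (v * (theta p (u * v) * theta p (u / v))) / (theta p u ^ 2 * theta p v ^ 2)"
    if u: "u \<noteq> 0" "v \<noteq> 0" "theta p u \<noteq> 0" "theta p v \<noteq> 0" for u v
  proof -
    have "X u - X v = - (theta p u ^ 2 * theta p (- v) ^ 2 - theta p (- u) ^ 2 * theta p v ^ 2) / (theta p u ^ 2 * theta p v ^ 2 * t)"
      unfolding X_def t_def[symmetric] using nz u by (simp add: divide_simps)
    also have "\<dots> = - (v * (theta p (u * v) * theta p (u / v))) / (theta p u ^ 2 * theta p v ^ 2)"
      unfolding theta_minus_one_relation[OF u(1,2), symmetric] t_def[symmetric] using nz by simp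
    finally show ?thesis .
  qed
  show ?thesis
    using disc cubic diff unfolding E_def by blast
qed

end

section \<open>Points of order seven\<close>

lemma theta_exp: "theta p (exp u) = exp (u / 2) * weier p u"
  by (simp add: weier_def mult.assoc[symmetric] exp_add[symmetric])

lemma weier_cubic:
  assumes p: "norm p < 1" "p \<noteq> 0"
  obtains a b X where "16 * (b ^ 2 * (a ^ 2 - 4 * b)) * euler p ^ 12 = p"
    "\<And>u. weier p u \<noteq> 0 \<Longrightarrow> X u ^ 3 - a * X u ^ 2 + b * X u = (weier p (2 * u) / weier p u ^ 4) ^ 2 / 4"
    "\<And>u v. weier p u \<noteq> 0 \<Longrightarrow> weier p v \<noteq> 0 \<Longrightarrow>
        X u - X v = - (weier p (u + v) * weier p (u - v)) / (weier p u ^ 2 * weier p v ^ 2)"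
proof -
  define s where "s = csqrt p"
  have s: "p = s ^ 2" by (simp add: s_def)
  have s1: "norm s < 1" "s \<noteq> 0"
    using p unfolding s by (auto simp: norm_power power_less_one_iff)
  define X where "X = (\<lambda>u. theta p (- exp u) ^ 2 / (theta p (exp u) ^ 2 * theta p (- 1) ^ 2))"
  obtain a b where ab: "16 * (b ^ 2 * (a ^ 2 - 4 * b)) * euler p ^ 12 = p"
    "\<And>u. theta p (exp u) \<noteq> 0 \<Longrightarrow>
       X u ^ 3 - a * X u ^ 2 + b * X u = (exp u * theta p (exp u ^ 2) / theta p (exp u) ^ 4) ^ 2 / 4"
    "\<And>u v. theta p (exp u) \<noteq> 0 \<Longrightarrow> theta p (exp v) \<noteq> 0 \<Longrightarrow>
       X u - X v = - (exp v * (theta p (exp u * exp v) * theta p (exp u / exp v))) / (theta p (exp u) ^ 2 * theta p (exp v) ^ 2)"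
  proof -
    obtain a b where *: "16 * (b ^ 2 * (a ^ 2 - 4 * b)) * euler p ^ 12 = p"
      and **: "\<forall>u. u \<noteq> 0 \<longrightarrow> theta p u \<noteq> 0 \<longrightarrow>
       (theta p (- u) ^ 2 / (theta p u ^ 2 * theta p (- 1) ^ 2)) ^ 3 - a * (theta p (- u) ^ 2 / (theta p u ^ 2 * theta p (- 1) ^ 2)) ^ 2 +
        b * (theta p (- u) ^ 2 / (theta p u ^ 2 * theta p (- 1) ^ 2)) = (u * theta p (u ^ 2) / theta p u ^ 4) ^ 2 / 4"
      and ***: "\<forall>u v. u \<noteq> 0 \<longrightarrow> v \<noteq> 0 \<longrightarrow> theta p u \<noteq> 0 \<longrightarrow> theta p v \<noteq> 0 \<longrightarrow>
       theta p (- u) ^ 2 / (theta p u ^ 2 * theta p (- 1) ^ 2) - theta p (- v) ^ 2 / (theta p v ^ 2 * theta p (- 1) ^ 2) =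
       - (v * (theta p (u * v) * theta p (u / v))) / (theta p u ^ 2 * theta p v ^ 2)"
      using theta_weierstrass_cubic[OF s1 s] by (elim exE conjE)
    show ?thesis
      by (rule that[of b a]) (unfold X_def, rule *, rule **[rule_format], simp, assumption,
          rule ***[rule_format], simp_all)
  qed
  have sq: "exp (u / 2) ^ 2 = exp u" for u :: complex
    using exp_double[of "u / 2"] by simp
  show ?thesis
  proof (rule that[of b a X, OF ab(1)])
    fix u assume u: "weier p u \<noteq> 0"
    have "exp (u / 2) ^ 4 = exp u * exp u"
      using sq[of u] by (simp add: power_numeral_reduce)
    then have "exp u * theta p (exp u ^ 2) / theta p (exp u) ^ 4 = weier p (2 * u) / weier p u ^ 4"
      using theta_exp[of p "2 * u"] theta_exp[of p u] u by (simp add: exp_double power_mult_distrib power2_eq_square)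
    then show "X u ^ 3 - a * X u ^ 2 + b * X u = (weier p (2 * u) / weier p u ^ 4) ^ 2 / 4"
      using ab(2)[of u] u by (simp add: theta_exp)
  next
    fix u v assume uv: "weier p u \<noteq> 0" "weier p v \<noteq> 0"
    have "exp ((u + v) / 2) * exp ((u - v) / 2) = exp u"
      by (subst exp_add[symmetric], rule arg_cong[of _ _ exp]) (simp add: field_simps)
    then have "exp v * (theta p (exp u * exp v) * theta p (exp u / exp v)) =
        exp u * exp v * (weier p (u + v) * weier p (u - v))"
      using theta_exp[of p "u + v"] theta_exp[of p "u - v"] by (simp add: exp_add exp_diff mult_ac)
    then show "X u - X v = - (weier p (u + v) * weier p (u - v)) / (weier p u ^ 2 * weier p v ^ 2)"
      using ab(3)[of u v] uv by (simp add: theta_exp power_mult_distrib sq)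
  qed
qed

definition septic :: "complex \<Rightarrow> complex \<Rightarrow> complex \<Rightarrow> int \<Rightarrow> complex" where
  "septic p k v n = (- 1) powi n * exp (k * of_int (n ^ 2)) * weier p (of_int n * v)"

text \<open>The quadratic exponential and the sign make the values of the Weierstrass function at the
  multiples of a point of order 7 periodic; both cancel in the homogeneous relations below.\<close>

lemma septic_diff:
  "septic p k v (m + n) * septic p k v (m - n) / (septic p k v m ^ 2 * septic p k v n ^ 2) =
   weier p (of_int m * v + of_int n * v) * weier p (of_int m * v - of_int n * v) /
     (weier p (of_int m * v) ^ 2 * weier p (of_int n * v) ^ 2)"
proof -
  have e: "exp (k * of_int ((m + n) ^ 2)) * exp (k * of_int ((m - n) ^ 2)) =
      exp (k * of_int (m ^ 2)) ^ 2 * exp (k * of_int (n ^ 2)) ^ 2"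
    unfolding exp_double[symmetric] exp_add[symmetric]
    by (rule arg_cong[of _ _ exp]) (simp add: algebra_simps power2_eq_square)
  have s: "(- 1 :: complex) powi (m + n) * (- 1) powi (m - n) = 1"
    using power_int_even_odd(1)[of m] by (subst power_int_add[symmetric]) simp_all
  have s2: "((- 1 :: complex) powi j) ^ 2 = 1" for j :: int
    by (simp add: power2_eq_square power_int_minus_one_mult_self)
  have "septic p k v (m + n) * septic p k v (m - n) =
      ((- 1) powi (m + n) * (- 1) powi (m - n)) * (exp (k * of_int ((m + n) ^ 2)) * exp (k * of_int ((m - n) ^ 2))) *
      (weier p (of_int m * v + of_int n * v) * weier p (of_int m * v - of_int n * v))"
    by (simp add: septic_def distrib_right left_diff_distrib)
  moreover have "septic p k v m ^ 2 * septic p k v n ^ 2 =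
      (exp (k * of_int (m ^ 2)) ^ 2 * exp (k * of_int (n ^ 2)) ^ 2) *
      (weier p (of_int m * v) ^ 2 * weier p (of_int n * v) ^ 2)"
    by (simp add: septic_def power_mult_distrib s2)
  ultimately show ?thesis unfolding s e by simp
qed

lemma septic_double:
  "septic p k v (2 * n) / septic p k v n ^ 4 = weier p (2 * (of_int n * v)) / weier p (of_int n * v) ^ 4"
proof -
  have e: "exp (k * of_int ((2 * n) ^ 2)) = exp (k * of_int (n ^ 2)) ^ 4"
    using exp_of_nat_mult[of 4 "k * of_int (n ^ 2)"] by (simp add: mult_ac)
  have s2: "((- 1 :: complex) powi n) ^ 4 = 1"
    using power_int_minus_one_mult_self[of n, where 'a = complex] by (simp add: power_numeral_reduce)
  have "septic p k v (2 * n) = exp (k * of_int (n ^ 2)) ^ 4 * weier p (2 * (of_int n * v))"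
    unfolding septic_def e power_int_even_odd by (simp add: mult_ac)
  moreover have "septic p k v n ^ 4 = exp (k * of_int (n ^ 2)) ^ 4 * weier p (of_int n * v) ^ 4"
    by (simp add: septic_def power_mult_distrib s2)
  ultimately show ?thesis by simp
qed

lemma septic_minus:
  assumes "norm p < 1"
  shows "septic p k v (- n) = - septic p k v n"
  using weier_minus[OF assms, of "of_int n * v"]
  by (simp add: septic_def power_int_minus_one_minus)

lemma septic_eq_0_iff: "septic p k v n = 0 \<longleftrightarrow> weier p (of_int n * v) = 0"
  by (simp add: septic_def)

text \<open>Periodicity and oddness reduce all values of \<open>septic\<close> to x, y, z up to
  sign, and doubling permutes the indices 1, 2, 4 cyclically. The cubic at v, 2v, 4v therefore
  provides exactly the hypotheses of \<open>klein_discriminant\<close>.\<close>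

theorem septic_relations:
  assumes p: "norm p < 1" "p \<noteq> 0" and per: "\<And>n. septic p k v (n + 7) = septic p k v n"
    and nz: "septic p k v 1 \<noteq> 0" "septic p k v 2 \<noteq> 0" "septic p k v 4 \<noteq> 0"
    and xyz: "x = septic p k v 1" "y = septic p k v 2" "z = septic p k v 4"
  shows "x ^ 3 * y + y ^ 3 * z + z ^ 3 * x = 0"
    and "p * (x * y * z) ^ 4 / euler p ^ 12 =
         - (y ^ 2 * z / x ^ 3 + z ^ 2 * x / y ^ 3 + x ^ 2 * y / z ^ 3) - 8"
proof -
  obtain a b X where ab: "16 * (b ^ 2 * (a ^ 2 - 4 * b)) * euler p ^ 12 = p"
    and cubic: "\<And>u. weier p u \<noteq> 0 \<Longrightarrow> X u ^ 3 - a * X u ^ 2 + b * X u = (weier p (2 * u) / weier p u ^ 4) ^ 2 / 4"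
    and diff: "\<And>u v. weier p u \<noteq> 0 \<Longrightarrow> weier p v \<noteq> 0 \<Longrightarrow>
        X u - X v = - (weier p (u + v) * weier p (u - v)) / (weier p u ^ 2 * weier p v ^ 2)"
    using weier_cubic[OF p] by metis
  define Y where "Y = (\<lambda>n. X (of_int n * v))"
  have cubic': "Y n ^ 3 - a * Y n ^ 2 + b * Y n = (septic p k v (2 * n) / septic p k v n ^ 4) ^ 2 / 4"
    if "septic p k v n \<noteq> 0" for n
    using cubic[of "of_int n * v"] that unfolding septic_double Y_def septic_eq_0_iff by simp
  have diff': "Y m - Y n = - (septic p k v (m + n) * septic p k v (m - n) / (septic p k v m ^ 2 * septic p k v n ^ 2))"
    if "septic p k v m \<noteq> 0" "septic p k v n \<noteq> 0" for m n
    using diff[of "of_int m * v" "of_int n * v"] that unfolding septic_diff Y_def septic_eq_0_iff by simp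
  have neg: "septic p k v (7 - n) = - septic p k v n" for n
    using per[of "- n"] septic_minus[OF p(1), of k v n] by simp
  have w: "septic p k v 3 = - z" "septic p k v 5 = - y" "septic p k v 6 = - x" "septic p k v 8 = x"
    "septic p k v (- 3) = z"
    using neg[of 4] neg[of 2] neg[of 1] per[of 1] septic_minus[OF p(1), of k v 3] by (simp_all add: xyz)
  have n0: "x \<noteq> 0" "y \<noteq> 0" "z \<noteq> 0" using nz xyz by auto
  have d: "Y 2 - Y 1 = z / (x * y ^ 2)" "Y 4 - Y 2 = x / (y * z ^ 2)" "Y 1 - Y 4 = y / (z * x ^ 2)"
  proof -
    have "Y 2 - Y 1 = - (- z * x / (y ^ 2 * x ^ 2))" "Y 4 - Y 2 = - (- x * y / (z ^ 2 * y ^ 2))"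
      "Y 1 - Y 4 = - (- y * z / (x ^ 2 * z ^ 2))"
      using diff'[of 2 1] diff'[of 4 2] diff'[of 1 4] nz by (simp_all add: w xyz[symmetric])
    then show "Y 2 - Y 1 = z / (x * y ^ 2)" "Y 4 - Y 2 = x / (y * z ^ 2)" "Y 1 - Y 4 = y / (z * x ^ 2)"
      using n0 by (simp_all add: power2_eq_square)
  qed
  have c: "Y 1 ^ 3 - a * Y 1 ^ 2 + b * Y 1 = (y / x ^ 4) ^ 2 / 4"
      "Y 2 ^ 3 - a * Y 2 ^ 2 + b * Y 2 = (z / y ^ 4) ^ 2 / 4"
      "Y 4 ^ 3 - a * Y 4 ^ 2 + b * Y 4 = (x / z ^ 4) ^ 2 / 4"
    using cubic'[of 1] cubic'[of 2] cubic'[of 4] nz by (simp_all add: w xyz[symmetric])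
  show "x ^ 3 * y + y ^ 3 * z + z ^ 3 * x = 0"
    by (rule klein_discriminant(1)[OF n0 d c])
  have E0: "euler p \<noteq> 0" by (rule qpoch_inf_self_nonzero[OF p(1)])
  then have "p / euler p ^ 12 = 16 * (b ^ 2 * (a ^ 2 - 4 * b))"
    using ab by (simp add: divide_eq_eq)
  then have "p * (x * y * z) ^ 4 / euler p ^ 12 = 16 * (b ^ 2 * (a ^ 2 - 4 * b)) * (x * y * z) ^ 4"
    by (simp only: times_divide_eq_left[symmetric])
  also have "\<dots> = - (y ^ 2 * z / x ^ 3 + z ^ 2 * x / y ^ 3 + x ^ 2 * y / z ^ 3) - 8"
    by (rule klein_discriminant(2)[OF n0 d c])
  finally show "p * (x * y * z) ^ 4 / euler p ^ 12 =
         - (y ^ 2 * z / x ^ 3 + z ^ 2 * x / y ^ 3 + x ^ 2 * y / z ^ 3) - 8" .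
qed

lemma septic_sum:
  fixes x y z :: complex
  assumes "x \<noteq> 0" "y \<noteq> 0" "z \<noteq> 0"
  shows "y / x ^ 4 + z / y ^ 4 + x / z ^ 4 = (y ^ 2 * z / x ^ 3 + z ^ 2 * x / y ^ 3 + x ^ 2 * y / z ^ 3) / (x * y * z)"
proof -
  have "y / x ^ 4 = (y ^ 2 * z / x ^ 3) / (x * y * z)" "z / y ^ 4 = (z ^ 2 * x / y ^ 3) / (x * y * z)"
    "x / z ^ 4 = (x ^ 2 * y / z ^ 3) / (x * y * z)"
    using assms by (simp_all add: divide_simps power_numeral_reduce)
  then show ?thesis by (simp only: add_divide_distrib)
qed

section \<open>The Legendre symbol modulo 7 and twisted Lambert series as double sums\<close>

lemma Legendre_7:
  "Legendre a 7 = (if a mod 7 = 0 then 0 else if a mod 7 \<in> {1, 2, 4} then 1 else - 1)"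
proof -
  have "QuadRes 7 a \<longleftrightarrow> a mod 7 \<in> {0, 1, 2, 4}"
  proof
    assume "QuadRes 7 a"
    then obtain y where y: "y ^ 2 mod 7 = a mod 7" by (auto simp: QuadRes_def cong_def)
    have "y mod 7 \<in> {0, 1, 2, 3, 4, 5, 6}" by (simp; presburger)
    moreover have "y ^ 2 mod 7 = (y mod 7) ^ 2 mod 7" by (simp add: power_mod)
    ultimately show "a mod 7 \<in> {0, 1, 2, 4}" using y by auto
  next
    assume "a mod 7 \<in> {0, 1, 2, 4}"
    then have "\<exists>y\<in>{0, 1, 3, 2}. y ^ 2 mod 7 = a mod 7" by auto
    then show "QuadRes 7 a" unfolding QuadRes_def cong_def by blast
  qed
  then show ?thesis by (auto simp: Legendre_def cong_def)
qed

lemma norm_Legendre_7: "norm (of_int (Legendre a 7) :: complex) \<le> 1"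
  by (simp add: Legendre_7)

lemma summable_square_geometric:
  fixes r :: real
  assumes "0 \<le> r" "r < 1"
  shows "summable (\<lambda>n. of_nat (Suc n) ^ 2 * r ^ Suc n)"
proof -
  have 1: "summable (\<lambda>n. diffs (\<lambda>_. 1) n * x ^ n)" if "norm x < 1" for x :: real
    by (rule termdiff_converges[OF that]) (simp add: summable_geometric)
  have 2: "summable (\<lambda>n. diffs (diffs (\<lambda>_. 1)) n * r ^ n)"
    by (rule termdiff_converges[of _ 1]) (use assms 1 in auto)
  show ?thesis
  proof (rule summable_comparison_test'[OF 2])
    fix n :: nat
    have "real (Suc n) * real (Suc n) * (r ^ n * r) \<le> real (Suc n) * real (Suc (Suc n)) * (r ^ n * 1)"
      using assms by (intro mult_mono) auto
    then show "norm (of_nat (Suc n) ^ 2 * r ^ Suc n) \<le> diffs (diffs (\<lambda>_. 1)) n * r ^ n"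
      using assms by (simp add: diffs_def power2_eq_square mult_ac abs_mult)
  qed
qed

lemma lambert3_series:
  assumes x: "norm x < 1"
  shows "((\<lambda>n. of_nat (Suc n) ^ 2 * x ^ Suc n) has_sum lambert3 x) UNIV"
proof -
  have x1: "x \<noteq> 1" using x by auto
  have sm: "summable (\<lambda>n. norm (of_nat (Suc n) ^ 2 * x ^ Suc n))"
    using summable_square_geometric[of "norm x"] x
    by (simp add: norm_mult norm_power del: power_Suc of_nat_Suc)
  define S where "S = (\<Sum>n. of_nat (Suc n) ^ 2 * x ^ Suc n)"
  have S: "(\<lambda>n. of_nat (Suc n) ^ 2 * x ^ Suc n) sums S"
    unfolding S_def using summable_norm_cancel[OF sm] by (rule summable_sums)
  have "(\<lambda>n. of_nat n ^ 2 * x ^ n) sums S"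
    using sums_Suc_iff[of "\<lambda>n. of_nat n ^ 2 * x ^ n" S] S by simp
  then have "(\<lambda>n. x * (of_nat n ^ 2 * x ^ n)) sums (x * S)"
    by (rule sums_mult)
  from sums_diff[OF S this]
  have "(\<lambda>n. x * (2 * (of_nat (Suc n) * x ^ n) - x ^ n)) sums (S - x * S)"
    by (simp add: algebra_simps power2_eq_square)
  moreover have "(\<lambda>n. x * (2 * (of_nat (Suc n) * x ^ n) - x ^ n)) sums (x * (2 * (1 / (1 - x) ^ 2) - 1 / (1 - x)))"
    by (intro sums_mult sums_diff geometric_deriv_sums geometric_sums x)
  ultimately have "S - x * S = x * (2 * (1 / (1 - x) ^ 2) - 1 / (1 - x))"
    by (rule sums_unique2)
  moreover have "x * (2 * (1 / (1 - x) ^ 2) - 1 / (1 - x)) = x * (1 + x) / (1 - x) ^ 2"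
    using x1 by (simp add: divide_simps power2_eq_square) (simp add: algebra_simps)
  ultimately have "(1 - x) * S = x * (1 + x) / (1 - x) ^ 2"
    by (simp add: algebra_simps)
  then have "S = x * (1 + x) / (1 - x) ^ 2 / (1 - x)"
    using x1 by (simp add: eq_divide_eq mult_ac)
  then have "S = lambert3 x"
    by (simp add: lambert3_def power_numeral_reduce mult_ac)
  then show ?thesis using norm_summable_imp_has_sum[OF sm] S by simp
qed

text \<open>Since (m+1)(n+1) \<ge> m + n + 1, the family is dominated by a product of two convergent
  series. Its absolute summability permits both orders of summation.\<close>

lemma lambert_pairs_summable:
  fixes d :: "nat \<Rightarrow> nat \<Rightarrow> complex"
  assumes q: "norm q < 1" and d: "\<And>m n. norm (d m n) \<le> 1"
  shows "(\<lambda>(m, n). d m n * (of_nat (Suc n) ^ 2 * q ^ (Suc m * Suc n))) summable_on UNIV"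
proof -
  define r where "r = norm q"
  have r: "0 \<le> r" "r < 1" using q by (auto simp: r_def)
  define G where "G = (\<lambda>(m, n). complex_of_real (r ^ m) * complex_of_real (of_nat (Suc n) ^ 2 * r ^ Suc n))"
  have "(\<lambda>m. complex_of_real (r ^ m)) summable_on UNIV"
    using r by (intro norm_summable_imp_summable_on) (simp add: norm_power)
  moreover have "(\<lambda>n. complex_of_real (of_nat (Suc n) ^ 2 * r ^ Suc n)) summable_on UNIV"
    using r summable_square_geometric[OF r]
    by (intro norm_summable_imp_summable_on, unfold norm_of_real)
      (simp add: abs_mult del: power_Suc of_nat_Suc)
  ultimately have "G summable_on (UNIV \<times> UNIV)"
    unfolding G_def summable_on_def using has_sum_mult_Times by blast
  then have "(\<lambda>x. norm (G x)) summable_on UNIV"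
    using summable_on_iff_abs_summable_on_complex by auto
  then show ?thesis
  proof (rule summable_on_norm_bound)
    fix x :: "nat \<times> nat"
    obtain m n where x: "x = (m, n)" by (cases x)
    have "r ^ (Suc m * Suc n) \<le> r ^ (m + Suc n)"
      using r by (intro power_decreasing) auto
    then have le: "r ^ (Suc m * Suc n) \<le> r ^ m * r ^ Suc n"
      by (simp only: power_add)
    have "norm (d m n * (of_nat (Suc n) ^ 2 * q ^ (Suc m * Suc n))) \<le> 1 * (of_nat (Suc n) ^ 2 * r ^ (Suc m * Suc n))"
      unfolding norm_mult norm_power r_def[symmetric] norm_of_nat
      using d r by (intro mult_right_mono) auto
    also have "\<dots> \<le> 1 * (of_nat (Suc n) ^ 2 * (r ^ m * r ^ Suc n))"
      by (intro mult_left_mono le) auto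
    also have "\<dots> = norm (G x)"
      unfolding G_def x prod.case norm_mult norm_of_real using r by (simp add: abs_mult)
    finally show "norm (case x of (m, n) \<Rightarrow> d m n * (of_nat (Suc n) ^ 2 * q ^ (Suc m * Suc n))) \<le> norm (G x)"
      unfolding x prod.case .
  qed
qed

lemma geometric_has_sum_Suc:
  fixes x :: complex
  assumes "norm x < 1"
  shows "((\<lambda>m. x ^ Suc m) has_sum (x / (1 - x))) UNIV"
proof -
  have "((\<lambda>m. x ^ m) has_sum (1 / (1 - x))) UNIV"
    using assms by (intro norm_summable_imp_has_sum geometric_sums) (simp_all add: norm_power)
  from has_sum_cmult_right[OF this, of x] show ?thesis by simp
qed

lemma lambert3_twisted:
  fixes c :: "nat \<Rightarrow> complex"
  assumes q: "norm q < 1" and c: "\<And>m. norm (c m) \<le> 1"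
  defines "S \<equiv> infsum (\<lambda>(m, n). c m * (of_nat (Suc n) ^ 2 * q ^ (Suc m * Suc n))) UNIV"
  shows "((\<lambda>(m, n). c m * (of_nat (Suc n) ^ 2 * q ^ (Suc m * Suc n))) has_sum S) UNIV"
    and "((\<lambda>m. c m * lambert3 (q ^ Suc m)) has_sum S) UNIV"
proof -
  show 1: "((\<lambda>(m, n). c m * (of_nat (Suc n) ^ 2 * q ^ (Suc m * Suc n))) has_sum S) UNIV"
    unfolding S_def using lambert_pairs_summable[OF q, of "\<lambda>m _. c m"] c by simp
  show "((\<lambda>m. c m * lambert3 (q ^ Suc m)) has_sum S) UNIV"
  proof (rule has_sum_SigmaD[where B = "\<lambda>_. UNIV"])
    show "((\<lambda>(m, n). c m * (of_nat (Suc n) ^ 2 * q ^ (Suc m * Suc n))) has_sum S) (UNIV \<times> UNIV)"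
      using 1 by simp
    show "((\<lambda>n. case (m, n) of (m, n) \<Rightarrow> c m * (of_nat (Suc n) ^ 2 * q ^ (Suc m * Suc n))) has_sum
        c m * lambert3 (q ^ Suc m)) UNIV" for m
      using has_sum_cmult_right[OF lambert3_series[OF norm_power_less_1[OF q, of "Suc m"]], of "c m"]
      unfolding prod.case power_mult by simp
  qed
qed

text \<open>The coefficient sits on n here. Summing over m first gives the Lambert series with n^2
  q^n/(1-q^n); summing over n first gives values of h, to which roots of unity can be
  applied.\<close>

lemma lambert_square_twisted:
  fixes c :: "nat \<Rightarrow> complex"
  assumes q: "norm q < 1" and c: "\<And>m. norm (c m) \<le> 1"
    and h: "\<And>x. norm x < 1 \<Longrightarrow> ((\<lambda>n. c n * (of_nat (Suc n) ^ 2 * x ^ Suc n)) has_sum h x) UNIV"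
  defines "S \<equiv> infsum (\<lambda>(m, n). c n * (of_nat (Suc n) ^ 2 * q ^ (Suc m * Suc n))) UNIV"
  shows "((\<lambda>n. c n * (of_nat (Suc n) ^ 2 * q ^ Suc n / (1 - q ^ Suc n))) has_sum S) UNIV"
    and "((\<lambda>m. h (q ^ Suc m)) has_sum S) UNIV"
proof -
  have 1: "((\<lambda>(m, n). c n * (of_nat (Suc n) ^ 2 * q ^ (Suc m * Suc n))) has_sum S) (UNIV \<times> UNIV)"
    unfolding S_def using lambert_pairs_summable[OF q, of "\<lambda>_ n. c n"] c by simp
  show "((\<lambda>m. h (q ^ Suc m)) has_sum S) UNIV"
  proof (rule has_sum_SigmaD[OF 1])
    show "((\<lambda>n. case (m, n) of (m, n) \<Rightarrow> c n * (of_nat (Suc n) ^ 2 * q ^ (Suc m * Suc n))) has_sum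
        h (q ^ Suc m)) UNIV" for m
      using h[OF norm_power_less_1[OF q, of "Suc m"]] unfolding prod.case power_mult by simp
  qed
  have 2: "((\<lambda>(n, m). c n * (of_nat (Suc n) ^ 2 * q ^ (Suc m * Suc n))) has_sum S) (UNIV \<times> UNIV)"
    using 1 by (subst (asm) has_sum_swap) (simp add: case_prod_unfold)
  show "((\<lambda>n. c n * (of_nat (Suc n) ^ 2 * q ^ Suc n / (1 - q ^ Suc n))) has_sum S) UNIV"
  proof (rule has_sum_SigmaD[OF 2])
    fix n
    have "q ^ (Suc m * Suc n) = (q ^ Suc n) ^ Suc m" for m
      by (subst power_mult[symmetric]) (simp only: mult.commute)
    then show "((\<lambda>m. case (n, m) of (n, m) \<Rightarrow> c n * (of_nat (Suc n) ^ 2 * q ^ (Suc m * Suc n))) has_sum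
        c n * (of_nat (Suc n) ^ 2 * q ^ Suc n / (1 - q ^ Suc n))) UNIV"
      using has_sum_cmult_right[OF geometric_has_sum_Suc[OF norm_power_less_1[OF q, of "Suc n"]], of "c n * of_nat (Suc n) ^ 2"]
      by (simp only: prod.case times_divide_eq_right mult.assoc zero_less_Suc)
  qed
qed

section \<open>Seventh roots of unity\<close>

locale seventh_root =
  fixes w :: complex
  assumes w7: "w ^ 7 = 1" and w1: "w \<noteq> 1"
begin

lemma w0: "w \<noteq> 0" using w7 by auto

lemma cyclotomic: "1 + w + w ^ 2 + w ^ 3 + w ^ 4 + w ^ 5 + w ^ 6 = 0"
proof -
  have "(w - 1) * (1 + w + w ^ 2 + w ^ 3 + w ^ 4 + w ^ 5 + w ^ 6) = w ^ 7 - 1"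
    by (simp add: algebra_simps power_numeral_reduce)
  then show ?thesis using w7 w1 by simp
qed

lemma power_mod_7: "w ^ n = w ^ (n mod 7)"
proof -
  have "w ^ n = w ^ (7 * (n div 7) + n mod 7)" by simp
  also have "\<dots> = w ^ (n mod 7)" unfolding power_add power_mult w7 by simp
  finally show ?thesis .
qed

lemma power_neq_1:
  assumes "\<not> 7 dvd n"
  shows "w ^ n \<noteq> 1"
proof
  assume 1: "w ^ n = 1"
  have n: "n \<noteq> 0" using assms by (metis dvd_0_right)
  have "coprime n 7"
    using assms prime_imp_coprime[of "7 :: nat" n] by (simp add: coprime_commute)
  then obtain x y where "n * x = 7 * y + 1"
    using bezout_nat[OF n, of 7] by auto
  then have "w ^ (n * x) = w ^ (7 * y + 1)" by simp
  then show False
    unfolding power_add power_mult 1 w7 using w1 by simp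
qed

text \<open>The quadratic Gauss sum modulo 7. Several of its properties are proved below by
  polynomial identities in w whose right side is an explicit multiple of the seventh cyclotomic
  polynomial.\<close>

definition gauss :: complex where
  "gauss = w + w ^ 2 + w ^ 4 - (w ^ 3 + w ^ 5 + w ^ 6)"

lemma gauss_square: "gauss ^ 2 = - 7"
proof -
  have "gauss ^ 2 + 7 = (1 + w + w ^ 2 + w ^ 3 + w ^ 4 + w ^ 5 + w ^ 6) *
      (7 - 7 * w + w ^ 2 + w ^ 3 - 3 * w ^ 4 + w ^ 5 + w ^ 6)"
    unfolding gauss_def by (simp add: algebra_simps power_numeral_reduce)
  then show ?thesis unfolding cyclotomic by (simp add: eq_neg_iff_add_eq_0)
qed

lemma gauss_nonzero: "gauss \<noteq> 0"
  using gauss_square by auto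

lemma gauss_prod: "(1 - w) * (1 - w ^ 2) * (1 - w ^ 4) = - gauss"
proof -
  have "(1 - w) * (1 - w ^ 2) * (1 - w ^ 4) + gauss = (1 + w + w ^ 2 + w ^ 3 + w ^ 4 + w ^ 5 + w ^ 6) * (1 - w)"
    unfolding gauss_def by (simp add: algebra_simps power_numeral_reduce)
  then show ?thesis unfolding cyclotomic by (simp add: eq_neg_iff_add_eq_0)
qed

text \<open>Separability of the Gauss sum: replacing w by w^m multiplies it by the symbol, also when
  7 divides m. The nonresidues are listed as 6, 5, 3 to pair them with their negatives 1, 2,
  4.\<close>

lemma Legendre_gauss:
  "w ^ m + (w ^ 2) ^ m + (w ^ 4) ^ m - ((w ^ 6) ^ m + (w ^ 5) ^ m + (w ^ 3) ^ m) = of_int (Legendre (int m) 7) * gauss"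
proof -
  have r: "m mod 7 \<in> {0, 1, 2, 3, 4, 5, 6}" by (simp; presburger)
  have L: "Legendre (int m) 7 = (if m mod 7 = 0 then 0 else if m mod 7 \<in> {1, 2, 4} then 1 else - 1)"
  proof -
    have "int m mod 7 = int k" if "m mod 7 = k" for k
      using that zmod_int[of m 7] by simp
    then show ?thesis using r by (elim insertE emptyE) (simp_all add: Legendre_7)
  qed
  have e: "(w ^ j) ^ m = w ^ (j * (m mod 7) mod 7)" for j
    by (subst power_mult[symmetric], subst power_mod_7) (simp add: mod_mult_right_eq)
  have "(w ^ 1) ^ m + (w ^ 2) ^ m + (w ^ 4) ^ m - ((w ^ 6) ^ m + (w ^ 5) ^ m + (w ^ 3) ^ m) = of_int (Legendre (int m) 7) * gauss"
    unfolding e L gauss_def using r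
    by (elim insertE emptyE) (simp_all add: algebra_simps power2_eq_square)
  then show ?thesis by simp
qed

lemma lambert3_gauss:
  assumes x: "norm x < 1" and "norm w = 1"
  shows "((\<lambda>n. of_int (Legendre (int (Suc n)) 7) * (of_nat (Suc n) ^ 2 * x ^ Suc n)) has_sum
     (lambert3 (w * x) + lambert3 (w ^ 2 * x) + lambert3 (w ^ 4 * x) -
      (lambert3 (w ^ 6 * x) + lambert3 (w ^ 5 * x) + lambert3 (w ^ 3 * x))) / gauss) UNIV"
proof -
  have S: "((\<lambda>n. of_nat (Suc n) ^ 2 * (w ^ j * x) ^ Suc n) has_sum lambert3 (w ^ j * x)) UNIV" for j
    using assms by (intro lambert3_series) (simp add: norm_mult norm_power)
  have "((\<lambda>n. ((of_nat (Suc n) ^ 2 * (w ^ 1 * x) ^ Suc n + of_nat (Suc n) ^ 2 * (w ^ 2 * x) ^ Suc n + of_nat (Suc n) ^ 2 * (w ^ 4 * x) ^ Suc n)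
     + - (of_nat (Suc n) ^ 2 * (w ^ 6 * x) ^ Suc n + of_nat (Suc n) ^ 2 * (w ^ 5 * x) ^ Suc n + of_nat (Suc n) ^ 2 * (w ^ 3 * x) ^ Suc n)) / gauss) has_sum
     ((lambert3 (w ^ 1 * x) + lambert3 (w ^ 2 * x) + lambert3 (w ^ 4 * x) +
      - (lambert3 (w ^ 6 * x) + lambert3 (w ^ 5 * x) + lambert3 (w ^ 3 * x))) / gauss)) UNIV"
    by (intro has_sum_divide_const has_sum_add has_sum_uminusI S)
  moreover have "((of_nat (Suc n) ^ 2 * (w ^ 1 * x) ^ Suc n + of_nat (Suc n) ^ 2 * (w ^ 2 * x) ^ Suc n + of_nat (Suc n) ^ 2 * (w ^ 4 * x) ^ Suc n)
     + - (of_nat (Suc n) ^ 2 * (w ^ 6 * x) ^ Suc n + of_nat (Suc n) ^ 2 * (w ^ 5 * x) ^ Suc n + of_nat (Suc n) ^ 2 * (w ^ 3 * x) ^ Suc n)) / gauss =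
     of_int (Legendre (int (Suc n)) 7) * (of_nat (Suc n) ^ 2 * x ^ Suc n)" for n
  proof -
    have a: "a * (u1 * X) + a * (u2 * X) + a * (u4 * X) + - (a * (u6 * X) + a * (u5 * X) + a * (u3 * X)) =
       a * X * (u1 + u2 + u4 - (u6 + u5 + u3))" for a u1 u2 u3 u4 u5 u6 X :: complex
      by (simp add: algebra_simps)
    show ?thesis
      unfolding power_mult_distrib a power_one_right Legendre_gauss using gauss_nonzero
      by (simp only: times_divide_eq_right[symmetric] nonzero_mult_div_cancel_right mult_ac) simp
  qed
  ultimately show ?thesis by (simp only: power_one_right add_uminus_conv_diff)
qed

text \<open>Over the common denominator (-g)^3, with g the Gauss sum, the numerator is 56 modulo the
  cyclotomic polynomial; the long factor is the quotient of that division. Finally (-g)^3 = 7 g and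
  8/g = -8 g/7.\<close>

lemma lambert3_root_sum: "lambert3 w + lambert3 (w ^ 2) + lambert3 (w ^ 4) = - (8 / 7) * gauss"
proof -
  have nz: "1 - w \<noteq> 0" "1 - w ^ 2 \<noteq> 0" "1 - w ^ 4 \<noteq> 0"
    using w1 power_neq_1[of 2] power_neq_1[of 4] by auto
  have "w * (1 + w) * ((1 - w ^ 2) ^ 3 * (1 - w ^ 4) ^ 3) + w ^ 2 * (1 + w ^ 2) * ((1 - w) ^ 3 * (1 - w ^ 4) ^ 3) +
     w ^ 4 * (1 + w ^ 4) * ((1 - w) ^ 3 * (1 - w ^ 2) ^ 3) - 56 =
     (1 + w + w ^ 2 + w ^ 3 + w ^ 4 + w ^ 5 + w ^ 6) *
     (- 56 + 57 * w + w ^ 2 - 8 * w ^ 3 + 8 * w ^ 4 - 9 * w ^ 5 + 7 * w ^ 6 - 32 * w ^ 7 + 24 * w ^ 8 +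
      7 * w ^ 9 - 9 * w ^ 10 + 8 * w ^ 11 - 8 * w ^ 12 + w ^ 13 + w ^ 14)"
    by (simp add: algebra_simps power_numeral_reduce)
  then have N: "w * (1 + w) * ((1 - w ^ 2) ^ 3 * (1 - w ^ 4) ^ 3) + w ^ 2 * (1 + w ^ 2) * ((1 - w) ^ 3 * (1 - w ^ 4) ^ 3) +
     w ^ 4 * (1 + w ^ 4) * ((1 - w) ^ 3 * (1 - w ^ 2) ^ 3) = 56"
    unfolding cyclotomic by simp
  have "a / A ^ 3 + b / B ^ 3 + c / C ^ 3 = (a * (B ^ 3 * C ^ 3) + b * (A ^ 3 * C ^ 3) + c * (A ^ 3 * B ^ 3)) / (A * B * C) ^ 3"
    if "A \<noteq> 0" "B \<noteq> 0" "C \<noteq> 0" for a b c A B C :: complex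
    using that by (simp add: add_divide_distrib power_mult_distrib)
  from this[OF nz, of "w * (1 + w)" "w ^ 2 * (1 + w ^ 2)" "w ^ 4 * (1 + w ^ 4)"]
  have "lambert3 w + lambert3 (w ^ 2) + lambert3 (w ^ 4) = 56 / (- gauss) ^ 3"
    unfolding lambert3_def N gauss_prod .
  also have "(- gauss) ^ 3 = - (gauss ^ 2 * gauss)"
    by (simp add: power_numeral_reduce)
  also have "\<dots> = 7 * gauss"
    unfolding gauss_square by simp
  also have "56 / (7 * gauss) = - (8 / 7) * gauss"
  proof -
    have "56 / (7 * gauss) = 8 * gauss / gauss ^ 2" using gauss_nonzero by (simp add: power2_eq_square)
    then show ?thesis by (simp add: gauss_square)
  qed
  finally show ?thesis .
qed

lemma sum_roots:
  "(\<Sum>j<7. (w ^ j) ^ n) = (if 7 dvd n then 7 else 0)"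
proof (cases "7 dvd n")
  case True
  then obtain k where k: "n = 7 * k" by blast
  have "(w ^ j) ^ n = (w ^ 7) ^ (j * k)" for j
    unfolding k by (simp only: power_mult[symmetric] mult_ac)
  then have "(w ^ j) ^ n = 1" for j
    using w7 by simp
  then show ?thesis using True by simp
next
  case False
  have "(\<Sum>j<7. (w ^ j) ^ n) = (\<Sum>j<7. (w ^ n) ^ j)"
    by (simp add: power_mult[symmetric] mult.commute)
  also have "\<dots> = ((w ^ n) ^ 7 - 1) / (w ^ n - 1)"
    using power_neq_1[OF False] by (simp add: geometric_sum)
  also have "(w ^ n) ^ 7 = (w ^ 7) ^ n" by (simp only: power_mult[symmetric] mult.commute)
  also have "\<dots> = 1" using w7 by simp
  finally show ?thesis using False by simp
qed

text \<open>The exponents 1, 2, 4 and 3, 5, 6 give two cubic factors with coefficients in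
  \<open>a\<close>, a root of a^2 + a + 2: the factorization of (1-x^7)/(1-x) over the field of the
  square root of -7.\<close>

lemma prod_roots: "(\<Prod>j<7. 1 - w ^ j * x) = 1 - x ^ 7"
proof -
  define a where "a = w + w ^ 2 + w ^ 4"
  have b: "w ^ 3 + w ^ 5 + w ^ 6 = - 1 - a"
    using cyclotomic by (simp add: a_def algebra_simps eq_neg_iff_add_eq_0)
  have "gauss = 2 * a + 1" unfolding gauss_def b by (simp add: a_def)
  then have "4 * (a ^ 2 + a + 2) = gauss ^ 2 + 7" by (simp add: algebra_simps power2_eq_square)
  then have "4 * (a ^ 2 + a + 2) = 0" unfolding gauss_square by simp
  then have a2: "a ^ 2 + a + 2 = 0" by (simp only: mult_eq_0_iff) simp
  have w8: "w ^ 8 = w" "w ^ 9 = w ^ 2" "w ^ 11 = w ^ 4" "w ^ 14 = 1"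
    using power_mod_7[of 8] power_mod_7[of 9] power_mod_7[of 11] power_mod_7[of 14] by simp_all
  have "(1 - w * x) * (1 - w ^ 2 * x) * (1 - w ^ 4 * x) =
      1 - (w + w ^ 2 + w ^ 4) * x + (w ^ 3 + w ^ 5 + w ^ 6) * x ^ 2 - w ^ 7 * x ^ 3"
    by (simp add: algebra_simps power_numeral_reduce)
  then have P1: "(1 - w * x) * (1 - w ^ 2 * x) * (1 - w ^ 4 * x) = 1 - a * x + (- 1 - a) * x ^ 2 - x ^ 3"
    unfolding b w7 a_def[symmetric] by simp
  have "(1 - w ^ 3 * x) * (1 - w ^ 5 * x) * (1 - w ^ 6 * x) =
      1 - (w ^ 3 + w ^ 5 + w ^ 6) * x + (w ^ 8 + w ^ 9 + w ^ 11) * x ^ 2 - w ^ 14 * x ^ 3"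
    by (simp add: algebra_simps power_numeral_reduce)
  then have P2: "(1 - w ^ 3 * x) * (1 - w ^ 5 * x) * (1 - w ^ 6 * x) = 1 - (- 1 - a) * x + a * x ^ 2 - x ^ 3"
    unfolding b w8 a_def[symmetric] by simp
  have "(\<Prod>j<7. 1 - w ^ j * x) = (1 - x) * (((1 - w * x) * (1 - w ^ 2 * x) * (1 - w ^ 4 * x)) *
      ((1 - w ^ 3 * x) * (1 - w ^ 5 * x) * (1 - w ^ 6 * x)))"
    by (simp add: lessThan_nat_numeral lessThan_Suc mult_ac)
  also have "\<dots> = (1 - x) * ((1 + x + x ^ 2 + x ^ 3 + x ^ 4 + x ^ 5 + x ^ 6) - (a ^ 2 + a + 2) * (x ^ 2 + 2 * x ^ 3 + x ^ 4))"
    unfolding P1 P2 by (simp add: algebra_simps power_numeral_reduce)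
  also have "\<dots> = 1 - x ^ 7"
    unfolding a2 by (simp add: algebra_simps power_numeral_reduce)
  finally show ?thesis .
qed

lemma qpoch_inf_prod_roots:
  assumes q: "norm q < 1"
  shows "(\<Prod>j<7. qpoch_inf (w ^ j * z) q) = qpoch_inf (z ^ 7) (q ^ 7)"
proof (rule qpoch_inf_eqI[OF norm_power_less_1[OF q], symmetric])
  have "(\<Prod>i<7. \<Prod>j<N. 1 - w ^ i * z * q ^ j) = (\<Prod>j<N. 1 - z ^ 7 * (q ^ 7) ^ j)" for N
    using prod_roots
    by (subst prod.swap) (simp add: mult.assoc power_mult_distrib power_mult[symmetric] mult.commute[of 7])
  then show "(\<lambda>N. \<Prod>j<N. 1 - z ^ 7 * (q ^ 7) ^ j) \<longlonglongrightarrow> (\<Prod>j<7. qpoch_inf (w ^ j * z) q)"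
    using tendsto_prod[of "{..<7::nat}" "\<lambda>i N. \<Prod>j<N. 1 - w ^ i * z * q ^ j" "\<lambda>i. qpoch_inf (w ^ i * z) q"]
      qpoch_inf_LIMSEQ[OF q] by simp
qed simp

end

section \<open>The two Lambert series of level seven\<close>

abbreviation (input) theta_quot :: "complex \<Rightarrow> complex \<Rightarrow> complex" where
  "theta_quot q z \<equiv> z * theta q (z ^ 2) / theta q z ^ 4"

lemma theta_quotient_weier:
  assumes "weier p u \<noteq> 0"
  shows "exp u * theta p (exp u ^ 2) / theta p (exp u) ^ 4 = weier p (2 * u) / weier p u ^ 4"
proof -
  have "exp (u / 2) ^ 2 = exp u" using exp_double[of "u / 2"] by simp
  then have "exp (u / 2) ^ 4 = exp u * exp u" by (simp add: power_numeral_reduce)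
  then show ?thesis
    using theta_exp[of p "2 * u"] theta_exp[of p u] assms
    by (simp add: exp_double power_mult_distrib power2_eq_square)
qed

definition v7 :: complex where "v7 = 2 * of_real pi * \<i> / 7"

definition zeta7 :: complex where "zeta7 = exp v7"

abbreviation (input) septic_zeta7 :: "complex \<Rightarrow> int \<Rightarrow> complex" where
  "septic_zeta7 q \<equiv> septic q 0 v7"

text \<open>\<open>Ln q / 14\<close> is forced: (n+7)^2 - n^2 = 14 n + 49, so the Gaussian gains
  exp((n + 7/2) Ln q), which cancels the multiplier of the sigma function under the period 7 Ln q.
  For the real period 7 \<open>v7\<close> the multiplier is just -1, hence the parameter 0
  there.\<close>

abbreviation (input) septic_Ln :: "complex \<Rightarrow> int \<Rightarrow> complex" where
  "septic_Ln q \<equiv> septic (q ^ 7) (Ln q / 14) (Ln q)"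

lemma exp_v7: "exp (7 * v7) = 1" "exp (- (7 * v7) / 2) = - 1"
  by (simp_all add: v7_def exp_minus mult_ac exp_pi_i exp_pi_i' exp_two_pi_i exp_two_pi_i')

lemma norm_zeta7 [simp]: "norm zeta7 = 1"
  by (simp add: zeta7_def v7_def)

interpretation z7: seventh_root zeta7
proof
  show "zeta7 ^ 7 = 1"
    using exp_of_nat_mult[of 7 v7] exp_v7(1) by (simp add: zeta7_def)
  show "zeta7 \<noteq> 1"
  proof
    assume "zeta7 = 1"
    then obtain n :: int where "2 * pi / 7 = of_int (2 * n) * pi"
      by (auto simp: zeta7_def v7_def exp_eq_1)
    then have "1 = 7 * real_of_int n" by simp
    then have "1 = 7 * n" by linarith
    then show False by presburger
  qed
qed

lemma unit_root_theta_nonzero: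
  assumes q: "norm q < 1" and n: "\<not> 7 dvd n"
  shows "zeta7 ^ n * q ^ j \<noteq> 1" "q ^ Suc j \<noteq> zeta7 ^ n" "theta q (zeta7 ^ n) \<noteq> 0"
proof -
  show 1: "zeta7 ^ n * q ^ j \<noteq> 1" for j
  proof (cases j)
    case 0
    then show ?thesis using z7.power_neq_1[OF n] by simp
  next
    case (Suc i)
    then have "norm (zeta7 ^ n * q ^ j) < 1"
      using norm_power_less_1[OF q, of j] by (simp add: norm_mult norm_power)
    then show ?thesis by auto
  qed
  show 2: "q ^ Suc j \<noteq> zeta7 ^ n" for j
    using norm_power_less_1[OF q, of "Suc j"] by (metis less_irrefl norm_power norm_zeta7 power_one zero_less_Suc)
  show "theta q (zeta7 ^ n) \<noteq> 0"
    using z7.w0 by (intro theta_nonzero q 1 2) auto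
qed

lemma weier_zeta7: "weier q (of_nat n * v7) = exp (- (of_nat n * v7) / 2) * theta q (zeta7 ^ n)"
  by (simp add: weier_def zeta7_def exp_of_nat_mult)

definition septic_T :: "complex \<Rightarrow> complex \<Rightarrow> complex \<Rightarrow> complex" where
  "septic_T p k v = - (septic p k v 2 ^ 2 * septic p k v 4 / septic p k v 1 ^ 3 +
   septic p k v 4 ^ 2 * septic p k v 1 / septic p k v 2 ^ 3 + septic p k v 1 ^ 2 * septic p k v 2 / septic p k v 4 ^ 3)"

context
  fixes q :: complex
  assumes q: "norm q < 1" "q \<noteq> 0"
begin

lemma weier_zeta7_nonzero: "\<not> 7 dvd n \<Longrightarrow> weier q (of_nat n * v7) \<noteq> 0"
  unfolding weier_zeta7 using unit_root_theta_nonzero(3)[OF q(1)] by simp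

lemma weier_periodic: "weier q (u + 7 * v7) = - weier q u"
proof -
  have "exp (- (u + 7 * v7) / 2) = exp (- u / 2 + - (7 * v7) / 2)"
    by (rule arg_cong[of _ _ exp]) (simp add: field_simps)
  then have "exp (- (u + 7 * v7) / 2) = - exp (- u / 2)"
    unfolding exp_add exp_v7 by simp
  moreover have "exp (u + 7 * v7) = exp u"
    unfolding exp_add exp_v7 by simp
  ultimately show ?thesis by (simp only: weier_def) simp
qed

lemma septic_zeta7_periodic: "septic_zeta7 q (n + 7) = septic_zeta7 q n"
proof -
  have "of_int (n + 7) * v7 = of_int n * v7 + 7 * v7" by (simp add: distrib_right)
  moreover have "(- 1 :: complex) powi (n + 7) = - ((- 1) powi n)"
    by (simp add: power_int_add)
  ultimately show ?thesis
    by (simp only: septic_def weier_periodic) simp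
qed

lemma septic_zeta7_nonzero:
  "septic_zeta7 q 1 \<noteq> 0" "septic_zeta7 q 2 \<noteq> 0" "septic_zeta7 q 4 \<noteq> 0"
  using weier_zeta7_nonzero[of 1] weier_zeta7_nonzero[of 2] weier_zeta7_nonzero[of 4]
  by (simp_all add: septic_eq_0_iff)

text \<open>Pairing each root with its inverse, the theta values contribute all (\<zeta>^j q; q)
  with j = 1,...,6, which together with E make up E_7. The half exponentials combine to exp(-7 v7 /
  2) = -1.\<close>

lemma septic_zeta7_prod:
  "septic_zeta7 q 1 * septic_zeta7 q 2 * septic_zeta7 q 4 =
   - z7.gauss * euler q ^ 2 * euler (q ^ 7)"
proof -
  define E where "E = euler q"
  define Q where "Q = (\<lambda>j. qpoch_inf (zeta7 ^ j * q) q)"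
  have "septic_zeta7 q 1 * septic_zeta7 q 2 * septic_zeta7 q 4 =
      - (weier q (of_nat 1 * v7) * weier q (of_nat 2 * v7) * weier q (of_nat 4 * v7))"
    by (simp add: septic_def)
  also have "\<dots> = - (exp (- (of_nat 1 * v7) / 2) * exp (- (of_nat 2 * v7) / 2) * exp (- (of_nat 4 * v7) / 2)) *
      (theta q (zeta7 ^ 1) * theta q (zeta7 ^ 2) * theta q (zeta7 ^ 4))"
    unfolding weier_zeta7 by simp
  also have "exp (- (of_nat 1 * v7) / 2) * exp (- (of_nat 2 * v7) / 2) * exp (- (of_nat 4 * v7) / 2) = exp (- (7 * v7) / 2)"
    unfolding exp_add[symmetric] by (rule arg_cong[of _ _ exp]) (simp add: field_simps)
  also have "- exp (- (7 * v7) / 2) = 1" unfolding exp_v7 by simp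
  finally have s: "septic_zeta7 q 1 * septic_zeta7 q 2 * septic_zeta7 q 4 =
      theta q (zeta7 ^ 1) * theta q (zeta7 ^ 2) * theta q (zeta7 ^ 4)" by simp
  have th: "theta q (zeta7 ^ 1) = (1 - zeta7) * (E * Q 1 * Q 6)"
    "theta q (zeta7 ^ 2) = (1 - zeta7 ^ 2) * (E * Q 2 * Q 5)"
    "theta q (zeta7 ^ 4) = (1 - zeta7 ^ 4) * (E * Q 4 * Q 3)"
  proof -
    have inv: "q / zeta7 ^ i = zeta7 ^ j * q" if "i + j = 7" for i j
    proof -
      have "zeta7 ^ i * zeta7 ^ j = 1" using that z7.w7 by (simp add: power_add[symmetric])
      then show ?thesis using z7.w0 by (simp add: divide_simps mult_ac)
    qed
    show "theta q (zeta7 ^ 1) = (1 - zeta7) * (E * Q 1 * Q 6)"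
      and "theta q (zeta7 ^ 2) = (1 - zeta7 ^ 2) * (E * Q 2 * Q 5)"
      and "theta q (zeta7 ^ 4) = (1 - zeta7 ^ 4) * (E * Q 4 * Q 3)"
      using theta_factor[OF q(1), of "zeta7 ^ 1"] theta_factor[OF q(1), of "zeta7 ^ 2"] theta_factor[OF q(1), of "zeta7 ^ 4"]
        inv[of 1 6] inv[of 2 5] inv[of 4 3] z7.w0 by (simp_all add: E_def Q_def)
  qed
  have "septic_zeta7 q 1 * septic_zeta7 q 2 * septic_zeta7 q 4 = ((1 - zeta7) * (1 - zeta7 ^ 2) * (1 - zeta7 ^ 4)) * E ^ 3 * (Q 1 * Q 2 * Q 3 * Q 4 * Q 5 * Q 6)"
    unfolding s th by (simp add: power3_eq_cube mult_ac)
  moreover have "E * (Q 1 * Q 2 * Q 3 * Q 4 * Q 5 * Q 6) = euler (q ^ 7)"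
    using z7.qpoch_inf_prod_roots[OF q(1), of q]
    by (simp add: E_def Q_def lessThan_nat_numeral lessThan_Suc mult_ac)
  then have "E ^ 3 * (Q 1 * Q 2 * Q 3 * Q 4 * Q 5 * Q 6) = E ^ 2 * euler (q ^ 7)"
    by (simp add: power_numeral_reduce mult.assoc)
  ultimately show ?thesis
    unfolding z7.gauss_prod by (simp only: E_def mult.assoc)
qed

text \<open>The discriminant comparison gives T - 8 = q (xyz)^4 / E^12, and the product xyz is
  known; 49 is the fourth power of the Gauss sum.\<close>

lemma septic_T_zeta7:
  "septic_T q 0 v7 = 8 + 49 * q * euler (q ^ 7) ^ 4 / euler q ^ 4"
proof -
  define E where "E = euler q"
  define E7 where "E7 = euler (q ^ 7)"
  have E0: "E \<noteq> 0" using qpoch_inf_self_nonzero[OF q(1)] by (simp add: E_def)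
  have "septic_T q 0 v7 - 8 = q * (septic_zeta7 q 1 * septic_zeta7 q 2 * septic_zeta7 q 4) ^ 4 / E ^ 12"
    unfolding E_def septic_T_def
    using septic_relations(2)[OF q septic_zeta7_periodic septic_zeta7_nonzero refl refl refl] by simp
  also have "(septic_zeta7 q 1 * septic_zeta7 q 2 * septic_zeta7 q 4) ^ 4 = (z7.gauss ^ 2) ^ 2 * E ^ 8 * E7 ^ 4"
    unfolding septic_zeta7_prod E_def[symmetric] E7_def[symmetric]
    by (simp add: power_mult_distrib power_mult[symmetric])
  also have "q * ((z7.gauss ^ 2) ^ 2 * E ^ 8 * E7 ^ 4) / E ^ 12 = 49 * q * E7 ^ 4 / E ^ 4"
    unfolding z7.gauss_square using E0 by (simp add: divide_simps power_add[symmetric] mult_ac)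
  finally show ?thesis by (simp add: E_def E7_def algebra_simps)
qed

lemma septic_zeta7_quotients:
  "theta_quot q (zeta7 ^ 1) +
   theta_quot q (zeta7 ^ 2) +
   theta_quot q (zeta7 ^ 4) =
   septic_T q 0 v7 / (z7.gauss * euler q ^ 2 * euler (q ^ 7))"
proof -
  have z: "exp (of_int (int n) * v7) = zeta7 ^ n" for n
    by (simp add: zeta7_def exp_of_nat_mult)
  have "theta_quot q (zeta7 ^ n) =
      septic_zeta7 q (2 * int n) / septic_zeta7 q (int n) ^ 4" if "\<not> 7 dvd n" for n
    using theta_quotient_weier[of q "of_int (int n) * v7"] weier_zeta7_nonzero[OF that]
    unfolding septic_double z by simp
  from this[of 1] this[of 2] this[of 4] septic_zeta7_periodic[of 1]
  have "theta_quot q (zeta7 ^ 1) +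
   theta_quot q (zeta7 ^ 2) +
   theta_quot q (zeta7 ^ 4) =
   septic_zeta7 q 2 / septic_zeta7 q 1 ^ 4 + septic_zeta7 q 4 / septic_zeta7 q 2 ^ 4 + septic_zeta7 q 1 / septic_zeta7 q 4 ^ 4"
    by simp
  moreover have "R / (- a * b * c) = - R / (a * b * c)" for R a b c :: complex by simp
  ultimately show ?thesis
    unfolding septic_sum[OF septic_zeta7_nonzero] septic_zeta7_prod septic_T_def by (simp only:)
qed

text \<open>Adding \<open>lambert3_sums'\<close> at \<zeta>, \<zeta>^2, \<zeta>^4 puts the residue
  roots and the nonresidue roots on opposite sides, so each summand is -g h(q^(n+1)), with g the
  Gauss sum. The theta quotients add up to a multiple of T.\<close>

lemma lambert_square_Legendre:
  obtains S where
    "((\<lambda>n. of_int (Legendre (int (Suc n)) 7) * (of_nat (Suc n) ^ 2 * q ^ Suc n / (1 - q ^ Suc n))) has_sum S) UNIV"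
    "7 * S = 8 - 8 * (euler q ^ 7 / euler (q ^ 7)) -
       49 * q * euler q ^ 3 * euler (q ^ 7) ^ 3"
proof -
  define E where "E = euler q"
  define E7 where "E7 = euler (q ^ 7)"
  define T where "T = septic_T q 0 v7"
  define g where "g = z7.gauss"
  have E0: "E \<noteq> 0" "E7 \<noteq> 0" "g \<noteq> 0"
    using qpoch_inf_self_nonzero[OF q(1)] qpoch_inf_self_nonzero[OF norm_power_less_1[OF q(1), of 7]] z7.gauss_nonzero
    by (simp_all add: E_def E7_def g_def)
  define h where "h = (\<lambda>x. (lambert3 (zeta7 * x) + lambert3 (zeta7 ^ 2 * x) + lambert3 (zeta7 ^ 4 * x) -
      (lambert3 (zeta7 ^ 6 * x) + lambert3 (zeta7 ^ 5 * x) + lambert3 (zeta7 ^ 3 * x))) / g)"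
  have h: "((\<lambda>n. of_int (Legendre (int (Suc n)) 7) * (of_nat (Suc n) ^ 2 * x ^ Suc n)) has_sum h x) UNIV"
    if "norm x < 1" for x
    unfolding h_def g_def by (rule z7.lambert3_gauss[OF that norm_zeta7])
  define S where "S = infsum (\<lambda>(m, n). of_int (Legendre (int (Suc n)) 7) * (of_nat (Suc n) ^ 2 * q ^ (Suc m * Suc n))) UNIV"
  note tw = lambert_square_twisted[OF q(1) norm_Legendre_7 h, folded S_def]
  have inv: "x / zeta7 ^ i = zeta7 ^ j * x" if "i + j = 7" for i j x
  proof -
    have "zeta7 ^ i * zeta7 ^ j = 1" using that z7.w7 by (simp add: power_add[symmetric])
    then show ?thesis using z7.w0 by (simp add: divide_simps mult_ac)
  qed
  have L: "(\<lambda>n. lambert3 (zeta7 ^ j * q ^ Suc n) - lambert3 (zeta7 ^ i * q ^ Suc n)) sums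
      (lambert3 (zeta7 ^ i) - E ^ 9 * (theta_quot q (zeta7 ^ i)))"
    if "i + j = 7" "\<not> 7 dvd i" for i j
    using lambert3_sums'[OF q, of "zeta7 ^ i"] z7.w0 unit_root_theta_nonzero(1,2)[OF q(1) that(2)]
    unfolding inv[OF that(1)] E_def by (simp add: mult.assoc del: power_Suc)
  have "(\<lambda>n. (lambert3 (zeta7 ^ 6 * q ^ Suc n) - lambert3 (zeta7 ^ 1 * q ^ Suc n)) +
     (lambert3 (zeta7 ^ 5 * q ^ Suc n) - lambert3 (zeta7 ^ 2 * q ^ Suc n)) +
     (lambert3 (zeta7 ^ 3 * q ^ Suc n) - lambert3 (zeta7 ^ 4 * q ^ Suc n))) sums
     ((lambert3 (zeta7 ^ 1) - E ^ 9 * (theta_quot q (zeta7 ^ 1))) +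
      (lambert3 (zeta7 ^ 2) - E ^ 9 * (theta_quot q (zeta7 ^ 2))) +
      (lambert3 (zeta7 ^ 4) - E ^ 9 * (theta_quot q (zeta7 ^ 4))))"
    by (intro sums_add L) auto
  also have "(\<lambda>n. (lambert3 (zeta7 ^ 6 * q ^ Suc n) - lambert3 (zeta7 ^ 1 * q ^ Suc n)) +
     (lambert3 (zeta7 ^ 5 * q ^ Suc n) - lambert3 (zeta7 ^ 2 * q ^ Suc n)) +
     (lambert3 (zeta7 ^ 3 * q ^ Suc n) - lambert3 (zeta7 ^ 4 * q ^ Suc n))) = (\<lambda>n. - g * h (q ^ Suc n))"
    by (rule ext) (use E0(3) in \<open>simp add: h_def\<close>)
  also have "(lambert3 (zeta7 ^ 1) - E ^ 9 * (theta_quot q (zeta7 ^ 1))) +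
      (lambert3 (zeta7 ^ 2) - E ^ 9 * (theta_quot q (zeta7 ^ 2))) +
      (lambert3 (zeta7 ^ 4) - E ^ 9 * (theta_quot q (zeta7 ^ 4))) =
      (lambert3 zeta7 + lambert3 (zeta7 ^ 2) + lambert3 (zeta7 ^ 4)) - E ^ 9 *
      (theta_quot q (zeta7 ^ 1) +
       theta_quot q (zeta7 ^ 2) +
       theta_quot q (zeta7 ^ 4))"
    unfolding power_one_right by (simp only: distrib_left) simp
  also have "\<dots> = - (8 / 7) * g - E ^ 9 * (T / (g * E ^ 2 * E7))"
    unfolding z7.lambert3_root_sum septic_zeta7_quotients T_def E_def E7_def g_def ..
  finally have "(\<lambda>n. - g * h (q ^ Suc n)) sums (- (8 / 7) * g - E ^ 9 * (T / (g * E ^ 2 * E7)))" .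
  moreover have "(\<lambda>n. - g * h (q ^ Suc n)) sums (- g * S)"
    by (intro sums_mult has_sum_imp_sums tw(2))
  ultimately have "- g * S = - (8 / 7) * g - E ^ 9 * (T / (g * E ^ 2 * E7))"
    by (rule sums_unique2[rotated])
  moreover have "E ^ 9 * (T / (g * E ^ 2 * E7)) = g * (E ^ 7 * T / (g ^ 2 * E7))"
    using E0 by (simp add: divide_simps power_numeral_reduce)
  moreover have "g ^ 2 = - 7" by (simp add: g_def z7.gauss_square)
  ultimately have "g * S = g * (8 / 7 - E ^ 7 * T / (7 * E7))"
    by (simp add: algebra_simps)
  then have "S = 8 / 7 - E ^ 7 * T / (7 * E7)"
    using E0(3) by simp
  then have "7 * S = 8 - E ^ 7 / E7 * T" by (simp add: field_simps)
  also have "E ^ 7 / E7 * T = 8 * (E ^ 7 / E7) + 49 * q * E ^ 3 * E7 ^ 3"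
    unfolding T_def septic_T_zeta7 E_def[symmetric] E7_def[symmetric] using E0
    by (simp add: divide_simps power_numeral_reduce) (simp add: algebra_simps)
  finally show ?thesis
    using that[OF tw(1)] by (simp add: E_def E7_def algebra_simps)
qed

end

lemma weier_shift:
  assumes "norm p < 1" "p \<noteq> 0" "exp c = p"
  shows "weier p (u + c) = - exp (- c / 2 - u) * weier p u"
proof -
  have "weier p (u + c) = exp (- (u + c) / 2) * theta p (p * exp u)"
    by (simp add: weier_def exp_add assms(3) mult.commute)
  also have "\<dots> = - (exp (- (u + c) / 2) / exp u) * theta p (exp u)"
    by (subst theta_shift) (use assms in auto)
  also have "exp (- (u + c) / 2) / exp u = exp (- c / 2 - u) * exp (- u / 2)"
    unfolding exp_add[symmetric] exp_diff[symmetric] by (rule arg_cong[of _ _ exp]) (simp add: field_simps)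
  finally show ?thesis by (simp add: weier_def)
qed

context
  fixes q :: complex
  assumes q: "norm q < 1" "q \<noteq> 0"
begin

lemma exp_Ln_multiple: "exp (of_int (int n) * Ln q) = q ^ n" "exp (7 * Ln q) = q ^ 7"
  using exp_of_nat_mult[of n "Ln q"] exp_of_nat_mult[of 7 "Ln q"] q(2) by simp_all

lemma septic_Ln_periodic: "septic_Ln q (n + 7) = septic_Ln q n"
proof -
  define u where "u = of_int n * Ln q"
  have w: "weier (q ^ 7) (of_int (n + 7) * Ln q) = - exp (- (7 * Ln q) / 2 - u) * weier (q ^ 7) u"
    using weier_shift[of "q ^ 7" "7 * Ln q" u] q norm_power_less_1[OF q(1), of 7] exp_Ln_multiple(2)
    by (simp add: u_def distrib_right)
  have s: "(- 1 :: complex) powi (n + 7) = - ((- 1) powi n)"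
    by (simp add: power_int_add)
  have e: "exp (Ln q / 14 * of_int ((n + 7) ^ 2)) * exp (- (7 * Ln q) / 2 - u) = exp (Ln q / 14 * of_int (n ^ 2))"
    unfolding exp_add[symmetric] by (rule arg_cong[of _ _ exp]) (simp add: u_def field_simps power2_eq_square)
  have "septic_Ln q (n + 7) =
      (- 1) powi n * (exp (Ln q / 14 * of_int ((n + 7) ^ 2)) * exp (- (7 * Ln q) / 2 - u)) * weier (q ^ 7) u"
    unfolding septic_def w s by simp
  then show ?thesis unfolding e by (simp only: septic_def u_def)
qed

lemma power_theta_nonzero:
  assumes n: "0 < n" "n < 7"
  shows "q ^ n * (q ^ 7) ^ j \<noteq> 1" "(q ^ 7) ^ Suc j \<noteq> q ^ n" "theta (q ^ 7) (q ^ n) \<noteq> 0"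
proof -
  show 1: "q ^ n * (q ^ 7) ^ j \<noteq> 1" for j
    using power_eq_1_norm_less[OF q(1), of "n + 7 * j"] n by (simp add: power_add power_mult)
  show 2: "(q ^ 7) ^ Suc j \<noteq> q ^ n" for j
  proof
    assume "(q ^ 7) ^ Suc j = q ^ n"
    moreover have "7 * Suc j - n + n = 7 * Suc j" using n by simp
    ultimately have "q ^ (7 * Suc j - n + n) = q ^ n" by (simp only: power_mult)
    then have "q ^ (7 * Suc j - n) = 1" unfolding power_add using q(2) by simp
    then show False using power_eq_1_norm_less[OF q(1), of "7 * Suc j - n"] n by simp
  qed
  show "theta (q ^ 7) (q ^ n) \<noteq> 0"
    using q by (intro theta_nonzero norm_power_less_1 1 2) auto
qed

lemma weier_Ln: "weier (q ^ 7) (of_int (int n) * Ln q) = exp (- (of_nat n * Ln q) / 2) * theta (q ^ 7) (q ^ n)"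
  unfolding weier_def exp_Ln_multiple by simp

lemma septic_Ln_nonzero:
  "septic_Ln q 1 \<noteq> 0" "septic_Ln q 2 \<noteq> 0"
  "septic_Ln q 4 \<noteq> 0"
  using weier_Ln[of 1] weier_Ln[of 2] weier_Ln[of 4]
    power_theta_nonzero(3)[of 1] power_theta_nonzero(3)[of 2] power_theta_nonzero(3)[of 4]
  by (simp_all add: septic_eq_0_iff)

text \<open>The arguments q, q^2, q^4 and their complements to q^7 cover all nonzero residues modulo
  7, giving E E_7^2. The power q^(-2) is the sum of n^2/14 - n/2 over n = 1, 2, 4.\<close>

lemma septic_Ln_prod:
  "septic_Ln q 1 * septic_Ln q 2 * septic_Ln q 4 =
   - (euler q * euler (q ^ 7) ^ 2 / q ^ 2)"
proof -
  define E7 where "E7 = euler (q ^ 7)"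
  define Q where "Q = (\<lambda>j. qpoch_inf (q ^ j) (q ^ 7))"
  let ?e = "\<lambda>n. exp (Ln q / 14 * of_int (int n ^ 2)) * exp (- (of_nat n * Ln q) / 2)"
  have s: "septic_Ln q (int n) = (- 1) ^ n * ?e n * theta (q ^ 7) (q ^ n)" for n
    unfolding septic_def weier_Ln by simp
  have e: "?e 1 * ?e 2 * ?e 4 = 1 / q ^ 2"
  proof -
    have "?e 1 * ?e 2 * ?e 4 = exp (- (of_nat 2 * Ln q))"
      unfolding exp_add[symmetric] by (rule arg_cong[of _ _ exp]) (simp add: field_simps)
    also have "\<dots> = 1 / q ^ 2"
      unfolding exp_minus exp_of_nat_mult using q(2) by (simp add: inverse_eq_divide)
    finally show ?thesis .
  qed
  have d: "q ^ 7 / q ^ i = q ^ j" if "i + j = 7" for i j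
  proof -
    have "q ^ 7 = q ^ i * q ^ j" unfolding power_add[symmetric] that ..
    then show ?thesis using q(2) by simp
  qed
  have th: "theta (q ^ 7) (q ^ i) = E7 * Q i * Q j" if "i + j = 7" for i j
    unfolding theta_def d[OF that] by (simp add: E7_def Q_def)
  have "septic_Ln q 1 * septic_Ln q 2 * septic_Ln q 4 =
      - (?e 1 * ?e 2 * ?e 4) * (theta (q ^ 7) (q ^ 1) * theta (q ^ 7) (q ^ 2) * theta (q ^ 7) (q ^ 4))"
    using s[of 1] s[of 2] s[of 4] by simp
  also have "theta (q ^ 7) (q ^ 1) * theta (q ^ 7) (q ^ 2) * theta (q ^ 7) (q ^ 4) =
      E7 ^ 2 * (Q 1 * Q 2 * Q 3 * Q 4 * Q 5 * Q 6 * E7)"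
    using th[of 1 6] th[of 2 5] th[of 4 3] by (simp add: power2_eq_square mult_ac)
  also have "Q 1 * Q 2 * Q 3 * Q 4 * Q 5 * Q 6 * E7 = euler q"
    using qpoch_inf_power_split[OF q(1), of 7 q]
    by (simp add: E7_def Q_def lessThan_nat_numeral lessThan_Suc mult_ac power_numeral_reduce)
  finally show ?thesis unfolding e by (simp add: E7_def)
qed

lemma septic_T_Ln:
  "septic_T (q ^ 7) (Ln q / 14) (Ln q) = 8 + euler q ^ 4 / (q * euler (q ^ 7) ^ 4)"
proof -
  define E where "E = euler q"
  define E7 where "E7 = euler (q ^ 7)"
  have E0: "E7 \<noteq> 0" using qpoch_inf_self_nonzero[OF norm_power_less_1[OF q(1), of 7]] by (simp add: E7_def)
  have q7: "norm (q ^ 7) < 1" "q ^ 7 \<noteq> 0" using q norm_power_less_1[OF q(1), of 7] by auto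
  have "septic_T (q ^ 7) (Ln q / 14) (Ln q) - 8 = q ^ 7 * (septic_Ln q 1 *
      septic_Ln q 2 * septic_Ln q 4) ^ 4 / E7 ^ 12"
    unfolding E7_def septic_T_def
    using septic_relations(2)[OF q7 septic_Ln_periodic septic_Ln_nonzero refl refl refl] by simp
  also have "(septic_Ln q 1 *
      septic_Ln q 2 * septic_Ln q 4) ^ 4 = E ^ 4 * E7 ^ 8 / q ^ 8"
    unfolding septic_Ln_prod E_def[symmetric] E7_def[symmetric]
    by (simp add: power_mult_distrib power_mult[symmetric] power_divide)
  also have "q ^ 7 * (E ^ 4 * E7 ^ 8 / q ^ 8) / E7 ^ 12 = E ^ 4 / (q * E7 ^ 4)"
    using E0 q(2) by (simp add: divide_simps power_numeral_reduce)
  finally show ?thesis by (simp add: E_def E7_def algebra_simps)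
qed

lemma septic_Ln_quotients:
  "theta_quot (q ^ 7) (q ^ 1) +
   theta_quot (q ^ 7) (q ^ 2) +
   theta_quot (q ^ 7) (q ^ 4) =
   septic_T (q ^ 7) (Ln q / 14) (Ln q) / (euler q * euler (q ^ 7) ^ 2 / q ^ 2)"
proof -
  let ?s = "septic_Ln q"
  have "theta_quot (q ^ 7) (q ^ n) = ?s (2 * int n) / ?s (int n) ^ 4"
    if "0 < n" "n < 7" for n
    using theta_quotient_weier[of "q ^ 7" "of_int (int n) * Ln q"] power_theta_nonzero(3)[OF that]
    unfolding septic_double exp_Ln_multiple by (simp add: weier_Ln[unfolded of_int_of_nat_eq])
  from this[of 1] this[of 2] this[of 4] septic_Ln_periodic[of 1]
  have "theta_quot (q ^ 7) (q ^ 1) +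
   theta_quot (q ^ 7) (q ^ 2) +
   theta_quot (q ^ 7) (q ^ 4) =
   ?s 2 / ?s 1 ^ 4 + ?s 4 / ?s 2 ^ 4 + ?s 1 / ?s 4 ^ 4"
    by simp
  moreover have "R / (- a) = - R / a" for R a :: complex by simp
  ultimately show ?thesis
    unfolding septic_sum[OF septic_Ln_nonzero] septic_Ln_prod septic_T_def by (simp only:)
qed

text \<open>Terms are grouped in blocks of seven. For the nome q^7, \<open>lambert3_sums\<close> at
  z = q^i pairs the progressions 7n + i and 7n + 7 - i with opposite signs, as the odd character
  modulo 7 does; i = 1, 2, 4 exhaust the nonzero residues.\<close>

lemma lambert3_Legendre_sum:
  "infsum (\<lambda>(m, n). of_int (Legendre (int (Suc m)) 7) * (of_nat (Suc n) ^ 2 * q ^ (Suc m * Suc n))) UNIV =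
   q * euler q ^ 3 * euler (q ^ 7) ^ 3 + 8 * q ^ 2 * euler (q ^ 7) ^ 7 / euler q"
proof -
  define E where "E = euler q"
  define E7 where "E7 = euler (q ^ 7)"
  define T where "T = septic_T (q ^ 7) (Ln q / 14) (Ln q)"
  define S where "S = infsum (\<lambda>(m, n). of_int (Legendre (int (Suc m)) 7) * (of_nat (Suc n) ^ 2 * q ^ (Suc m * Suc n))) UNIV"
  have q7: "norm (q ^ 7) < 1" "q ^ 7 \<noteq> 0" using q norm_power_less_1[OF q(1), of 7] by auto
  have E0: "E \<noteq> 0" "E7 \<noteq> 0"
    using qpoch_inf_self_nonzero[OF q(1)] qpoch_inf_self_nonzero[OF q7(1)] by (simp_all add: E_def E7_def)
  define f where "f = (\<lambda>m. of_int (Legendre (int (Suc m)) 7) * lambert3 (q ^ Suc m))"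
  have "f sums S"
    unfolding f_def S_def by (rule has_sum_imp_sums[OF lambert3_twisted(2)[OF q(1) norm_Legendre_7]])
  then have 1: "(\<lambda>n. sum f {n * 7..<n * 7 + 7}) sums S"
    by (rule sums_group) simp
  have d: "(q ^ 7) ^ Suc n / q ^ i = q ^ (7 * n + j)" if "i + j = 7" for i j n
  proof -
    have "(q ^ 7) ^ Suc n = q ^ (7 * n + j) * q ^ i"
      unfolding power_mult[symmetric] power_add[symmetric]
      by (rule arg_cong[of _ _ "\<lambda>k. q ^ k"]) (use that in simp)
    then show ?thesis using q(2) by simp
  qed
  have L: "(\<lambda>n. lambert3 (q ^ (7 * n + j)) - lambert3 (q ^ (7 * n + i))) sums
      (- (E7 ^ 9) * (theta_quot (q ^ 7) (q ^ i)))"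
    if ij: "i + j = 7" "0 < i" "i < 7" for i j
  proof -
    have "q ^ i * (q ^ 7) ^ n = q ^ (7 * n + i)" for n
      by (simp add: power_add power_mult)
    then show ?thesis
      using lambert3_sums[OF q7, of "q ^ i"] q(2) power_theta_nonzero(1,2)[OF ij(2,3)]
      unfolding d[OF ij(1)] E7_def by (simp add: mult.assoc)
  qed
  have "(\<lambda>n. (lambert3 (q ^ (7 * n + 6)) - lambert3 (q ^ (7 * n + 1))) +
      (lambert3 (q ^ (7 * n + 5)) - lambert3 (q ^ (7 * n + 2))) +
      (lambert3 (q ^ (7 * n + 3)) - lambert3 (q ^ (7 * n + 4)))) sums
      (- (E7 ^ 9) * (theta_quot (q ^ 7) (q ^ 1)) +
       - (E7 ^ 9) * (theta_quot (q ^ 7) (q ^ 2)) +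
       - (E7 ^ 9) * (theta_quot (q ^ 7) (q ^ 4)))"
    by (intro sums_add L) auto
  also have "- (E7 ^ 9) * (theta_quot (q ^ 7) (q ^ 1)) +
       - (E7 ^ 9) * (theta_quot (q ^ 7) (q ^ 2)) +
       - (E7 ^ 9) * (theta_quot (q ^ 7) (q ^ 4)) =
       - (E7 ^ 9) * (T / (E * E7 ^ 2 / q ^ 2))"
    unfolding T_def E_def E7_def septic_Ln_quotients[symmetric] by (simp only: distrib_left)
  also have "(\<lambda>n. (lambert3 (q ^ (7 * n + 6)) - lambert3 (q ^ (7 * n + 1))) +
      (lambert3 (q ^ (7 * n + 5)) - lambert3 (q ^ (7 * n + 2))) +
      (lambert3 (q ^ (7 * n + 3)) - lambert3 (q ^ (7 * n + 4)))) = (\<lambda>n. - sum f {n * 7..<n * 7 + 7})"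
  proof
    fix n
    have leg: "Legendre (int (Suc (n * 7 + i))) 7 = (if Suc i mod 7 = 0 then 0 else if Suc i mod 7 \<in> {1, 2, 4} then 1 else - 1)"
      if "i < 7" for i
    proof -
      have "int (Suc (n * 7 + i)) mod 7 = int (Suc i mod 7)"
        by (simp add: zmod_int algebra_simps) presburger
      then show ?thesis unfolding Legendre_7 by simp
    qed
    have "sum f {n * 7..<n * 7 + 7} = (\<Sum>i<7. f (n * 7 + i))"
      by (rule sum.reindex_bij_witness[of _ "\<lambda>i. n * 7 + i" "\<lambda>j. j - n * 7"]) auto
    also have "\<dots> = (\<Sum>i<7. (if Suc i mod 7 = 0 then 0 else if Suc i mod 7 \<in> {1, 2, 4} then 1 else - 1) *
        lambert3 (q ^ (7 * n + Suc i)))"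
    proof (rule sum.cong)
      fix i :: nat assume "i \<in> {..<7}"
      moreover have "Suc (n * 7 + i) = 7 * n + Suc i" by simp
      ultimately show "f (n * 7 + i) = (if Suc i mod 7 = 0 then 0 else if Suc i mod 7 \<in> {1, 2, 4} then 1 else - 1) *
        lambert3 (q ^ (7 * n + Suc i))"
        unfolding f_def using leg[of i] by (auto simp: mult.commute simp del: power_Suc of_nat_Suc)
    qed simp
    also have "\<dots> = lambert3 (q ^ (7 * n + 1)) + lambert3 (q ^ (7 * n + 2)) - lambert3 (q ^ (7 * n + 3)) +
       lambert3 (q ^ (7 * n + 4)) - lambert3 (q ^ (7 * n + 5)) - lambert3 (q ^ (7 * n + 6))"
    proof -
      have "{..<7::nat} = {0, 1, 2, 3, 4, 5, 6}" by auto
      then show ?thesis by (simp add: power_add power_numeral_reduce mult_ac)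
    qed
    finally show "(lambert3 (q ^ (7 * n + 6)) - lambert3 (q ^ (7 * n + 1))) +
      (lambert3 (q ^ (7 * n + 5)) - lambert3 (q ^ (7 * n + 2))) +
      (lambert3 (q ^ (7 * n + 3)) - lambert3 (q ^ (7 * n + 4))) = - sum f {n * 7..<n * 7 + 7}"
      by simp
  qed
  finally have "- (E7 ^ 9) * (T / (E * E7 ^ 2 / q ^ 2)) = - S"
    using sums_unique2[OF _ sums_minus[OF 1]] by blast
  then have "S = E7 ^ 9 * (T / (E * E7 ^ 2 / q ^ 2))" by simp
  also have "\<dots> = q ^ 2 * E7 ^ 7 / E * T"
    using E0 q(2) by (simp add: divide_simps power_numeral_reduce)
  also have "\<dots> = q * E ^ 3 * E7 ^ 3 + 8 * q ^ 2 * E7 ^ 7 / E"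
    unfolding T_def septic_T_Ln E_def[symmetric] E7_def[symmetric] using E0 q(2)
    by (simp add: divide_simps power_numeral_reduce) (simp add: algebra_simps)
  finally show ?thesis by (simp add: S_def E_def E7_def)
qed

end

section \<open>Partitions\<close>

text \<open>Sums over an exhausting sequence give the unconditional sum once the absolute sums stay
  bounded. For partitions and for rows the absolute sums are again products of the same shape at a
  nonnegative nome, so the bound is the convergence of those products.\<close>

lemma has_sum_incseq:
  fixes f :: "'a \<Rightarrow> complex"
  assumes B: "incseq B" "(\<Union>N. B N) = A" and s: "\<And>N. (f has_sum s N) (B N)" "s \<longlonglongrightarrow> l"
    and t: "\<And>N. ((\<lambda>x. norm (f x)) has_sum t N) (B N)" "\<And>N. t N \<le> C"
  shows "(f has_sum l) A"
proof -
  have fin: "\<exists>N. F \<subseteq> B N" if "finite F" "F \<subseteq> A" for F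
    using that
  proof (induction F rule: finite_induct)
    case (insert x F)
    then obtain N M where "F \<subseteq> B N" "x \<in> B M" using B(2) by auto
    then have "insert x F \<subseteq> B (max N M)"
      using incseqD[OF B(1), of N "max N M"] incseqD[OF B(1), of M "max N M"] by auto
    then show ?case by blast
  qed simp
  have sm: "(\<lambda>x. norm (f x)) summable_on A"
  proof (rule nonneg_bdd_above_summable_on)
    show "bdd_above (sum (\<lambda>x. norm (f x)) ` {F. F \<subseteq> A \<and> finite F})"
    proof (rule bdd_aboveI2)
      fix F assume "F \<in> {F. F \<subseteq> A \<and> finite F}"
      then have F: "finite F" "F \<subseteq> A" by auto
      obtain N where "F \<subseteq> B N" using fin[OF F] by blast
      then have "(\<Sum>x\<in>F. norm (f x)) \<le> t N"
        using F(1) by (intro finite_sum_le_has_sum[OF t(1)]) auto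
      then show "(\<Sum>x\<in>F. norm (f x)) \<le> C" using t(2)[of N] by linarith
    qed
  qed simp
  have fA: "f summable_on A" by (rule abs_summable_summable[OF sm])
  have "s \<longlonglongrightarrow> infsum f A"
  proof (rule LIMSEQ_I)
    fix e :: real assume e: "e > 0"
    obtain F where F: "finite F" "F \<subseteq> A" "dist (\<Sum>x\<in>F. norm (f x)) (infsum (\<lambda>x. norm (f x)) A) \<le> e / 2"
      using infsum_finite_approximation[OF sm, of "e / 2"] e by auto
    obtain N0 where N0: "F \<subseteq> B N0" using fin F by blast
    show "\<exists>N0. \<forall>N\<ge>N0. norm (s N - infsum f A) < e"
    proof (intro exI allI impI)
      fix N assume "N \<ge> N0"
      then have FB: "F \<subseteq> B N" using N0 incseqD[OF B(1)] by blast
      have BA: "B N \<subseteq> A" using B(2) by blast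
      have split: "infsum g A = infsum g (B N) + infsum g (A - B N)" if "g summable_on A" for g :: "'a \<Rightarrow> 'b :: banach"
        using infsum_Un_disjoint[of g "B N" "A - B N"] summable_on_subset_banach[OF that] BA
        by (simp add: Un_absorb1)
      have "norm (s N - infsum f A) = norm (infsum f (A - B N))"
        using split[OF fA] s(1)[of N] by (simp add: infsumI norm_minus_commute)
      also have "\<dots> \<le> infsum (\<lambda>x. norm (f x)) (A - B N)"
        by (rule norm_infsum_bound) (rule summable_on_subset_banach[OF sm], auto)
      also have "\<dots> = infsum (\<lambda>x. norm (f x)) A - infsum (\<lambda>x. norm (f x)) (B N)"
        using split[OF sm] by simp
      also have "\<dots> \<le> infsum (\<lambda>x. norm (f x)) A - (\<Sum>x\<in>F. norm (f x))"
        using FB F(1) t(1)[of N] by (intro diff_left_mono finite_sum_le_infsum) (auto simp: has_sum_imp_summable)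
      also have "\<dots> \<le> e / 2"
        using F(3) by (simp only: dist_norm real_norm_def abs_le_iff) linarith
      finally show "norm (s N - infsum f A) < e" using e by linarith
    qed
  qed
  then have "l = infsum f A" using s(2) LIMSEQ_unique by blast
  then show ?thesis using fA by simp
qed

text \<open>Splitting off the multiplicity of the part N+1 contributes one geometric series.\<close>

lemma has_sum_partitions_bounded:
  fixes q :: complex
  assumes q: "norm q < 1"
  shows "((\<lambda>M. q ^ sum_mset M) has_sum (\<Prod>j<N. 1 / (1 - q ^ Suc j))) {M. set_mset M \<subseteq> {1..N}}"
proof (induction N)
  case 0
  have "{M. set_mset M \<subseteq> {1..0::nat}} = {{#}}" by auto
  then show ?case by (simp add: has_sum_finiteI)
next
  case (Suc N)
  have geo: "((\<lambda>k. (q ^ Suc N) ^ k) has_sum (1 / (1 - q ^ Suc N))) UNIV"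
    using norm_power_less_1[OF q, of "Suc N"]
    by (intro norm_summable_imp_has_sum geometric_sums) (simp_all only: norm_power, simp_all)
  have "((\<lambda>(M, k). q ^ sum_mset M * (q ^ Suc N) ^ k) has_sum
      (\<Prod>j<N. 1 / (1 - q ^ Suc j)) * (1 / (1 - q ^ Suc N))) ({M. set_mset M \<subseteq> {1..N}} \<times> UNIV)"
    by (rule has_sum_mult_Times[OF Suc geo])
  moreover have "bij_betw (\<lambda>(M, k). M + replicate_mset k (Suc N)) ({M. set_mset M \<subseteq> {1..N}} \<times> UNIV)
      {M. set_mset M \<subseteq> {1..Suc N}}"
  proof (rule bij_betwI[where g = "\<lambda>M. (filter_mset (\<lambda>x. x \<noteq> Suc N) M, count M (Suc N))"])
    show "(\<lambda>(M, k). M + replicate_mset k (Suc N)) \<in> {M. set_mset M \<subseteq> {1..N}} \<times> UNIV \<rightarrow> {M. set_mset M \<subseteq> {1..Suc N}}"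
      by (auto split: if_splits)
    show "(\<lambda>M. (filter_mset (\<lambda>x. x \<noteq> Suc N) M, count M (Suc N))) \<in> {M. set_mset M \<subseteq> {1..Suc N}} \<rightarrow> {M. set_mset M \<subseteq> {1..N}} \<times> UNIV"
      by (auto simp: le_Suc_eq)
    show "(\<lambda>M. (filter_mset (\<lambda>x. x \<noteq> Suc N) M, count M (Suc N))) ((\<lambda>(M, k). M + replicate_mset k (Suc N)) x) = x"
      if x: "x \<in> {M. set_mset M \<subseteq> {1..N}} \<times> UNIV" for x
    proof -
      obtain M k where xk: "x = (M, k)" "set_mset M \<subseteq> {1..N}" using x by auto
      then have c: "count M (Suc N) = 0" by (auto simp: count_eq_zero_iff)
      have "filter_mset (\<lambda>x. x \<noteq> Suc N) (M + replicate_mset k (Suc N)) = M"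
        using c by (intro multiset_eqI) auto
      then show ?thesis using c by (simp add: xk)
    qed
    show "(\<lambda>(M, k). M + replicate_mset k (Suc N)) ((\<lambda>M. (filter_mset (\<lambda>x. x \<noteq> Suc N) M, count M (Suc N))) M) = M" for M
      by (intro multiset_eqI) auto
  qed
  moreover have "q ^ sum_mset (M + replicate_mset k (Suc N)) = q ^ sum_mset M * (q ^ Suc N) ^ k" for M k
  proof -
    have "sum_mset (M + replicate_mset k (Suc N)) = sum_mset M + Suc N * k" by (simp add: mult.commute)
    then show ?thesis by (simp only: power_add power_mult)
  qed
  ultimately show ?case
    by (subst has_sum_reindex_bij_betw[symmetric, where g = "\<lambda>(M, k). M + replicate_mset k (Suc N)"])
      (auto simp: case_prod_unfold simp del: power_Suc)
qed

lemma LIMSEQ_inverse_qpoch: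
  assumes q: "norm q < 1"
  shows "(\<lambda>N. \<Prod>j<N. 1 / (1 - q ^ Suc j)) \<longlonglongrightarrow> 1 / euler q"
proof -
  have "(\<lambda>N. 1 / (\<Prod>j<N. 1 - q * q ^ j)) \<longlonglongrightarrow> 1 / euler q"
    by (intro tendsto_intros qpoch_inf_LIMSEQ q qpoch_inf_self_nonzero)
  then show ?thesis by (simp add: prod_dividef)
qed

theorem partition_generating_function:
  assumes q: "norm q < 1"
  shows "((\<lambda>n. of_nat (partition_number n) * q ^ n) has_sum (1 / euler q)) UNIV"
proof -
  define r where "r = complex_of_real (norm q)"
  have r: "norm r < 1" using q by (simp add: r_def)
  define A where "A = {M :: nat multiset. 0 \<notin># M}"
  obtain C where C: "\<And>N. norm (\<Prod>j<N. 1 / (1 - r ^ Suc j)) \<le> C"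
    using convergent_imp_Bseq[OF convergentI[OF LIMSEQ_inverse_qpoch[OF r]]] by (auto simp: Bseq_def)
  have sum: "((\<lambda>M. q ^ sum_mset M) has_sum (1 / euler q)) A"
  proof (rule has_sum_incseq[where B = "\<lambda>N. {M. set_mset M \<subseteq> {1..N}}" and t = "\<lambda>N. Re (\<Prod>j<N. 1 / (1 - r ^ Suc j))"])
    show "incseq (\<lambda>N. {M :: nat multiset. set_mset M \<subseteq> {1..N}})"
      by (fastforce intro!: incseq_SucI)
    show "(\<Union>N. {M :: nat multiset. set_mset M \<subseteq> {1..N}}) = A"
    proof (intro equalityI subsetI)
      fix M assume M: "M \<in> A"
      have "x \<le> sum_mset M" if "x \<in># M" for x :: nat
        using that by (metis sum_mset.remove le_add1)
      then have "set_mset M \<subseteq> {1..sum_mset M}" using M by (auto simp: A_def Suc_le_eq intro: gr0I)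
      then show "M \<in> (\<Union>N. {M. set_mset M \<subseteq> {1..N}})" by auto
    qed (auto simp: A_def)
    show "((\<lambda>M. q ^ sum_mset M) has_sum (\<Prod>j<N. 1 / (1 - q ^ Suc j))) {M. set_mset M \<subseteq> {1..N}}" for N
      by (rule has_sum_partitions_bounded[OF q])
    show "(\<lambda>N. \<Prod>j<N. 1 / (1 - q ^ Suc j)) \<longlonglongrightarrow> 1 / euler q"
      by (rule LIMSEQ_inverse_qpoch[OF q])
    show "((\<lambda>M. norm (q ^ sum_mset M)) has_sum Re (\<Prod>j<N. 1 / (1 - r ^ Suc j))) {M. set_mset M \<subseteq> {1..N}}" for N
      using has_sum_Re[OF has_sum_partitions_bounded[OF r, of N]]
      by (simp add: r_def norm_power of_real_power[symmetric] del: of_real_power)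
    show "Re (\<Prod>j<N. 1 / (1 - r ^ Suc j)) \<le> C" for N
      using C[of N] complex_Re_le_cmod order_trans by blast
  qed
  have "bij_betw snd (SIGMA n:UNIV. {M :: nat multiset. 0 \<notin># M \<and> sum_mset M = n}) A"
    by (rule bij_betwI[where g = "\<lambda>M. (sum_mset M, M)"]) (auto simp: A_def)
  from has_sum_reindex_bij_betw[OF this, of "\<lambda>M. q ^ sum_mset M"] sum
  have "((\<lambda>x. q ^ sum_mset (snd x)) has_sum (1 / euler q)) (SIGMA n:UNIV. {M :: nat multiset. 0 \<notin># M \<and> sum_mset M = n})"
    by simp
  then show ?thesis
  proof (rule has_sum_SigmaD)
    fix n
    show "((\<lambda>M. q ^ sum_mset (snd (n, M))) has_sum of_nat (partition_number n) * q ^ n) {M. 0 \<notin># M \<and> sum_mset M = n}"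
      by (rule has_sum_finiteI[OF finite_partitions]) (simp add: partition_number_def)
  qed
qed

section \<open>Extraction of the powers of q^7 by averaging over the seventh roots of q\<close>

lemma has_sum_sum:
  fixes f :: "'i \<Rightarrow> 'a \<Rightarrow> complex"
  assumes "finite I" "\<And>j. j \<in> I \<Longrightarrow> (f j has_sum s j) A"
  shows "((\<lambda>x. \<Sum>j\<in>I. f j x) has_sum (\<Sum>j\<in>I. s j)) A"
  using assms by (induction I rule: finite_induct) (auto intro!: has_sum_add)

lemma has_sum_root_average:
  fixes a :: "'a \<Rightarrow> complex" and e :: "'a \<Rightarrow> nat"
  assumes "\<And>j. j < 7 \<Longrightarrow> ((\<lambda>i. a i * (zeta7 ^ j * r) ^ e i) has_sum s j) A"
  shows "((\<lambda>i. a i * r ^ e i) has_sum ((\<Sum>j<7. s j) / 7)) {i\<in>A. 7 dvd e i}"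
proof -
  have "((\<lambda>i. \<Sum>j<7. a i * (zeta7 ^ j * r) ^ e i) has_sum (\<Sum>j<7. s j)) A"
    using assms by (intro has_sum_sum) auto
  then have "((\<lambda>i. (\<Sum>j<7. a i * (zeta7 ^ j * r) ^ e i) / 7) has_sum (\<Sum>j<7. s j) / 7) A"
    by (rule has_sum_divide_const)
  also have "(\<lambda>i. (\<Sum>j<7. a i * (zeta7 ^ j * r) ^ e i) / 7) = (\<lambda>i. if 7 dvd e i then a i * r ^ e i else 0)"
  proof
    fix i
    have "(\<Sum>j<7. a i * (zeta7 ^ j * r) ^ e i) = a i * r ^ e i * (\<Sum>j<7. (zeta7 ^ j) ^ e i)"
      by (simp add: power_mult_distrib sum_distrib_left mult_ac)
    then show "(\<Sum>j<7. a i * (zeta7 ^ j * r) ^ e i) / 7 = (if 7 dvd e i then a i * r ^ e i else 0)"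
      unfolding z7.sum_roots by simp
  qed
  finally show ?thesis
    by (rule has_sum_cong_neutral[THEN iffD1, rotated -1]) auto
qed

context
  fixes q r :: complex
  assumes q: "norm q < 1" "q \<noteq> 0" and r: "r ^ 7 = q"
begin

lemma r_facts: "norm (zeta7 ^ j * r) < 1" "zeta7 ^ j * r \<noteq> 0" "(zeta7 ^ j * r) ^ 7 = q"
proof -
  have "norm r ^ 7 < 1" using q(1) r by (metis norm_power)
  then have "norm r < 1" by (meson not_le one_le_power)
  then show "norm (zeta7 ^ j * r) < 1" by (simp add: norm_mult norm_power)
  show "zeta7 ^ j * r \<noteq> 0" using q(2) r z7.w0 by auto
  have "(zeta7 ^ j) ^ 7 = (zeta7 ^ 7) ^ j" by (simp only: power_mult[symmetric] mult.commute)
  then have "(zeta7 ^ j) ^ 7 = 1" using z7.w7 by simp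
  then show "(zeta7 ^ j * r) ^ 7 = q" by (simp add: power_mult_distrib r)
qed

text \<open>The factor x^2 moves the exponent from n to n + 2, so that divisibility by 7 selects
  precisely the indices n = 7(j+1) - 2.\<close>

lemma partition_average:
  "((\<lambda>j. of_nat (partition_number (7 * Suc j - 2)) * q ^ Suc j) has_sum
    ((\<Sum>j<7. (zeta7 ^ j * r) ^ 2 / euler (zeta7 ^ j * r)) / 7)) UNIV"
proof -
  have "((\<lambda>n. of_nat (partition_number n) * (zeta7 ^ j * r) ^ (n + 2)) has_sum
      (zeta7 ^ j * r) ^ 2 / euler (zeta7 ^ j * r)) UNIV" for j
  proof -
    have "x ^ 2 * (of_nat (partition_number n) * x ^ n) = of_nat (partition_number n) * x ^ (n + 2)" for x :: complex and n
      by (simp only: power_add mult_ac)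
    then show ?thesis
      using has_sum_cmult_right[OF partition_generating_function[OF r_facts(1)[of j]], of "(zeta7 ^ j * r) ^ 2"]
      by (simp only: times_divide_eq_right mult_1_right)
  qed
  from has_sum_root_average[where e = "\<lambda>n. n + 2", OF this]
  have sm: "((\<lambda>n. of_nat (partition_number n) * r ^ (n + 2)) has_sum
     ((\<Sum>j<7. (zeta7 ^ j * r) ^ 2 / euler (zeta7 ^ j * r)) / 7)) {n. 7 dvd n + 2}"
    by simp
  have bij: "bij_betw (\<lambda>j. 7 * Suc j - 2) UNIV {n :: nat. 7 dvd n + 2}"
  proof (rule bij_betwI[where g = "\<lambda>n. (n + 2) div 7 - 1"])
    show "(\<lambda>j. 7 * Suc j - 2) \<in> UNIV \<rightarrow> {n. 7 dvd n + 2}" by simp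
    show "(7 * Suc j - 2 + 2) div 7 - 1 = j" for j by simp
    show "7 * Suc ((n + 2) div 7 - 1) - 2 = n" if n: "n \<in> {n. 7 dvd n + 2}" for n
    proof -
      obtain k where k: "n + 2 = 7 * k" using n by (auto elim: dvdE)
      then show ?thesis by (cases k) auto
    qed
  qed auto
  have "((\<lambda>j. of_nat (partition_number (7 * Suc j - 2)) * r ^ (7 * Suc j - 2 + 2)) has_sum
     ((\<Sum>j<7. (zeta7 ^ j * r) ^ 2 / euler (zeta7 ^ j * r)) / 7)) UNIV"
    by (rule has_sum_reindex_bij_betw[OF bij, of "\<lambda>n. of_nat (partition_number n) * r ^ (n + 2)", THEN iffD2, OF sm])
  moreover have "r ^ (7 * Suc j - 2 + 2) = q ^ Suc j" for j
  proof -
    have "7 * Suc j - 2 + 2 = 7 * Suc j" by simp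
    then show ?thesis unfolding r[symmetric] by (simp only: power_mult)
  qed
  ultimately show ?thesis by (simp only:)
qed

text \<open>The eigenfunction property. If 7 divides (m+1)(n+1), either the character vanishes or 7
  divides n+1; replacing n+1 by 7(n+1) multiplies its square by 49. The sum over seven roots adds
  another factor 7.\<close>

lemma lambert3_Legendre_average:
  defines "S \<equiv> \<lambda>q. infsum (\<lambda>(m, n). of_int (Legendre (int (Suc m)) 7) * (of_nat (Suc n) ^ 2 * q ^ (Suc m * Suc n))) UNIV :: complex"
  shows "(\<Sum>j<7. S (zeta7 ^ j * r)) = 343 * S q"
proof -
  define a where "a = (\<lambda>(m, n). of_int (Legendre (int (Suc m)) 7) * of_nat (Suc n) ^ 2 :: complex)"
  define e where "e = (\<lambda>(m, n). Suc m * Suc n)"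
  have fam: "(\<lambda>(m, n). of_int (Legendre (int (Suc m)) 7) * (of_nat (Suc n) ^ 2 * x ^ (Suc m * Suc n))) = (\<lambda>i. a i * x ^ e i)" for x :: complex
    by (auto simp: a_def e_def fun_eq_iff)
  have H: "((\<lambda>i. a i * x ^ e i) has_sum S x) UNIV" if "norm x < 1" for x
    using lambert3_twisted(1)[OF that, of "\<lambda>m. of_int (Legendre (int (Suc m)) 7)", OF norm_Legendre_7]
    unfolding S_def fam .
  have "((\<lambda>i. a i * r ^ e i) has_sum ((\<Sum>j<7. S (zeta7 ^ j * r)) / 7)) {i\<in>UNIV. 7 dvd e i}"
    by (intro has_sum_root_average H r_facts)
  then have sm: "((\<lambda>i. a i * r ^ e i) has_sum ((\<Sum>j<7. S (zeta7 ^ j * r)) / 7)) {i. 7 dvd Suc (snd i)}"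
  proof (rule has_sum_cong_neutral[THEN iffD1, rotated -1])
    fix i :: "nat \<times> nat"
    assume i: "i \<in> {i \<in> UNIV. 7 dvd e i} - {i. 7 dvd Suc (snd i)}"
    then have "7 dvd Suc (fst i)"
      using prime_dvd_mult_iff[of "7 :: nat" "Suc (fst i)" "Suc (snd i)"] by (auto simp: e_def case_prod_unfold)
    then have "int (Suc (fst i)) mod 7 = 0" by presburger
    then show "a i * r ^ e i = 0" by (simp add: a_def case_prod_unfold Legendre_7)
  qed (auto simp: e_def case_prod_unfold simp del: mult_Suc mult_Suc_right intro: dvd_mult)
  have bij: "bij_betw (\<lambda>(m, n). (m, 7 * Suc n - 1)) UNIV {i :: nat \<times> nat. 7 dvd Suc (snd i)}"
  proof (rule bij_betwI[where g = "\<lambda>(m, n). (m, Suc n div 7 - 1)"])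
    show "(case case x of (m, n) \<Rightarrow> (m, Suc n div 7 - 1) of (m, n) \<Rightarrow> (m, 7 * Suc n - 1)) = x"
      if i: "x \<in> {i. 7 dvd Suc (snd i)}" for x :: "nat \<times> nat"
    proof -
      obtain m n where x: "x = (m, n)" by (cases x)
      then obtain k where k: "Suc n = 7 * k" using i by (auto elim: dvdE)
      then have "7 * Suc (Suc n div 7 - 1) - 1 = n" by (cases k) auto
      then show ?thesis by (simp add: x)
    qed
  qed auto
  have "((\<lambda>i. a (case i of (m, n) \<Rightarrow> (m, 7 * Suc n - 1)) * r ^ e (case i of (m, n) \<Rightarrow> (m, 7 * Suc n - 1))) has_sum
      ((\<Sum>j<7. S (zeta7 ^ j * r)) / 7)) UNIV"
    by (rule has_sum_reindex_bij_betw[OF bij, of "\<lambda>i. a i * r ^ e i", THEN iffD2, OF sm])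
  moreover have "a (case i of (m, n) \<Rightarrow> (m, 7 * Suc n - 1)) * r ^ e (case i of (m, n) \<Rightarrow> (m, 7 * Suc n - 1)) = 49 * (a i * q ^ e i)" for i
  proof -
    obtain m n where i: "i = (m, n)" by (cases i)
    have s: "Suc (7 * Suc n - 1) = 7 * Suc n" by simp
    have "Suc m * (7 * Suc n) = 7 * (Suc m * Suc n)" by (simp only: mult_ac)
    then have "r ^ (Suc m * (7 * Suc n)) = q ^ (Suc m * Suc n)" unfolding r[symmetric] by (simp only: power_mult)
    then show ?thesis
      unfolding i a_def e_def prod.case s by (simp add: power_mult_distrib del: power_Suc of_nat_Suc mult_Suc mult_Suc_right)
  qed
  ultimately have "((\<lambda>i. 49 * (a i * q ^ e i)) has_sum ((\<Sum>j<7. S (zeta7 ^ j * r)) / 7)) UNIV"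
    by (simp only:)
  moreover have "((\<lambda>i. 49 * (a i * q ^ e i)) has_sum (49 * S q)) UNIV"
    by (rule has_sum_cmult_right[OF H[OF q(1)]])
  ultimately have "(\<Sum>j<7. S (zeta7 ^ j * r)) / 7 = 49 * S q"
    using has_sum_unique by blast
  then show ?thesis by simp
qed

text \<open>The extra factor x makes the exponent of x equal to n(n-1)/2 + 1, divisible by 7 only
  for n = 7m - 3. There it is 49 m(m-1)/2 + 7, so the surviving terms form a theta series for the
  nome q^7.\<close>

lemma theta_average:
  assumes z: "z \<noteq> 0"
  shows "(\<Sum>j<7. (zeta7 ^ j * r) * theta (zeta7 ^ j * r) z) = - 7 * q * theta (q ^ 7) (z ^ 7) / z ^ 3"
proof -
  define e where "e = (\<lambda>n::int. nat (n * (n - 1) div 2) + 1)"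
  define a where "a = (\<lambda>n::int. (- 1) powi n * z powi n)"
  have tri: "n * (n - 1) div 2 \<ge> 0" for n :: int
    by (cases "n \<ge> 1") (auto simp: zero_le_mult_iff pos_imp_zdiv_nonneg_iff)
  have fam: "x * (theta_coeff x n * z powi n) = a n * x ^ e n" if "x \<noteq> 0" for x n
  proof -
    have "x powi (n * (n - 1) div 2) = x ^ nat (n * (n - 1) div 2)"
      using tri[of n] by (simp add: power_int_def)
    then show ?thesis by (simp add: theta_coeff_def a_def e_def mult_ac)
  qed
  have H: "((\<lambda>n. a n * (zeta7 ^ j * r) ^ e n) has_sum ((zeta7 ^ j * r) * theta (zeta7 ^ j * r) z)) UNIV" for j
    using has_sum_cmult_right[OF jacobi_triple_product[OF r_facts(1,2)[of j] z], of "zeta7 ^ j * r"]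
    unfolding fam[OF r_facts(2)] .
  have A: "((\<lambda>n. a n * r ^ e n) has_sum ((\<Sum>j<7. (zeta7 ^ j * r) * theta (zeta7 ^ j * r) z) / 7)) {n\<in>UNIV. 7 dvd e n}"
    by (rule has_sum_root_average[OF H])
  have dvd: "7 dvd e n \<longleftrightarrow> n mod 7 = 4" for n
  proof -
    define t where "t = n * (n - 1) div 2"
    have "2 * t = n * (n - 1)" by (simp add: t_def)
    \<comment> \<open>Completing the square modulo 7, where 8 is 1: the exponent t + 1 is divisible
      by 7 exactly when 2n - 1 is.\<close>
    then have t: "8 * (t + 1) = (2 * n - 1) ^ 2 + 7"
      by (simp add: power2_eq_square algebra_simps)
    have "7 dvd e n \<longleftrightarrow> 7 dvd t + 1"
      using tri[of n] unfolding e_def t_def[symmetric] by presburger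
    also have "\<dots> \<longleftrightarrow> 7 dvd 8 * (t + 1)" by presburger
    also have "\<dots> \<longleftrightarrow> 7 dvd (2 * n - 1) ^ 2" unfolding t by presburger
    also have "\<dots> \<longleftrightarrow> 7 dvd 2 * n - 1"
      by (rule prime_dvd_power_iff) auto
    also have "\<dots> \<longleftrightarrow> n mod 7 = 4" by presburger
    finally show ?thesis .
  qed
  have bij: "bij_betw (\<lambda>m. 7 * m - 3) UNIV {n::int. n \<in> UNIV \<and> 7 dvd e n}"
  proof (rule bij_betwI[where g = "\<lambda>n. (n + 3) div 7"])
    have "(7 * m - 3) mod 7 = 4" for m :: int by presburger
    then show "(\<lambda>m. 7 * m - 3) \<in> UNIV \<rightarrow> {n::int. n \<in> UNIV \<and> 7 dvd e n}" by (simp add: dvd)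
    show "(7 * m - 3 + 3) div 7 = m" for m :: int by simp
    have "7 * ((n + 3) div 7) - 3 = n" if "n mod 7 = 4" for n :: int using that by presburger
    then show "7 * ((n + 3) div 7) - 3 = n" if "n \<in> {n::int. n \<in> UNIV \<and> 7 dvd e n}" for n
      using that by (simp add: dvd)
  qed simp
  have "((\<lambda>m. a (7 * m - 3) * r ^ e (7 * m - 3)) has_sum ((\<Sum>j<7. (zeta7 ^ j * r) * theta (zeta7 ^ j * r) z) / 7)) UNIV"
    by (rule has_sum_reindex_bij_betw[OF bij, of "\<lambda>n. a n * r ^ e n", THEN iffD2, OF A])
  moreover have "a (7 * m - 3) * r ^ e (7 * m - 3) = - q / z ^ 3 * (theta_coeff (q ^ 7) m * (z ^ 7) powi m)" for m
  proof -
    define t where "t = m * (m - 1) div 2"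
    have t: "2 * t = m * (m - 1)" by (simp add: t_def)
    have "(7 * m - 3) * (7 * m - 3 - 1) = 2 * (49 * t + 6)"
      using t by (simp add: algebra_simps)
    then have "(7 * m - 3) * (7 * m - 3 - 1) div 2 = 49 * t + 6" by simp
    then have e: "e (7 * m - 3) = 7 * (7 * nat t) + 7"
      using tri[of m] unfolding e_def t_def[symmetric] by (simp add: nat_add_distrib nat_mult_distrib)
    have "r ^ e (7 * m - 3) = q * (q ^ 7) ^ nat t"
      unfolding e power_add power_mult r by simp
    also have "(q ^ 7) ^ nat t = (q ^ 7) powi t"
      using tri[of m] by (simp add: power_int_def t_def)
    finally have 1: "r ^ e (7 * m - 3) = q * (q ^ 7) powi t" .
    have "z powi (7 * m - 3) = (z ^ 7) powi m / z ^ 3"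
      using z power_int_diff[of z "7 * m" 3] power_int_mult[of z 7 m] by simp
    moreover have "(- 1 :: complex) powi (7 * m - 3) = - ((- 1) powi m)"
      using power_int_diff[of "- 1 :: complex" "7 * m" 3] power_int_mult[of "- 1 :: complex" 7 m] by simp
    ultimately show ?thesis
      unfolding 1 a_def theta_coeff_def t_def[symmetric] by simp
  qed
  ultimately have "((\<lambda>m. - q / z ^ 3 * (theta_coeff (q ^ 7) m * (z ^ 7) powi m)) has_sum
      ((\<Sum>j<7. (zeta7 ^ j * r) * theta (zeta7 ^ j * r) z) / 7)) UNIV"
    by (simp only:)
  moreover have "((\<lambda>m. - q / z ^ 3 * (theta_coeff (q ^ 7) m * (z ^ 7) powi m)) has_sum
      (- q / z ^ 3 * theta (q ^ 7) (z ^ 7))) UNIV"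
    using q z by (intro has_sum_cmult_right jacobi_triple_product norm_power_less_1) auto
  ultimately have "(\<Sum>j<7. (zeta7 ^ j * r) * theta (zeta7 ^ j * r) z) / 7 = - q / z ^ 3 * theta (q ^ 7) (z ^ 7)"
    using has_sum_unique by blast
  then show ?thesis by (simp add: field_simps)
qed

text \<open>The derivative of \<open>theta_average\<close> at z = 1, where theta has slope minus the
  cube of the Euler product. The inner derivative of z^7 gives the second factor 7; the factor
  z^(-3) is not differentiated in effect, because theta vanishes at 1.\<close>

lemma qpoch_cube_average:
  "(\<Sum>j<7. (zeta7 ^ j * r) * euler (zeta7 ^ j * r) ^ 3) = - 49 * q * euler (q ^ 7) ^ 3"
proof -
  let ?f = "\<lambda>z. \<Sum>j<7. (zeta7 ^ j * r) * theta (zeta7 ^ j * r) z"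
  have "(?f has_field_derivative (\<Sum>j<7. (zeta7 ^ j * r) * - (euler (zeta7 ^ j * r) ^ 3))) (at 1)"
    by (intro DERIV_sum DERIV_cmult theta_has_derivative_at_1 r_facts)
  moreover have "(?f has_field_derivative 49 * q * euler (q ^ 7) ^ 3) (at 1)"
  proof -
    have q7: "norm (q ^ 7) < 1" using norm_power_less_1[OF q(1), of 7] by simp
    have "((\<lambda>z. z ^ 7) has_field_derivative (7 :: complex)) (at 1)"
      by (auto intro!: derivative_eq_intros)
    then have d: "((\<lambda>z. theta (q ^ 7) (z ^ 7)) has_field_derivative - (euler (q ^ 7) ^ 3) * 7) (at 1)"
      by (rule DERIV_chain2[where g = "\<lambda>z. z ^ 7", rotated]) (use theta_has_derivative_at_1[OF q7] in simp)
    have "((\<lambda>z. 1 / z ^ 3) has_field_derivative (- 3 :: complex)) (at 1)"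
      by (auto intro!: derivative_eq_intros)
    from DERIV_mult[OF DERIV_cmult[OF d, of "- 7 * q"] this]
    have "((\<lambda>z. - 7 * q * theta (q ^ 7) (z ^ 7) * (1 / z ^ 3)) has_field_derivative 49 * q * euler (q ^ 7) ^ 3) (at 1)"
      using q7 by (simp add: mult.assoc)
    moreover have "\<forall>\<^sub>F z in nhds 1. - 7 * q * theta (q ^ 7) (z ^ 7) * (1 / z ^ 3) = ?f z"
      using eventually_nhds_in_open[of "- {0::complex}" 1, OF open_Compl]
      by (auto elim!: eventually_mono simp: theta_average)
    ultimately show ?thesis
      by (subst DERIV_cong_ev[OF refl _ refl, symmetric]) auto
  qed
  ultimately have "(\<Sum>j<7. (zeta7 ^ j * r) * - (euler (zeta7 ^ j * r) ^ 3)) = 49 * q * euler (q ^ 7) ^ 3"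
    by (rule DERIV_unique)
  then have "- (\<Sum>j<7. (zeta7 ^ j * r) * euler (zeta7 ^ j * r) ^ 3) = 49 * q * euler (q ^ 7) ^ 3"
    by (simp add: sum_negf)
  from arg_cong[OF this, of uminus] show ?thesis by simp
qed

end

text \<open>At every seventh root x of q the factors with nome x^7 in the evaluation of S(x) are
  constant. The average of S therefore involves only the average of x E(x)^3, which is known, and
  that of x^2/E(x), which generates the partition numbers; the eigenvalue equation is solved for the
  latter.\<close>

theorem partition_7n_minus_2:
  assumes q: "norm q < 1" "q \<noteq> 0"
  shows "((\<lambda>j. of_nat (partition_number (7 * Suc j - 2)) * q ^ Suc j) has_sum
     (7 * q * (euler (q ^ 7) ^ 3 / euler q ^ 4) +
      49 * q ^ 2 * (euler (q ^ 7) ^ 7 / euler q ^ 8))) UNIV"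
proof -
  define r where "r = exp (Ln q / 7)"
  have r: "r ^ 7 = q"
    using exp_of_nat_mult[of 7 "Ln q / 7"] q(2) by (simp add: r_def)
  define E where "E = euler q"
  define E7 where "E7 = euler (q ^ 7)"
  have E0: "E \<noteq> 0" using qpoch_inf_self_nonzero[OF q(1)] by (simp add: E_def)
  define S where "S = (\<lambda>q. infsum (\<lambda>(m, n). of_int (Legendre (int (Suc m)) 7) * (of_nat (Suc n) ^ 2 * q ^ (Suc m * Suc n))) UNIV :: complex)"
  define P where "P = (\<Sum>j<7. (zeta7 ^ j * r) ^ 2 / euler (zeta7 ^ j * r))"
  have S: "S x = x * qpoch_inf x x ^ 3 * qpoch_inf (x ^ 7) (x ^ 7) ^ 3 + 8 * x ^ 2 * qpoch_inf (x ^ 7) (x ^ 7) ^ 7 / qpoch_inf x x"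
    if "norm x < 1" "x \<noteq> 0" for x
    unfolding S_def by (rule lambert3_Legendre_sum[OF that])
  have "343 * S q = (\<Sum>j<7. S (zeta7 ^ j * r))"
    unfolding S_def by (rule lambert3_Legendre_average[OF q r, symmetric])
  also have "\<dots> = (\<Sum>j<7. (zeta7 ^ j * r) * euler (zeta7 ^ j * r) ^ 3 * E ^ 3 +
     8 * E ^ 7 * ((zeta7 ^ j * r) ^ 2 / euler (zeta7 ^ j * r)))"
    unfolding S[OF r_facts(1,2)[OF q r]] r_facts(3)[OF q r] E_def[symmetric]
    by (simp only: times_divide_eq_right mult_ac)
  also have "\<dots> = (\<Sum>j<7. (zeta7 ^ j * r) * euler (zeta7 ^ j * r) ^ 3) * E ^ 3 + 8 * E ^ 7 * P"
    by (simp only: sum.distrib sum_distrib_left sum_distrib_right P_def)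
  also have "\<dots> = - 49 * q * E7 ^ 3 * E ^ 3 + 8 * E ^ 7 * P"
    unfolding qpoch_cube_average[OF q r] E7_def ..
  finally have "343 * S q = - 49 * q * E7 ^ 3 * E ^ 3 + 8 * E ^ 7 * P" .
  then have "8 * E ^ 7 * P = 392 * q * E ^ 3 * E7 ^ 3 + 2744 * q ^ 2 * E7 ^ 7 / E"
    unfolding S[OF q] E_def[symmetric] E7_def[symmetric] by (simp add: algebra_simps)
  then have "P / 7 = (392 * q * E ^ 3 * E7 ^ 3 + 2744 * q ^ 2 * E7 ^ 7 / E) / (56 * E ^ 7)"
    using E0 by (simp add: divide_simps mult_ac)
  also have "\<dots> = 7 * q * (E7 ^ 3 / E ^ 4) + 49 * q ^ 2 * (E7 ^ 7 / E ^ 8)"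
    using E0 by (simp add: divide_simps power_numeral_reduce)
  finally show ?thesis
    using partition_average[OF q r] by (simp only: P_def E_def E7_def)
qed

section \<open>Frobenius symbols\<close>

text \<open>Encodes the order of colored integers in the order of the naturals. The base k + 1
  exceeds every color, so the code is injective and monotone for colors up to k, and rows become
  strictly sorted lists of numbers.\<close>

definition cenc :: "nat \<Rightarrow> colored_nat \<Rightarrow> nat" where
  "cenc k x = fst x * Suc k + snd x"

lemma colored_less_iff_cenc:
  assumes "snd x \<le> k" "snd y \<le> k"
  shows "colored_less x y \<longleftrightarrow> cenc k x < cenc k y"
proof -
  have lt: "cenc k a < cenc k b" if "fst a < fst b" "snd a \<le> k" for a b
  proof -
    have "fst a * Suc k + snd a < Suc (fst a) * Suc k" using that by simp
    also have "\<dots> \<le> fst b * Suc k" using that by (intro mult_le_mono1) simp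
    finally show ?thesis by (simp add: cenc_def)
  qed
  show ?thesis
    using lt[of x y] lt[of y x] assms
    by (cases "fst x" "fst y" rule: linorder_cases) (auto simp: colored_less_def cenc_def)
qed

lemma inj_on_cenc: "inj_on (cenc k) {x. snd x \<le> k}"
proof (rule inj_onI)
  fix x y assume a: "x \<in> {x. snd x \<le> k}" "y \<in> {x. snd x \<le> k}" and eq: "cenc k x = cenc k y"
  then have "\<not> colored_less x y" "\<not> colored_less y x"
    using colored_less_iff_cenc[of x k y] colored_less_iff_cenc[of y k x] by auto
  then show "x = y" by (auto simp: colored_less_def prod_eq_iff)
qed

lemma gen_frobenius_row_iff:
  "gen_frobenius_row k r \<longleftrightarrow> (\<forall>x\<in>set r. snd x \<in> {1..k}) \<and> sorted_wrt (<) (rev (map (cenc k) r))"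
proof -
  have "sorted_wrt (\<lambda>x y. colored_less y x) r \<longleftrightarrow> sorted_wrt (\<lambda>x y. cenc k y < cenc k x) r"
    if "\<forall>x\<in>set r. snd x \<in> {1..k}"
  proof -
    have "colored_less y x \<longleftrightarrow> cenc k y < cenc k x" if "x \<in> set r" "y \<in> set r" for x y
      using that \<open>\<forall>x\<in>set r. snd x \<in> {1..k}\<close> by (intro colored_less_iff_cenc) auto
    then show ?thesis
      by (auto elim!: sorted_wrt_mono_rel[rotated])
  qed
  then show ?thesis
    by (auto simp: gen_frobenius_row_def sorted_wrt_rev sorted_wrt_map)
qed

text \<open>A strictly decreasing list is determined by its set; conversely a finite set is turned
  into a row by sorting its codes.\<close>

lemma bij_betw_rows:
  "bij_betw set {r. gen_frobenius_row k r} {S. finite S \<and> S \<subseteq> UNIV \<times> {1..k}}"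
  unfolding bij_betw_def
proof
  show "inj_on set {r. gen_frobenius_row k r}"
  proof (rule inj_onI)
    fix r s assume rs: "r \<in> {r. gen_frobenius_row k r}" "s \<in> {r. gen_frobenius_row k r}" and eq: "set r = set s"
    then have "rev (map (cenc k) r) = rev (map (cenc k) s)"
      by (intro strict_sorted_equal) (auto simp: gen_frobenius_row_iff)
    then have "map (cenc k) r = map (cenc k) s" by simp
    moreover have "inj_on (cenc k) (set r \<union> set s)"
      using rs by (intro inj_on_subset[OF inj_on_cenc]) (auto simp: gen_frobenius_row_def)
    ultimately show "r = s" by (simp add: inj_on_map_eq_map)
  qed
  show "set ` {r. gen_frobenius_row k r} = {S. finite S \<and> S \<subseteq> UNIV \<times> {1..k}}"
  proof (intro equalityI subsetI)
    fix S :: "colored_nat set" assume "S \<in> {S. finite S \<and> S \<subseteq> UNIV \<times> {1..k}}"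
    then have S: "finite S" "S \<subseteq> UNIV \<times> {1..k}" by auto
    have inj: "inj_on (cenc k) S"
      using S by (intro inj_on_subset[OF inj_on_cenc]) auto
    define r where "r = map (the_inv_into S (cenc k)) (rev (sorted_list_of_set (cenc k ` S)))"
    have m: "map (cenc k) r = rev (sorted_list_of_set (cenc k ` S))"
      unfolding r_def map_map using S(1)
      by (intro map_idI) (auto intro!: f_the_inv_into_f[OF inj])
    have "set r = the_inv_into S (cenc k) ` cenc k ` S"
      using S(1) by (simp add: r_def)
    also have "\<dots> = S" using inj by (simp add: image_image the_inv_into_f_f)
    finally have set: "set r = S" .
    have "gen_frobenius_row k r"
      unfolding gen_frobenius_row_iff m set using S by auto
    then show "S \<in> set ` {r. gen_frobenius_row k r}" using set by blast
  qed (auto simp: gen_frobenius_row_def)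
qed

lemma row_distinct: "gen_frobenius_row k r \<Longrightarrow> distinct r"
  using strict_sorted_iff[of "rev (map (cenc k) r)"] by (auto simp: gen_frobenius_row_iff distinct_map)

text \<open>Expanding the product over the box of pairs (j, c) with j < N, each pair contributes
  either 1 or -z q^j. The absolute values form the same expansion at |q| and -|z|, which bounds them
  uniformly in N.\<close>

lemma row_generating_function:
  assumes q: "norm q < 1"
  shows "((\<lambda>r. (- z) ^ length r * q ^ (\<Sum>x\<leftarrow>r. fst x)) has_sum qpoch_inf z q ^ k) {r. gen_frobenius_row k r}"
proof -
  define f where "f = (\<lambda>(q :: complex) (z :: complex) S. \<Prod>x\<in>S. - (z * q ^ fst (x :: nat \<times> nat)))"
  have fin: "(f q z has_sum (\<Prod>j<N. 1 - z * q ^ j) ^ k) (Pow ({..<N} \<times> {1..k}))" for q z N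
  proof (rule has_sum_finiteI)
    have "sum (f q z) (Pow ({..<N} \<times> {1..k})) = (\<Prod>x\<in>{..<N} \<times> {1..k}. - (z * q ^ fst x) + 1)"
      using prod_add[of "{..<N} \<times> {1..k}" "\<lambda>x. - (z * q ^ fst x)" "\<lambda>_. 1"] by (simp add: f_def)
    also have "\<dots> = (\<Prod>j<N. \<Prod>c\<in>{1..k}. 1 - z * q ^ j)"
      by (subst prod.cartesian_product) (auto intro!: prod.cong)
    also have "\<dots> = (\<Prod>j<N. 1 - z * q ^ j) ^ k"
      by (simp add: prod_power_distrib)
    finally show "(\<Prod>j<N. 1 - z * q ^ j) ^ k = sum (f q z) (Pow ({..<N} \<times> {1..k}))" ..
  qed simp
  define r where "r = complex_of_real (norm q)"
  define y where "y = - complex_of_real (norm z)"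
  have r: "norm r < 1" using q by (simp add: r_def)
  have lim: "(\<lambda>N. (\<Prod>j<N. 1 - z * q ^ j) ^ k) \<longlonglongrightarrow> qpoch_inf z q ^ k" if "norm q < 1" for q z
    by (intro tendsto_power qpoch_inf_LIMSEQ that)
  obtain C where C: "\<And>N. norm ((\<Prod>j<N. 1 - y * r ^ j) ^ k) \<le> C"
    using convergent_imp_Bseq[OF convergentI[OF lim[OF r, of y]]] by (auto simp: Bseq_def)
  have "(f q z has_sum qpoch_inf z q ^ k) {S. finite S \<and> S \<subseteq> UNIV \<times> {1..k}}"
  proof (rule has_sum_incseq[where B = "\<lambda>N. Pow ({..<N} \<times> {1..k})" and t = "\<lambda>N. Re ((\<Prod>j<N. 1 - y * r ^ j) ^ k)"])
    show "incseq (\<lambda>N. Pow ({..<N::nat} \<times> {1..k}))"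
      by (intro incseq_SucI Pow_mono) auto
    show "(\<Union>N. Pow ({..<N::nat} \<times> {1..k})) = {S. finite S \<and> S \<subseteq> UNIV \<times> {1..k}}"
    proof (intro equalityI subsetI)
      fix S assume S: "S \<in> {S. finite S \<and> S \<subseteq> (UNIV :: nat set) \<times> {1..k}}"
      then have mx: "fst x \<le> Max (fst ` S)" if "x \<in> S" for x
        using that by (intro Max_ge) auto
      have "S \<subseteq> {..<Suc (Max (fst ` S))} \<times> {1..k}"
      proof
        fix x assume x: "x \<in> S"
        then have "x \<in> UNIV \<times> {1..k}" using S by blast
        then show "x \<in> {..<Suc (Max (fst ` S))} \<times> {1..k}"
          using mx[OF x] by (simp add: mem_Times_iff less_Suc_eq_le)
      qed
      then show "S \<in> (\<Union>N. Pow ({..<N::nat} \<times> {1..k}))" by blast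
    qed (auto intro: finite_subset)
    show "(f q z has_sum (\<Prod>j<N. 1 - z * q ^ j) ^ k) (Pow ({..<N} \<times> {1..k}))" for N by (rule fin)
    show "(\<lambda>N. (\<Prod>j<N. 1 - z * q ^ j) ^ k) \<longlonglongrightarrow> qpoch_inf z q ^ k" by (rule lim[OF q])
    have "Re (f r y S) = norm (f q z S)" for S
    proof -
      have "f r y S = complex_of_real (\<Prod>x\<in>S. norm z * norm q ^ fst x)"
        by (simp add: f_def r_def y_def)
      then have "Re (f r y S) = (\<Prod>x\<in>S. norm z * norm q ^ fst x)"
        by (simp only: Re_complex_of_real)
      then show ?thesis by (simp add: f_def prod_norm[symmetric] norm_mult norm_power)
    qed
    then show "((\<lambda>S. norm (f q z S)) has_sum Re ((\<Prod>j<N. 1 - y * r ^ j) ^ k)) (Pow ({..<N} \<times> {1..k}))" for N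
      using has_sum_Re[OF fin[of r y N]] by simp
    show "Re ((\<Prod>j<N. 1 - y * r ^ j) ^ k) \<le> C" for N
      using C[of N] complex_Re_le_cmod order_trans by blast
  qed
  then have "((\<lambda>r. f q z (set r)) has_sum qpoch_inf z q ^ k) {r. gen_frobenius_row k r}"
    using has_sum_reindex_bij_betw[OF bij_betw_rows, of "f q z"] by simp
  moreover have "f q z (set s) = (- z) ^ length s * q ^ (\<Sum>x\<leftarrow>s. fst x)" if "s \<in> {r. gen_frobenius_row k r}" for s
  proof -
    have "f q z (set s) = (\<Prod>x\<leftarrow>s. - (z * q ^ fst x))"
      using that row_distinct[of k s] by (simp add: f_def prod.distinct_set_conv_list)
    also have "\<dots> = (- z) ^ length s * q ^ (\<Sum>x\<leftarrow>s. fst x)"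
      by (induction s) (auto simp: power_add)
    finally show ?thesis .
  qed
  ultimately show ?thesis by (rule has_sum_cong[THEN iffD1, rotated])
qed

text \<open>Averaging z^(-k) times the series over the N-th roots of unity leaves the coefficients
  at indices congruent to k modulo N. For suitable N all of these except the k-th lie outside a
  finite set whose complement carries at most half of |a k|.\<close>

lemma laurent_unique:
  fixes a :: "int \<Rightarrow> complex"
  assumes "\<And>z. z \<noteq> 0 \<Longrightarrow> ((\<lambda>n. a n * z powi n) has_sum 0) UNIV"
  shows "a k = 0"
proof (rule ccontr)
  assume ak: "a k \<noteq> 0"
  have "a summable_on UNIV"
    using has_sum_imp_summable[OF assms[of 1]] by simp
  then have sm: "(\<lambda>n. norm (a n)) summable_on UNIV"
    by (simp add: summable_on_iff_abs_summable_on_complex)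
  obtain F where F: "finite F" "dist (\<Sum>n\<in>F. norm (a n)) (infsum (\<lambda>n. norm (a n)) UNIV) \<le> norm (a k) / 2"
    using infsum_finite_approximation[OF sm, of "norm (a k) / 2"] ak by auto
  \<comment> \<open>Larger than the distance from k to any index in \<open>F\<close>, so that no
    other index of \<open>F\<close> is congruent to k modulo \<open>N\<close>.\<close>
  define N where "N = nat (\<Sum>n\<in>F. \<bar>n - k\<bar>) + 1"
  have N: "N > 0" by (simp add: N_def)
  have small: "n = k" if "n \<in> F" "int N dvd n - k" for n
  proof -
    have "\<bar>n - k\<bar> \<le> (\<Sum>n\<in>F. \<bar>n - k\<bar>)"
      using F(1) that(1) by (intro member_le_sum) auto
    then have "\<bar>n - k\<bar> < int N" by (simp add: N_def)
    then show ?thesis using that(2) dvd_imp_le_int[of "n - k" "int N"] by force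
  qed
  define w where "w = exp (2 * of_real pi * \<i> / of_nat N)"
  have w0: "w \<noteq> 0" by (simp add: w_def)
  have rt: "(\<Sum>j<N. (w ^ j) powi m) = (if int N dvd m then of_nat N else 0)" for m
  proof -
    have e: "(w ^ j) powi m = (w powi m) ^ j" for j
      using power_int_mult[of w "int j" m] power_int_mult[of w m "int j"] by (simp add: mult.commute)
    have wm: "w powi m = exp (2 * of_real pi * \<i> * of_int m / of_nat N)"
      unfolding w_def exp_power_int by (simp add: mult_ac)
    have one: "w powi m = 1 \<longleftrightarrow> int N dvd m"
    proof
      assume "w powi m = 1"
      then obtain n :: int where "2 * pi * of_int m / real N = of_int (2 * n) * pi"
        by (auto simp: wm exp_eq_1)
      then have "of_int m = (of_int (n * int N) :: real)" using N by (simp add: field_simps)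
      then show "int N dvd m" by (simp only: of_int_eq_iff) simp
    next
      assume "int N dvd m"
      then obtain c where c: "m = int N * c" by blast
      have "w ^ N = 1" using N by (simp add: w_def exp_of_nat_mult[symmetric])
      then show "w powi m = 1" unfolding c using power_int_mult[of w "int N" c] by simp
    qed
    have "(w powi m) ^ N = 1"
    proof -
      have "w ^ N = 1" using N by (simp add: w_def exp_of_nat_mult[symmetric])
      then show ?thesis using e[of N] by simp
    qed
    then show ?thesis
      unfolding e using one by (auto simp: geometric_sum)
  qed
  have "((\<lambda>n. \<Sum>j<N. (w ^ j) powi (- k) * (a n * (w ^ j) powi n)) has_sum (\<Sum>j<N. (w ^ j) powi (- k) * 0)) UNIV"
    using w0 by (intro has_sum_sum has_sum_cmult_right assms) auto
  also have "(\<lambda>n. \<Sum>j<N. (w ^ j) powi (- k) * (a n * (w ^ j) powi n)) = (\<lambda>n. of_nat N * (if int N dvd n - k then a n else 0))"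
  proof
    fix n
    have "(w ^ j) powi (- k) * (a n * (w ^ j) powi n) = a n * (w ^ j) powi (n - k)" for j
      using w0 by (simp add: power_int_diff power_int_minus divide_inverse)
    then show "(\<Sum>j<N. (w ^ j) powi (- k) * (a n * (w ^ j) powi n)) = of_nat N * (if int N dvd n - k then a n else 0)"
      by (simp only: sum_distrib_left[symmetric] rt) simp
  qed
  finally have "((\<lambda>n. of_nat N * (if int N dvd n - k then a n else 0)) has_sum 0) UNIV" by simp
  from has_sum_cmult_right[OF this, of "1 / of_nat N"]
  have "((\<lambda>n. if int N dvd n - k then a n else 0) has_sum 0) UNIV"
    using N by (simp add: mult.assoc[symmetric] del: mult.assoc)
  then have z: "((\<lambda>n. if int N dvd n - k then a n else 0) has_sum 0) (insert k (UNIV - {k}))"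
    by (simp add: insert_absorb)
  define R where "R = infsum (\<lambda>n. if int N dvd n - k then a n else 0) (UNIV - {k})"
  have sb: "(\<lambda>n. if int N dvd n - k then a n else 0) summable_on B" for B
    by (rule summable_on_norm_bound[OF summable_on_subset_banach[OF sm, of B]]) auto
  have "((\<lambda>n. if int N dvd n - k then a n else 0) has_sum (a k + R)) (insert k (UNIV - {k}))"
    unfolding R_def using has_sum_insert[of k "UNIV - {k}" "\<lambda>n. if int N dvd n - k then a n else 0"] sb by simp
  then have "a k = - R" using has_sum_unique[OF z] by (simp add: eq_neg_iff_add_eq_0)
  then have "norm (a k) = norm R" by simp
  also have "R = infsum (\<lambda>n. if int N dvd n - k then a n else 0) (UNIV - F - {k})"
    unfolding R_def using small by (intro infsum_cong_neutral) auto
  also have "norm \<dots> \<le> infsum (\<lambda>n. norm (a n)) (UNIV - F - {k})"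
    by (rule norm_infsum_le[OF has_sum_infsum has_sum_infsum]) (auto intro!: sb summable_on_subset_banach[OF sm])
  also have "\<dots> \<le> infsum (\<lambda>n. norm (a n)) (UNIV - F)"
    by (rule infsum_mono2) (auto intro!: summable_on_subset_banach[OF sm])
  also have "\<dots> = infsum (\<lambda>n. norm (a n)) UNIV - (\<Sum>n\<in>F. norm (a n))"
    using infsum_Un_disjoint[of "\<lambda>n. norm (a n)" F "UNIV - F"] F(1) summable_on_subset_banach[OF sm, of "UNIV - F"] by simp
  also have "\<dots> \<le> norm (a k) / 2"
    using F(2) by (simp only: dist_norm real_norm_def abs_le_iff) linarith
  finally show False using ak by simp
qed

text \<open>The coefficient of z^m in (theta/E)^7. First rows come from (z;q)^7 and second rows from
  (q/z;q)^7, so every entry of the second row brings an extra q. At m = 0 the rows have equal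
  length, the signs cancel and the exponent is the size of the symbol.\<close>

definition frob_coeff :: "complex \<Rightarrow> int \<Rightarrow> complex" where
  "frob_coeff q m = (\<Sum>\<^sub>\<infinity>(r, s)\<in>{(r, s). gen_frobenius_row 7 r \<and> gen_frobenius_row 7 s \<and> int (length r) - int (length s) = m}.
     (- 1) ^ (length r + length s) * q ^ (length s + (\<Sum>x\<leftarrow>r. fst x) + (\<Sum>x\<leftarrow>s. fst x)))"

context
  fixes q :: complex
  assumes q: "norm q < 1" "q \<noteq> 0"
begin

lemma theta_power_pairs:
  assumes z: "z \<noteq> 0"
  shows "((\<lambda>(r, s). (- 1) ^ (length r + length s) * q ^ (length s + (\<Sum>x\<leftarrow>r. fst x) + (\<Sum>x\<leftarrow>s. fst x)) *
      z powi (int (length r) - int (length s))) has_sum (theta q z / euler q) ^ 7)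
      ({r. gen_frobenius_row 7 r} \<times> {s. gen_frobenius_row 7 s})"
proof -
  have "((\<lambda>(r, s). ((- z) ^ length r * q ^ (\<Sum>x\<leftarrow>r. fst x)) * ((- (q / z)) ^ length s * q ^ (\<Sum>x\<leftarrow>s. fst x))) has_sum
     qpoch_inf z q ^ 7 * qpoch_inf (q / z) q ^ 7) ({r. gen_frobenius_row 7 r} \<times> {s. gen_frobenius_row 7 s})"
    by (intro has_sum_mult_Times row_generating_function q)
  moreover have "qpoch_inf z q ^ 7 * qpoch_inf (q / z) q ^ 7 = (theta q z / euler q) ^ 7"
    using qpoch_inf_self_nonzero[OF q(1)] by (simp add: theta_def power_mult_distrib)
  moreover have "((- z) ^ l * q ^ a) * ((- (q / z)) ^ m * q ^ b) = (- 1) ^ (l + m) * q ^ (m + a + b) * z powi (int l - int m)" for l m a b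
  proof -
    have "(- z) ^ l = (- 1) ^ l * z ^ l" "(- (q / z)) ^ m = (- 1) ^ m * (q ^ m / z ^ m)"
      by (simp_all add: power_minus[of z] power_minus[of "q / z"] power_divide)
    then show ?thesis using z by (simp add: power_add power_int_diff mult_ac)
  qed
  ultimately show ?thesis by (simp only:)
qed

lemma theta_power_laurent:
  assumes z: "z \<noteq> 0"
  shows "((\<lambda>m. frob_coeff q m * z powi m) has_sum (theta q z / euler q) ^ 7) UNIV"
proof -
  define R where "R = {r. gen_frobenius_row 7 r}"
  define g where "g = (\<lambda>x :: colored_nat list \<times> colored_nat list. (- 1) ^ (length (fst x) + length (snd x)) *
      q ^ (length (snd x) + (\<Sum>x\<leftarrow>fst x. fst x) + (\<Sum>x\<leftarrow>snd x. fst x)) :: complex)"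
  define B where "B = (\<lambda>m. {(r, s). gen_frobenius_row 7 r \<and> gen_frobenius_row 7 s \<and> int (length r) - int (length s) = m})"
  have H: "((\<lambda>x. g x * z powi (int (length (fst x)) - int (length (snd x)))) has_sum (theta q z / euler q) ^ 7) (R \<times> R)"
    if "z \<noteq> 0" for z
    using theta_power_pairs[OF that] by (simp add: g_def R_def case_prod_unfold)
  have g: "g summable_on R \<times> R"
    using has_sum_imp_summable[OF H[of 1]] by simp
  have "bij_betw snd (SIGMA m:UNIV. B m) (R \<times> R)"
    by (rule bij_betwI[where g = "\<lambda>x. (int (length (fst x)) - int (length (snd x)), x)"]) (auto simp: B_def R_def)
  from has_sum_reindex_bij_betw[OF this, of "\<lambda>x. g x * z powi (int (length (fst x)) - int (length (snd x)))"] H[OF z]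
  have S: "((\<lambda>y. g (snd y) * z powi (int (length (fst (snd y))) - int (length (snd (snd y))))) has_sum (theta q z / euler q) ^ 7) (SIGMA m:UNIV. B m)"
    by simp
  have fc: "(g has_sum frob_coeff q m) (B m)" for m
  proof -
    have "g summable_on B m"
      by (rule summable_on_subset_banach[OF g]) (auto simp: B_def R_def)
    moreover have "frob_coeff q m = infsum g (B m)"
      unfolding frob_coeff_def B_def by (intro infsum_cong) (auto simp: g_def)
    ultimately show ?thesis by simp
  qed
  from S show ?thesis
  proof (rule has_sum_SigmaD)
    fix m
    show "((\<lambda>x. g (snd (m, x)) * z powi (int (length (fst (snd (m, x)))) - int (length (snd (snd (m, x)))))) has_sum
        frob_coeff q m * z powi m) (B m)"
      using has_sum_cmult_left[OF fc[of m], of "z powi m"]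
      by (rule has_sum_cong[THEN iffD1, rotated]) (auto simp: B_def)
  qed
qed

text \<open>The seventh power of theta(qz) = -theta(z)/z, compared coefficient by coefficient
  through \<open>laurent_unique\<close>.\<close>

lemma frob_coeff_shift: "frob_coeff q (m + 7) = - (q powi m) * frob_coeff q m"
proof -
  define a where "a = (\<lambda>m. frob_coeff q m * q powi m + frob_coeff q (m + 7))"
  have "a m = 0"
  proof (rule laurent_unique)
    fix z :: complex assume z: "z \<noteq> 0"
    define t where "t = (theta q z / euler q) ^ 7"
    have "((\<lambda>m. frob_coeff q m * (q * z) powi m) has_sum (theta q (q * z) / euler q) ^ 7) UNIV"
      using q z by (intro theta_power_laurent) auto
    moreover have "(theta q (q * z) / euler q) ^ 7 = - (t / z ^ 7)"
      unfolding theta_shift[OF q(1) z q(2)] t_def by (simp add: power_divide power_mult_distrib mult.commute)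
    ultimately have 1: "((\<lambda>m. frob_coeff q m * (q * z) powi m) has_sum - (t / z ^ 7)) UNIV"
      by simp
    have "((\<lambda>m. frob_coeff q (m + 7) * z powi (m + 7)) has_sum t) UNIV"
      using theta_power_laurent[OF z] has_sum_int_shift[of "\<lambda>m. frob_coeff q m * z powi m" 7] by (simp add: t_def)
    then have 2: "((\<lambda>m. frob_coeff q (m + 7) * z powi (m + 7) / z ^ 7) has_sum t / z ^ 7) UNIV"
      by (rule has_sum_divide_const)
    have "frob_coeff q m * (q * z) powi m + frob_coeff q (m + 7) * z powi (m + 7) / z ^ 7 = a m * z powi m" for m
      using z by (simp add: a_def power_int_add power_int_mult_distrib algebra_simps)
    then show "((\<lambda>n. a n * z powi n) has_sum 0) UNIV"
      using has_sum_add[OF 1 2] by simp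
  qed
  then show ?thesis by (simp add: a_def add_eq_0_iff)
qed

text \<open>Along the multiples of 7 the recursion coincides with that of
  \<open>theta_coeff (q ^ 7)\<close>, so the coefficient at 0 determines all of them.\<close>

lemma frob_coeff_multiple: "frob_coeff q (7 * n) = theta_coeff (q ^ 7) n * frob_coeff q 0"
proof -
  have q7: "q ^ 7 \<noteq> 0" using q(2) by simp
  have pw: "(q ^ 7) powi n = q powi (7 * n)" for n
    using power_int_mult[of q 7 n] by simp
  have step: "frob_coeff q (7 * (n + 1)) = theta_coeff (q ^ 7) (n + 1) * frob_coeff q 0 \<longleftrightarrow>
      frob_coeff q (7 * n) = theta_coeff (q ^ 7) n * frob_coeff q 0" for n
  proof -
    have "frob_coeff q (7 * (n + 1)) = - (q powi (7 * n)) * frob_coeff q (7 * n)"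
      using frob_coeff_shift[of "7 * n"] by (simp add: algebra_simps)
    then show ?thesis
      unfolding theta_coeff_Suc[OF q7] pw using q(2) by simp
  qed
  show ?thesis
  proof (induction n rule: int_induct[where k = 0])
    case base
    then show ?case by (simp add: theta_coeff_def)
  next
    case (step1 i)
    then show ?case using step[of i] by simp
  next
    case (step2 i)
    then show ?case using step[of "i - 1"] by simp
  qed
qed

lemma CPhi_frob_coeff:
  "((\<lambda>n. of_nat (cphi 7 n) * q ^ n) has_sum frob_coeff q 0) UNIV"
proof -
  have R: "gen_frobenius_symbols 7 = {(r, s). gen_frobenius_row 7 r \<and> gen_frobenius_row 7 s \<and> int (length r) - int (length s) = 0}"
    by (auto simp: gen_frobenius_symbols_def)
  have e: "(- 1) ^ (length (fst F) + length (snd F)) * q ^ (length (snd F) + (\<Sum>x\<leftarrow>fst F. fst x) + (\<Sum>x\<leftarrow>snd F. fst x)) = q ^ gen_frobenius_size F"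
    if "F \<in> gen_frobenius_symbols 7" for F :: "colored_nat list \<times> colored_nat list"
    using that by (auto simp: gen_frobenius_symbols_def gen_frobenius_size_def mult_2[symmetric] power_mult)
  have "(\<lambda>(r, s). (- 1) ^ (length r + length s) * q ^ (length s + (\<Sum>x\<leftarrow>r. fst x) + (\<Sum>x\<leftarrow>s. fst x)))
      summable_on ({r. gen_frobenius_row 7 r} \<times> {s. gen_frobenius_row 7 s})"
    using has_sum_imp_summable[OF theta_power_pairs[of 1]] by simp
  then have "(\<lambda>F. (- 1) ^ (length (fst F) + length (snd F)) * q ^ (length (snd F) + (\<Sum>x\<leftarrow>fst F. fst x) + (\<Sum>x\<leftarrow>snd F. fst x)))
      summable_on gen_frobenius_symbols 7"
    by (subst (asm) case_prod_unfold, elim summable_on_subset_banach) (auto simp: gen_frobenius_symbols_def)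
  then have "((\<lambda>F. (- 1) ^ (length (fst F) + length (snd F)) * q ^ (length (snd F) + (\<Sum>x\<leftarrow>fst F. fst x) + (\<Sum>x\<leftarrow>snd F. fst x)))
      has_sum frob_coeff q 0) (gen_frobenius_symbols 7)"
    unfolding frob_coeff_def R case_prod_unfold by simp
  then have "((\<lambda>F. q ^ gen_frobenius_size F) has_sum frob_coeff q 0) (gen_frobenius_symbols 7)"
    by (rule has_sum_cong[THEN iffD1, rotated]) (rule e)
  moreover have "bij_betw snd (SIGMA n:UNIV. {F \<in> gen_frobenius_symbols 7. gen_frobenius_size F = n}) (gen_frobenius_symbols 7)"
    by (rule bij_betwI[where g = "\<lambda>F. (gen_frobenius_size F, F)"]) auto
  ultimately have "((\<lambda>x. q ^ gen_frobenius_size (snd x)) has_sum frob_coeff q 0)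
      (SIGMA n:UNIV. {F \<in> gen_frobenius_symbols 7. gen_frobenius_size F = n})"
    using has_sum_reindex_bij_betw[of snd _ _ "\<lambda>F. q ^ gen_frobenius_size F"] by blast
  then show ?thesis
  proof (rule has_sum_SigmaD)
    fix n
    show "((\<lambda>F. q ^ gen_frobenius_size (snd (n, F))) has_sum of_nat (cphi 7 n) * q ^ n)
        {F \<in> gen_frobenius_symbols 7. gen_frobenius_size F = n}"
      by (rule has_sum_finiteI[OF finite_gen_frobenius_partitions]) (simp add: cphi_def)
  qed
qed

text \<open>The sum over the roots of unity keeps the exponents 7n, whose coefficients are the
  constant term times those of theta for the nome q^7.\<close>

lemma theta_power_average:
  assumes z: "z \<noteq> 0"
  shows "(\<Sum>j<7. theta q (zeta7 ^ j * z) ^ 7) = 7 * euler q ^ 7 * frob_coeff q 0 * theta (q ^ 7) (z ^ 7)"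
proof -
  define E where "E = euler q"
  have E0: "E \<noteq> 0" using qpoch_inf_self_nonzero[OF q(1)] by (simp add: E_def)
  have "((\<lambda>m. \<Sum>j<7. frob_coeff q m * (zeta7 ^ j * z) powi m) has_sum (\<Sum>j<7. (theta q (zeta7 ^ j * z) / E) ^ 7)) UNIV"
    unfolding E_def using z z7.w0 by (intro has_sum_sum theta_power_laurent) auto
  also have "(\<lambda>m. \<Sum>j<7. frob_coeff q m * (zeta7 ^ j * z) powi m) = (\<lambda>m. if 7 dvd m then 7 * frob_coeff q m * z powi m else 0)"
  proof
    fix m
    have "(\<Sum>j<7. (zeta7 ^ j) powi m) = (if 7 dvd m then 7 else 0)"
    proof -
      have "(zeta7 ^ j) powi m = (zeta7 ^ j) ^ nat (m mod 7)" for j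
      proof -
        have "(zeta7 ^ j) ^ 7 = (zeta7 ^ 7) ^ j" by (simp only: power_mult[symmetric] mult.commute)
        then have 1: "(zeta7 ^ j) ^ 7 = 1" using z7.w7 by simp
        have "(zeta7 ^ j) powi (7 * (m div 7) + m mod 7) = (zeta7 ^ j) powi (m mod 7)"
          using z7.w0 by (subst power_int_add) (simp_all add: power_int_mult 1)
        then have "(zeta7 ^ j) powi m = (zeta7 ^ j) powi (m mod 7)" by simp
        then show ?thesis by (simp add: power_int_def)
      qed
      then have "(\<Sum>j<7. (zeta7 ^ j) powi m) = (if 7 dvd nat (m mod 7) then 7 else 0)"
        using z7.sum_roots[of "nat (m mod 7)"] by simp
      moreover have "7 dvd nat (m mod 7) \<longleftrightarrow> 7 dvd m"
      proof -
        have "nat (m mod 7) < 7" by (simp add: nat_less_iff)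
        then have "7 dvd nat (m mod 7) \<longleftrightarrow> nat (m mod 7) = 0"
          by (metis dvd_0_right nat_dvd_not_less neq0_conv)
        also have "\<dots> \<longleftrightarrow> m mod 7 = 0" using pos_mod_sign[of 7 m] by auto
        finally show ?thesis by (simp add: dvd_eq_mod_eq_0)
      qed
      ultimately show ?thesis by simp
    qed
    then show "(\<Sum>j<7. frob_coeff q m * (zeta7 ^ j * z) powi m) = (if 7 dvd m then 7 * frob_coeff q m * z powi m else 0)"
      by (simp add: power_int_mult_distrib sum_distrib_left[symmetric] sum_distrib_right[symmetric])
  qed
  finally have "((\<lambda>m. 7 * frob_coeff q m * z powi m) has_sum (\<Sum>j<7. (theta q (zeta7 ^ j * z) / E) ^ 7)) {m. 7 dvd m}"
    by (rule has_sum_cong_neutral[THEN iffD1, rotated -1]) auto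
  moreover have "bij_betw (\<lambda>n. 7 * n) UNIV {m :: int. 7 dvd m}"
    by (rule bij_betwI[where g = "\<lambda>m. m div 7"]) auto
  ultimately have "((\<lambda>n. 7 * frob_coeff q (7 * n) * z powi (7 * n)) has_sum (\<Sum>j<7. (theta q (zeta7 ^ j * z) / E) ^ 7)) UNIV"
    using has_sum_reindex_bij_betw[of "\<lambda>n. 7 * n" UNIV "{m :: int. 7 dvd m}" "\<lambda>m. 7 * frob_coeff q m * z powi m"] by blast
  moreover have "7 * frob_coeff q (7 * n) * z powi (7 * n) = 7 * frob_coeff q 0 * (theta_coeff (q ^ 7) n * (z ^ 7) powi n)" for n
    unfolding frob_coeff_multiple using power_int_mult[of z 7 n] by simp
  moreover have "((\<lambda>n. 7 * frob_coeff q 0 * (theta_coeff (q ^ 7) n * (z ^ 7) powi n)) has_sum (7 * frob_coeff q 0 * theta (q ^ 7) (z ^ 7))) UNIV"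
    using q z by (intro has_sum_cmult_right jacobi_triple_product norm_power_less_1) auto
  ultimately have "(\<Sum>j<7. (theta q (zeta7 ^ j * z) / E) ^ 7) = 7 * frob_coeff q 0 * theta (q ^ 7) (z ^ 7)"
    using has_sum_unique by (simp only:) blast
  then have "(\<Sum>j<7. theta q (zeta7 ^ j * z) ^ 7) / E ^ 7 = 7 * frob_coeff q 0 * theta (q ^ 7) (z ^ 7)"
    by (simp add: power_divide sum_divide_distrib)
  then show ?thesis using E0 by (simp add: E_def divide_eq_eq mult_ac)
qed

end

section \<open>The constant term\<close>

context
  fixes q :: complex
  assumes q: "norm q < 1" "q \<noteq> 0"
begin

interpretation weierstrass_function "weier q" "deriv (weier q)" "(deriv ^^ 2) (weier q)" "(deriv ^^ 3) (weier q)"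
  by (rule weier_weierstrass_function[OF q])

text \<open>The additive form of \<open>theta_power_average\<close>. The sign appears because the
  seventh power of the half exponential changes by exp(7 v7 / 2) = -1 at each step.\<close>

lemma weier_power_average:
  "(\<Sum>j<7. (- 1) ^ j * weier q (u + of_nat j * v7) ^ 7) = 7 * euler q ^ 7 * frob_coeff q 0 * weier (q ^ 7) (7 * u)"
proof -
  have v: "exp (7 * v7 / 2) = - 1"
    using exp_v7(2) exp_minus[of "7 * v7 / 2"] by (simp add: inverse_eq_iff_eq[of _ "- 1", simplified])
  have p7: "exp (x / 2) ^ 7 = exp (7 * x / 2)" for x :: complex
    using exp_of_nat_mult[of 7 "x / 2"] by simp
  have "theta q (zeta7 ^ j * exp u) ^ 7 = exp (7 * u / 2) * ((- 1) ^ j * weier q (u + of_nat j * v7) ^ 7)" for j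
  proof -
    have "zeta7 ^ j * exp u = exp (u + of_nat j * v7)"
      by (simp add: zeta7_def exp_of_nat_mult exp_add)
    then have "theta q (zeta7 ^ j * exp u) ^ 7 = exp (7 * (u + of_nat j * v7) / 2) * weier q (u + of_nat j * v7) ^ 7"
      by (simp add: theta_exp power_mult_distrib p7)
    also have "exp (7 * (u + of_nat j * v7) / 2) = exp (7 * u / 2 + of_nat j * (7 * v7 / 2))"
      by (rule arg_cong[of _ _ exp]) (simp add: field_simps)
    also have "\<dots> = exp (7 * u / 2) * (- 1) ^ j"
      unfolding exp_add exp_of_nat_mult v ..
    finally show ?thesis by simp
  qed
  then have "exp (7 * u / 2) * (\<Sum>j<7. (- 1) ^ j * weier q (u + of_nat j * v7) ^ 7) =
      7 * euler q ^ 7 * frob_coeff q 0 * theta (q ^ 7) (exp u ^ 7)"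
    using theta_power_average[OF q, of "exp u"] by (simp add: sum_distrib_left)
  also have "theta (q ^ 7) (exp u ^ 7) = exp (7 * u / 2) * weier (q ^ 7) (7 * u)"
    using theta_exp[of "q ^ 7" "7 * u"] exp_of_nat_mult[of 7 u] by simp
  finally have "exp (7 * u / 2) * (\<Sum>j<7. (- 1) ^ j * weier q (u + of_nat j * v7) ^ 7) =
      exp (7 * u / 2) * (7 * euler q ^ 7 * frob_coeff q 0 * weier (q ^ 7) (7 * u))"
    by (simp only: mult_ac)
  then show ?thesis by simp
qed

lemma weier_reflect: "weier q (7 * v7 - u) = weier q u" "deriv (weier q) (7 * v7 - u) = - deriv (weier q) u"
proof -
  show *: "weier q (7 * v7 - u) = weier q u" for u
    using weier_periodic[OF q, of "- u"] odd[of u] by (simp add: add.commute)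
  have "((\<lambda>u. weier q (7 * v7 - u)) has_field_derivative - deriv (weier q) (7 * v7 - u)) (at u)"
    by (auto intro!: derivative_eq_intros)
  then have "- deriv (weier q) (7 * v7 - u) = deriv (weier q) u"
    unfolding * using DERIV_unique[OF deriv_W] by metis
  then show "deriv (weier q) (7 * v7 - u) = - deriv (weier q) u"
    by (metis minus_minus)
qed

text \<open>The case c = 0, d = 2b of \<open>zeta_relation\<close>. It links the logarithmic
  derivatives at b and 3b; among points of order 7, up to sign, tripling again permutes the
  multiples 1, 2, 4.\<close>

lemma weier_triple:
  "euler q ^ 3 * weier q (2 * b) ^ 3 =
   weier q b ^ 2 * (deriv (weier q) (3 * b) * weier q b - 3 * deriv (weier q) b * weier q (3 * b))"
proof -
  define w2 where "w2 = weier q (2 * b)"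
  define w3 where "w3 = weier q (3 * b)"
  define d3 where "d3 = deriv (weier q) (3 * b)"
  define w where "w = weier q b"
  define d where "d = deriv (weier q) b"
  have i: "b + 0 = b" "b - 0 = b" "0 + 2 * b = 2 * b" "0 - 2 * b = - (2 * b)" "b + 2 * b = 3 * b" "b - 2 * b = - b"
    by simp_all
  have "- (euler q ^ 3) * w2 * (w2 * - w2) = (d * w + w * d) * (w3 * - w) - (d3 * - w + w3 * d) * (w * w)"
    using zeta_relation[of b 0 "2 * b"]
    unfolding i odd W1_even deriv_weier_0[OF q(1)] w2_def w3_def d3_def w_def d_def .
  then have "euler q ^ 3 * w2 ^ 3 = (d * w + w * d) * (w3 * - w) - (d3 * - w + w3 * d) * (w * w)"
    by (simp add: power3_eq_cube mult.assoc)
  also have "\<dots> = w ^ 2 * (d3 * w - 3 * d * w3)"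
    by (simp add: algebra_simps power2_eq_square)
  finally show ?thesis by (simp only: w2_def w3_def d3_def w_def d_def)
qed

text \<open>The derivative of the averaged seventh powers at 0 expresses the constant term through
  W^7 times logarithmic derivatives at the points of order 7. The latter follow from
  \<open>weier_triple\<close>, and \<open>klein_theta_sum\<close> turns the result into a polynomial
  in T.\<close>

lemma frob_coeff_0:
  "frob_coeff q 0 = 1 / euler (q ^ 7) + 49 * q * (euler (q ^ 7) ^ 3 / euler q ^ 4)
     + 343 * q ^ 2 * (euler (q ^ 7) ^ 7 / euler q ^ 8)"
proof -
  define E where "E = euler q"
  define E7 where "E7 = euler (q ^ 7)"
  define C where "C = frob_coeff q 0"
  define W where "W = (\<lambda>j::nat. weier q (of_nat j * v7))"
  define D where "D = (\<lambda>j::nat. deriv (weier q) (of_nat j * v7))"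
  have q7: "norm (q ^ 7) < 1" using norm_power_less_1[OF q(1), of 7] by simp
  have E0: "E \<noteq> 0" "E7 \<noteq> 0"
    using qpoch_inf_self_nonzero[OF q(1)] qpoch_inf_self_nonzero[OF q7] by (simp_all add: E_def E7_def)
  have refl: "W 3 = W 4" "W 5 = W 2" "W 6 = W 1" "D 3 = - D 4" "D 5 = - D 2" "D 6 = - D 1"
    using weier_reflect[of "4 * v7"] weier_reflect[of "2 * v7"] weier_reflect[of v7] by (simp_all add: W_def D_def)
  have per: "weier q (u + 7 * v7) = - weier q u" "deriv (weier q) (u + 7 * v7) = - deriv (weier q) u" for u
  proof -
    show *: "weier q (u + 7 * v7) = - weier q u" for u by (rule weier_periodic[OF q])
    have "((\<lambda>u. - weier q (u + 7 * v7)) has_field_derivative - deriv (weier q) (u + 7 * v7)) (at u)"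
      by (auto intro!: derivative_eq_intros)
    then have "- deriv (weier q) (u + 7 * v7) = deriv (weier q) u"
      unfolding * minus_minus using DERIV_unique[OF deriv_W] by metis
    then show "deriv (weier q) (u + 7 * v7) = - deriv (weier q) u" by (metis minus_minus)
  qed
  have W0: "W 1 \<noteq> 0" "W 2 \<noteq> 0" "W 4 \<noteq> 0"
    using weier_zeta7_nonzero[OF q, of 1] weier_zeta7_nonzero[OF q, of 2] weier_zeta7_nonzero[OF q, of 4]
    by (simp_all add: W_def)
  \<comment> \<open>The summand j = 0 drops out since W vanishes there to order 7 after taking
    powers. The summands j and 7 - j agree, because the sign and the derivative both change sign
    under reflection; this doubles 7 to 14.\<close>
  have avg: "14 * (- (W 1 ^ 6 * D 1) + W 2 ^ 6 * D 2 + W 4 ^ 6 * D 4) = - 49 * E ^ 7 * C * E7 ^ 3"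
  proof -
    have "((\<lambda>u. \<Sum>j<7. (- 1) ^ j * weier q (u + of_nat j * v7) ^ 7) has_field_derivative
        (\<Sum>j<7. (- 1) ^ j * (7 * (W j ^ 6 * D j)))) (at 0)"
      by (auto intro!: derivative_eq_intros sum.cong simp: W_def D_def)
    moreover have "((\<lambda>u. weier (q ^ 7) (7 * u)) has_field_derivative - (E7 ^ 3) * 7) (at 0)"
      using weier_has_derivative_at_0[OF q7] unfolding E7_def
      by (intro DERIV_chain2[where g = "\<lambda>u. 7 * u"]) (auto intro!: derivative_eq_intros)
    then have "((\<lambda>u. 7 * E ^ 7 * C * weier (q ^ 7) (7 * u)) has_field_derivative 7 * E ^ 7 * C * (- (E7 ^ 3) * 7)) (at 0)"
      by (rule DERIV_cmult)
    ultimately have "(\<Sum>j<7. (- 1) ^ j * (7 * (W j ^ 6 * D j))) = 7 * E ^ 7 * C * (- (E7 ^ 3) * 7)"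
      unfolding weier_power_average E_def C_def by (rule DERIV_unique)
    moreover have "(\<Sum>j<7. (- 1) ^ j * (7 * (W j ^ 6 * D j))) = 14 * (- (W 1 ^ 6 * D 1) + W 2 ^ 6 * D 2 + W 4 ^ 6 * D 4)"
    proof -
      have U: "{..<7::nat} = {0, 1, 2, 3, 4, 5, 6}" by auto
      have "W 0 = 0" by (simp add: W_def)
      then show ?thesis unfolding U by (simp add: refl)
    qed
    ultimately show ?thesis by simp
  qed
  define x where "x = septic_zeta7 q 1"
  define y where "y = septic_zeta7 q 2"
  define z where "z = septic_zeta7 q 4"
  have xyz: "x = - W 1" "y = W 2" "z = W 4"
    by (simp_all add: x_def y_def z_def septic_def W_def)
  have n0: "x \<noteq> 0" "y \<noteq> 0" "z \<noteq> 0" using W0 by (simp_all add: xyz)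
  define l1 where "l1 = D 1 / W 1"
  define l2 where "l2 = D 2 / W 2"
  define l4 where "l4 = D 4 / W 4"
  have D: "D 1 = - (l1 * x)" "D 2 = l2 * y" "D 4 = l4 * z"
    using W0 by (simp_all add: l1_def l2_def l4_def xyz)
  define A1 where "A1 = y ^ 3 / (x ^ 3 * z)"
  define A2 where "A2 = z ^ 3 / (y ^ 3 * x)"
  define A4 where "A4 = x ^ 3 / (z ^ 3 * y)"
  have W: "W 1 = - x" "W 2 = y" "W 4 = z" by (simp_all add: xyz)
  have dv: "s = e * (a / c)" if "e * a = c * s" "c \<noteq> 0" for s e a c :: complex
  proof -
    have "e * a / c = s" unfolding that(1) using that(2) by simp
    then show ?thesis by simp
  qed
  have r1: "3 * l1 + l4 = E ^ 3 * A1"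
  proof -
    have "E ^ 3 * y ^ 3 = W 1 ^ 2 * (D 3 * W 1 - 3 * D 1 * W 3)"
      using weier_triple[of v7] by (simp add: W_def D_def E_def xyz)
    also have "\<dots> = x ^ 3 * z * (3 * l1 + l4)"
      unfolding refl D W by (simp add: algebra_simps power2_eq_square power3_eq_cube)
    finally show ?thesis unfolding A1_def by (rule dv) (use n0 in simp)
  qed
  have r2: "3 * l2 + l1 = E ^ 3 * A2"
  proof -
    have "E ^ 3 * z ^ 3 = W 2 ^ 2 * (D 6 * W 2 - 3 * D 2 * W 6)"
      using weier_triple[of "2 * v7"] by (simp add: W_def D_def E_def xyz)
    also have "\<dots> = y ^ 3 * x * (3 * l2 + l1)"
      unfolding refl D W by (simp add: algebra_simps power2_eq_square power3_eq_cube)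
    finally show ?thesis unfolding A2_def by (rule dv) (use n0 in simp)
  qed
  have r4: "3 * l4 + l2 = E ^ 3 * A4"
  proof -
    have "weier q (2 * (4 * v7)) = x"
      using per(1)[of v7] by (simp add: xyz W_def algebra_simps)
    moreover have "weier q (3 * (4 * v7)) = - y"
      using per(1)[of "5 * v7"] refl(2) by (simp add: xyz W_def algebra_simps)
    moreover have "deriv (weier q) (3 * (4 * v7)) = D 2"
      using per(2)[of "5 * v7"] refl(5) by (simp add: D_def algebra_simps)
    ultimately have "E ^ 3 * x ^ 3 = W 4 ^ 2 * (D 2 * W 4 + 3 * D 4 * y)"
      using weier_triple[of "4 * v7"] by (simp add: W_def D_def E_def)
    also have "\<dots> = z ^ 3 * y * (3 * l4 + l2)"
      unfolding D W by (simp add: algebra_simps power2_eq_square power3_eq_cube)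
    finally show ?thesis unfolding A4_def by (rule dv) (use n0 in simp)
  qed
  \<comment> \<open>The system 3 l1 + l4, 3 l2 + l1, 3 l4 + l2 is circulant of determinant 27 + 1 =
    28, and 9, 1, -3 are the entries of its adjugate.\<close>
  have l: "28 * l1 = E ^ 3 * (9 * A1 + A2 - 3 * A4)" "28 * l2 = E ^ 3 * (9 * A2 + A4 - 3 * A1)"
    "28 * l4 = E ^ 3 * (9 * A4 + A1 - 3 * A2)"
  proof -
    have "28 * l1 = 9 * (3 * l1 + l4) + (3 * l2 + l1) - 3 * (3 * l4 + l2)"
      "28 * l2 = 9 * (3 * l2 + l1) + (3 * l4 + l2) - 3 * (3 * l1 + l4)"
      "28 * l4 = 9 * (3 * l4 + l2) + (3 * l1 + l4) - 3 * (3 * l2 + l1)"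
      by simp_all
    then show "28 * l1 = E ^ 3 * (9 * A1 + A2 - 3 * A4)" "28 * l2 = E ^ 3 * (9 * A2 + A4 - 3 * A1)"
      "28 * l4 = E ^ 3 * (9 * A4 + A1 - 3 * A2)"
      unfolding r1 r2 r4 by (simp_all add: algebra_simps)
  qed
  define T where "T = septic_T q 0 v7"
  have klein: "x ^ 3 * y + y ^ 3 * z + z ^ 3 * x = 0"
    by (rule septic_relations(1)[OF q septic_zeta7_periodic[OF q] septic_zeta7_nonzero[OF q] x_def y_def z_def])
  have T: "T = - (y ^ 2 * z / x ^ 3 + z ^ 2 * x / y ^ 3 + x ^ 2 * y / z ^ 3)"
    by (simp add: T_def septic_T_def x_def y_def z_def)
  have P: "(x * y * z) ^ 2 = - 7 * E ^ 4 * E7 ^ 2"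
    unfolding x_def y_def z_def septic_zeta7_prod[OF q] E_def[symmetric] E7_def[symmetric]
    using z7.gauss_square by (simp add: power_mult_distrib power_mult[symmetric])
  have "28 * (14 * (- (W 1 ^ 6 * D 1) + W 2 ^ 6 * D 2 + W 4 ^ 6 * D 4)) =
      14 * (x ^ 7 * (28 * l1) + y ^ 7 * (28 * l2) + z ^ 7 * (28 * l4))"
    unfolding D W by (simp add: algebra_simps power_numeral_reduce)
  also have "\<dots> = 14 * E ^ 3 * (x ^ 7 * (9 * A1 + A2 - 3 * A4) + y ^ 7 * (9 * A2 + A4 - 3 * A1) + z ^ 7 * (9 * A4 + A1 - 3 * A2))"
    unfolding l by (simp add: algebra_simps)
  also have "\<dots> = 14 * E ^ 3 * (2 * (- 7 * E ^ 4 * E7 ^ 2) * (T ^ 2 - 9 * T + 15))"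
    unfolding klein_theta_sum[OF n0 klein A1_def A2_def A4_def T] P ..
  finally have m1: "28 * (- 49 * E ^ 7 * C * E7 ^ 3) = 14 * E ^ 3 * (2 * (- 7 * E ^ 4 * E7 ^ 2) * (T ^ 2 - 9 * T + 15))"
    unfolding avg .
  have m2: "28 * (- 49 * E ^ 7 * C * E7 ^ 3) = (- 196 * E ^ 7 * E7 ^ 2) * (7 * C * E7)"
  proof -
    have "28 * (- 49 * e * c * (f * f * f)) = (- 196 * e * (f * f)) * (7 * c * f)" for e c f :: complex
      by simp
    then show ?thesis unfolding power3_eq_cube[of E7] power2_eq_square[of E7] .
  qed
  have m3: "14 * E ^ 3 * (2 * (- 7 * E ^ 4 * E7 ^ 2) * (T ^ 2 - 9 * T + 15)) = (- 196 * E ^ 7 * E7 ^ 2) * (T ^ 2 - 9 * T + 15)"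
  proof -
    have "14 * e * (2 * (- 7 * f * g) * t) = (- 196 * (e * f) * g) * t" for e f g t :: complex
      by simp
    moreover have "E ^ 3 * E ^ 4 = E ^ 7" by (simp add: power_add[symmetric])
    ultimately show ?thesis by (simp only:)
  qed
  have "(- 196 * E ^ 7 * E7 ^ 2) * (7 * C * E7) = (- 196 * E ^ 7 * E7 ^ 2) * (T ^ 2 - 9 * T + 15)"
    using m1 unfolding m2 m3 .
  then have "7 * C * E7 = T ^ 2 - 9 * T + 15"
  proof (rule mult_left_cancel[THEN iffD1, rotated])
    show "- 196 * E ^ 7 * E7 ^ 2 \<noteq> 0" using E0 by simp
  qed
  \<comment> \<open>At T = 8 + 49 k the polynomial T^2 - 9 T + 15 becomes 7 + 343 k + 2401 k^2, with
    all coefficients divisible by 7.\<close>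
  also have "\<dots> = 7 * (1 + 49 * (q * E7 ^ 4 / E ^ 4) + 343 * (q * E7 ^ 4 / E ^ 4) ^ 2)"
  proof -
    define k where "k = q * E7 ^ 4 / E ^ 4"
    have "T = 8 + 49 * k"
      by (simp add: T_def septic_T_zeta7[OF q] k_def E_def E7_def mult.assoc)
    then show ?thesis
      unfolding k_def[symmetric] by (simp add: algebra_simps power2_eq_square)
  qed
  finally have "7 * (C * E7) = 7 * (1 + 49 * (q * E7 ^ 4 / E ^ 4) + 343 * (q * E7 ^ 4 / E ^ 4) ^ 2)"
    by (simp only: mult.assoc)
  then have "C * E7 = 1 + 49 * (q * E7 ^ 4 / E ^ 4) + 343 * (q * E7 ^ 4 / E ^ 4) ^ 2"
    by (subst (asm) mult_left_cancel) auto
  then have "C = (1 + 49 * (q * E7 ^ 4 / E ^ 4) + 343 * (q * E7 ^ 4 / E ^ 4) ^ 2) / E7"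
    using E0 by (simp add: eq_divide_eq)
  also have "\<dots> = 1 / E7 + 49 * (q * E7 ^ 4 / E ^ 4 / E7) + 343 * ((q * E7 ^ 4 / E ^ 4) ^ 2 / E7)"
    by (simp add: add_divide_distrib)
  also have "q * E7 ^ 4 / E ^ 4 / E7 = q * (E7 ^ 3 / E ^ 4)"
    using E0 by (simp add: power_numeral_reduce)
  also have "(q * E7 ^ 4 / E ^ 4) ^ 2 / E7 = q ^ 2 * (E7 ^ 7 / E ^ 8)"
    using E0 by (simp add: power_numeral_reduce)
  finally show ?thesis by (simp add: C_def E_def E7_def mult.assoc)
qed

end

section \<open>The Lambert series, the Frobenius partitions and the ordinary partitions
  combined\<close>

theorem theorem3p2:
  fixes q :: complex
  assumes "norm q < 1"
  shows "(summable (\<lambda>n. of_nat (cphi 7 n) * q ^ n)) \<and>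
     (summable (\<lambda>k. of_int (Legendre (int (Suc k)) 7) *
           (of_nat (Suc k) ^ 2 * q ^ Suc k / (1 - q ^ Suc k)))) \<and>
     (summable (\<lambda>k. of_int (Legendre (int (Suc k)) 7) *
           ((q ^ Suc k + q ^ (2 * Suc k)) / (1 - q ^ Suc k) ^ 3))) \<and>
     (summable (\<lambda>j. of_nat (partition_number (7 * Suc j - 2)) * q ^ Suc j)) \<and>
     (CPhi 7 q =
           1 / qpoch_inf q q ^ 7 *
           (1 - 7 / 8 * (\<Sum>k. of_int (Legendre (int (Suc k)) 7) *
                               (of_nat (Suc k) ^ 2 * q ^ Suc k / (1 - q ^ Suc k)))
              + 343 / 8 * (\<Sum>k. of_int (Legendre (int (Suc k)) 7) *
                               ((q ^ Suc k + q ^ (2 * Suc k)) / (1 - q ^ Suc k) ^ 3)))) \<and>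
     (1 / qpoch_inf q q ^ 7 *
           (1 - 7 / 8 * (\<Sum>k. of_int (Legendre (int (Suc k)) 7) *
                               (of_nat (Suc k) ^ 2 * q ^ Suc k / (1 - q ^ Suc k)))
              + 343 / 8 * (\<Sum>k. of_int (Legendre (int (Suc k)) 7) *
                               ((q ^ Suc k + q ^ (2 * Suc k)) / (1 - q ^ Suc k) ^ 3))) =
         1 / qpoch_inf (q ^ 7) (q ^ 7)
           + 49 * q * (qpoch_inf (q ^ 7) (q ^ 7) ^ 3 / qpoch_inf q q ^ 4)
           + 343 * q ^ 2 * (qpoch_inf (q ^ 7) (q ^ 7) ^ 7 / qpoch_inf q q ^ 8)) \<and>
     (1 / qpoch_inf (q ^ 7) (q ^ 7)
           + 49 * q * (qpoch_inf (q ^ 7) (q ^ 7) ^ 3 / qpoch_inf q q ^ 4)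
           + 343 * q ^ 2 * (qpoch_inf (q ^ 7) (q ^ 7) ^ 7 / qpoch_inf q q ^ 8) =
         1 / qpoch_inf (q ^ 7) (q ^ 7)
           + 7 * (\<Sum>j. of_nat (partition_number (7 * Suc j - 2)) * q ^ Suc j))"
proof (cases "q = 0")
  \<comment> \<open>The theta series contains negative powers of q, so q = 0 is treated directly:
    every series reduces to its constant term.\<close>
  case True
  have "(\<lambda>n. of_nat (cphi 7 n) * (0 :: complex) ^ n) = (\<lambda>n. if n = 0 then 1 else 0)"
    by (auto simp: cphi_0)
  then have "(\<lambda>n. of_nat (cphi 7 n) * (0 :: complex) ^ n) sums 1"
    using sums_single[of 0 "\<lambda>_. 1 :: complex"] by simp
  moreover have "qpoch_inf 0 0 = 1"
    by (simp add: qpoch_inf_def)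
  ultimately show ?thesis
    unfolding True CPhi_def by (simp add: sums_iff)
next
  case False
  note q = assms False
  define E where "E = qpoch_inf q q"
  define E7 where "E7 = qpoch_inf (q ^ 7) (q ^ 7)"
  have E0: "E \<noteq> 0" "E7 \<noteq> 0"
    using qpoch_inf_self_nonzero[OF q(1)] qpoch_inf_self_nonzero[OF norm_power_less_1[OF q(1), of 7]]
    by (simp_all add: E_def E7_def)
  obtain A where "((\<lambda>k. of_int (Legendre (int (Suc k)) 7) * (of_nat (Suc k) ^ 2 * q ^ Suc k / (1 - q ^ Suc k))) has_sum A) UNIV"
    and A': "7 * A = 8 - 8 * (E ^ 7 / E7) - 49 * q * E ^ 3 * E7 ^ 3"
    unfolding E_def E7_def by (rule lambert_square_Legendre[OF q])
  then have A: "(\<lambda>k. of_int (Legendre (int (Suc k)) 7) * (of_nat (Suc k) ^ 2 * q ^ Suc k / (1 - q ^ Suc k))) sums A"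
    by (intro has_sum_imp_sums)
  define B where "B = q * E ^ 3 * E7 ^ 3 + 8 * q ^ 2 * E7 ^ 7 / E"
  have "(\<lambda>k. of_int (Legendre (int (Suc k)) 7) * lambert3 (q ^ Suc k)) sums B"
    using has_sum_imp_sums[OF lambert3_twisted(2)[OF q(1), of "\<lambda>m. of_int (Legendre (int (Suc m)) 7)", OF norm_Legendre_7]]
    unfolding lambert3_Legendre_sum[OF q] B_def E_def E7_def .
  moreover have "lambert3 (q ^ Suc k) = (q ^ Suc k + q ^ (2 * Suc k)) / (1 - q ^ Suc k) ^ 3" for k
  proof -
    have "q ^ (2 * Suc k) = q ^ Suc k * q ^ Suc k" by (simp only: mult_2 power_add)
    then show ?thesis by (simp only: lambert3_def distrib_left mult_1_right)
  qed
  ultimately have B: "(\<lambda>k. of_int (Legendre (int (Suc k)) 7) * ((q ^ Suc k + q ^ (2 * Suc k)) / (1 - q ^ Suc k) ^ 3)) sums B"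
    by (simp only:)
  define R where "R = 1 / E7 + 49 * q * (E7 ^ 3 / E ^ 4) + 343 * q ^ 2 * (E7 ^ 7 / E ^ 8)"
  have C: "(\<lambda>n. of_nat (cphi 7 n) * q ^ n) sums R"
    using has_sum_imp_sums[OF CPhi_frob_coeff[OF q]] unfolding frob_coeff_0[OF q] R_def E_def E7_def .
  have P: "(\<lambda>j. of_nat (partition_number (7 * Suc j - 2)) * q ^ Suc j) sums
      (7 * q * (E7 ^ 3 / E ^ 4) + 49 * q ^ 2 * (E7 ^ 7 / E ^ 8))"
    using has_sum_imp_sums[OF partition_7n_minus_2[OF q]] unfolding E_def E7_def .
  have "1 / E ^ 7 * (1 - 7 / 8 * A + 343 / 8 * B) = 1 / E ^ 7 * (1 - (7 * A) / 8 + 343 / 8 * B)"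
    by simp
  \<comment> \<open>The constant 8 of 7 A cancels the 1, the coefficients 49/8 and 343/8 of q E^3
    E_7^3 add up to 49, and the 8 in \<open>B\<close> leaves 343.\<close>
  also have "1 - (7 * A) / 8 + 343 / 8 * B = E ^ 7 / E7 + 49 * (q * E ^ 3 * E7 ^ 3) + 343 * (q ^ 2 * E7 ^ 7 / E)"
    unfolding A' B_def by (simp add: algebra_simps add_divide_distrib diff_divide_distrib)
  also have "1 / E ^ 7 * \<dots> = E ^ 7 / E7 / E ^ 7 + 49 * (q * E ^ 3 * E7 ^ 3 / E ^ 7) + 343 * (q ^ 2 * E7 ^ 7 / E / E ^ 7)"
    by (simp add: add_divide_distrib)
  also have "E ^ 7 / E7 / E ^ 7 = 1 / E7" using E0 by simp
  also have "q * E ^ 3 * E7 ^ 3 / E ^ 7 = q * (E7 ^ 3 / E ^ 4)" using E0 by (simp add: power_numeral_reduce)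
  also have "q ^ 2 * E7 ^ 7 / E / E ^ 7 = q ^ 2 * (E7 ^ 7 / E ^ 8)" using E0 by (simp add: power_numeral_reduce)
  also have "1 / E7 + 49 * (q * (E7 ^ 3 / E ^ 4)) + 343 * (q ^ 2 * (E7 ^ 7 / E ^ 8)) = R"
    by (simp add: R_def mult.assoc)
  finally have AB: "1 / E ^ 7 * (1 - 7 / 8 * A + 343 / 8 * B) = R" .
  have RP: "R = 1 / E7 + 7 * (7 * q * (E7 ^ 3 / E ^ 4) + 49 * q ^ 2 * (E7 ^ 7 / E ^ 8))"
    by (simp add: R_def algebra_simps)
  show ?thesis
    unfolding CPhi_def sums_unique[OF A, symmetric] sums_unique[OF B, symmetric] sums_unique[OF C, symmetric]
      sums_unique[OF P, symmetric] E_def[symmetric] E7_def[symmetric] R_def[symmetric] AB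
    using sums_summable[OF A] sums_summable[OF B] sums_summable[OF C] sums_summable[OF P] RP
    by (intro conjI refl)
qed

end
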